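(* For $\mathfrak g=\mathfrak{sp}_{2n}$ and $1\le k\le n$, $$S_k=\varpi(\Delta_{2k}[-1])+\sum_{1\le r<k}\binom{2n-2k+2r+1}{2r}\,\varpi\bigl(\tau^{2r}\Delta_{2k-2r}[-1]\bigr)\cdot1$$ is a Segal--Sugawara vector, i.e. $S_k\in\mathfrak z(\widehat{\mathfrak g})$.
   Context: $\mathfrak{sp}_{2n}\subset\mathfrak{gl}_{2n}$ is the linear span of $F_{ij}=E_{ij}-\epsilon_i\epsilon_jE_{j'i'}$, $i,j\in\{1,\dots,2n\}$, where $i'=2n-i+1$, $\epsilon_i=1$ for $i\le n$ and $\epsilon_i=-1$ for $i>n$. $\Delta_{2k}\in\mathcal S^{2k}(\mathfrak{sp}_{2n})^{\mathfrak{sp}_{2n}}$ is the sum of the principal $(2k\times2k)$-minors of the matrix $(F_{ij})$, computed in the commutative algebra $\mathcal S(\mathfrak{sp}_{2n})$. Put $\widehat{\mathfrak g}^-=t^{-1}\mathfrak g[t^{-1}]$, $x[a]=xt^a$. $\varpi$ is the symmetrisation map $\varpi(y_1\cdots y_m)=\frac1{m!}\sum_{\sigma\in S_m}y_{\sigma(1)}\cdots y_{\sigma(m)}$ from $\mathcal S(\widehat{\mathfrak g}^-)$ to $\mathcal U(\widehat{\mathfrak g}^-)$. For $F\in\mathcal S(\mathfrak g)$, $F[-1]\in\mathcal S(\mathfrak gt^{-1})$ is its image under $x\mapsto x[-1]$. The Feigin--Frenkel centre $\mathfrak z(\widehat{\mathfrak g})\subset\mathcal U(\widehat{\mathfrak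 g}^-)$ is the centre of the universal affine vertex algebra at the critical level (the space of $\mathfrak g[t]$-invariant vectors in the vacuum module at the critical level, identified as a vector space with $\mathcal U(\widehat{\mathfrak g}^-)$). By a theorem of Rybnikov it equals the centraliser in $\mathcal U(\widehat{\mathfrak g}^-)$ of $\mathcal H[-1]=\sum_i x_i[-1]x_i[-1]$, where $\{x_i\}$ is an orthonormal basis of $\mathfrak g$ for a non-degenerate $\mathfrak g$-invariant scalar product. Notation $\varpi(\tau^rF[-1])\cdot1$: let $\tau=-\partial_t$, so that $\tau x[a]-x[a]\tau=-a\,x[a-1]$ in the algebra generated by $\mathcal U(\widehat{\mathfrak g}^-)$ and $\tau$. For $F=y_1\cdots y_m$, $\varpi(\tau^rF[-1])$ is the average over all $(m+r)!$ orderings of the product of the $m+r$ factors $\tau,\dots,\tau$ ($r$ times), $y_1[-1],\dots,y_m[-1]$; $\varpi(\tau^rF[-1])\cdot1\in\mathcal U(\widehat{\mathfrak g}^-)$ is obtained by moving all $\tau$'s to the right and setting $\tau\cdot1=0$. Extend to all $F$ by linearity. *)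

theory Defs
  imports "HOL-Analysis.Analysis" "HOL-Library.Poly_Mapping"
begin

section \<open>Complex vector spaces, algebras and Lie algebras\<close>

class complex_vector = ab_group_add +
  fixes scaleC :: "complex \<Rightarrow> 'a \<Rightarrow> 'a" (infixr "*\<^sub>C" 75)
  assumes scaleC_add_right: "c *\<^sub>C (x + y) = c *\<^sub>C x + c *\<^sub>C y"
    and scaleC_add_left: "(c + d) *\<^sub>C x = c *\<^sub>C x + d *\<^sub>C x"
    and scaleC_scaleC [simp]: "c *\<^sub>C d *\<^sub>C x = (c * d) *\<^sub>C x"
    and scaleC_one [simp]: "1 *\<^sub>C x = x"

class complex_algebra_1 = complex_vector + ring_1 +
  assumes mult_scaleC_left [simp]: "(c *\<^sub>C x) * y = c *\<^sub>C (x * y)"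
    and mult_scaleC_right [simp]: "x * (c *\<^sub>C y) = c *\<^sub>C (x * y)"

class complex_lie_algebra = complex_vector +
  fixes lie_bracket :: "'a \<Rightarrow> 'a \<Rightarrow> 'a"
  assumes lie_bracket_add_left: "lie_bracket (x + y) z = lie_bracket x z + lie_bracket y z"
    and lie_bracket_add_right: "lie_bracket x (y + z) = lie_bracket x y + lie_bracket x z"
    and lie_bracket_scaleC_left: "lie_bracket (c *\<^sub>C x) y = c *\<^sub>C lie_bracket x y"
    and lie_bracket_scaleC_right: "lie_bracket x (c *\<^sub>C y) = c *\<^sub>C lie_bracket x y"
    and lie_bracket_self: "lie_bracket x x = 0"
    and jacobi: "lie_bracket x (lie_bracket y z) + lie_bracket y (lie_bracket z x)
      + lie_bracket z (lie_bracket x y) = 0"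

class quadratic_lie_algebra = complex_lie_algebra +
  fixes inv_form :: "'a \<Rightarrow> 'a \<Rightarrow> complex"
  assumes inv_form_add_left: "inv_form (x + y) z = inv_form x z + inv_form y z"
    and inv_form_scaleC_left: "inv_form (c *\<^sub>C x) y = c * inv_form x y"
    and inv_form_sym: "inv_form x y = inv_form y x"
    and inv_form_invariant: "inv_form (lie_bracket x y) z = inv_form x (lie_bracket y z)"

context complex_vector
begin

lemma scaleC_zero_right [simp]: "c *\<^sub>C 0 = 0"
  using scaleC_add_right[of c 0 0] by simp

lemma scaleC_zero_left [simp]: "0 *\<^sub>C x = 0"
  using scaleC_add_left[of 0 0 x] by simp

lemma scaleC_minus_right: "c *\<^sub>C (- x) = - (c *\<^sub>C x)"
  using scaleC_add_right[of c x "- x"] by (simp add: eq_neg_iff_add_eq_0 add.commute)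

lemma scaleC_diff_right: "c *\<^sub>C (x - y) = c *\<^sub>C x - c *\<^sub>C y"
  using scaleC_add_right[of c x "- y"] by (simp add: scaleC_minus_right)

lemma scaleC_minus_left: "(- c) *\<^sub>C x = - (c *\<^sub>C x)"
  using scaleC_add_left[of c "- c" x] by (simp add: eq_neg_iff_add_eq_0 add.commute)

lemma scaleC_sum_right: "c *\<^sub>C (\<Sum>i\<in>A. f i) = (\<Sum>i\<in>A. c *\<^sub>C f i)"
  by (induction A rule: infinite_finite_induct) (simp_all add: scaleC_add_right)

end

lemma lie_bracket_swap:
  fixes x y :: "'a::complex_lie_algebra"
  shows "lie_bracket x y = - lie_bracket y x"
proof -
  have "lie_bracket x y + lie_bracket y x = lie_bracket (x + y) (x + y)"
    using lie_bracket_self[of x] lie_bracket_self[of y]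
    by (simp only: lie_bracket_add_left lie_bracket_add_right) (simp add: add.commute)
  then have "lie_bracket x y + lie_bracket y x = 0"
    by (simp add: lie_bracket_self)
  then show ?thesis by (simp add: eq_neg_iff_add_eq_0)
qed

section \<open>The tensor algebra, the symmetric algebra and the enveloping algebra\<close>

text \<open>Words form a monoid under concatenation, so that finitely supported functions on words are the
  free associative algebra on the set \<open>'a\<close>; multilinearity in the letters is imposed by
  \<open>linear_relations\<close> below.\<close>

datatype 'a nc_word = NC_Word (letters: "'a list")

instantiation nc_word :: (type) monoid_add
begin

definition "zero_nc_word = NC_Word []"
definition "plus_nc_word v w = NC_Word (letters v @ letters w)"

instance
  by standard (simp_all add: zero_nc_word_def plus_nc_word_def)

end

type_synonym 'a free_alg = "'a nc_word \<Rightarrow>\<^sub>0 complex"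

definition free_gen :: "'a \<Rightarrow> 'a free_alg" where
  "free_gen x = Poly_Mapping.single (NC_Word [x]) 1"

inductive_set two_sided_ideal :: "'r::ring_1 set \<Rightarrow> 'r set" for R where
  zero: "0 \<in> two_sided_ideal R"
| gen: "r \<in> R \<Longrightarrow> a * r * b \<in> two_sided_ideal R"
| add: "x \<in> two_sided_ideal R \<Longrightarrow> y \<in> two_sided_ideal R \<Longrightarrow> x + y \<in> two_sided_ideal R"

inductive_set left_ideal :: "'r::ring_1 set \<Rightarrow> 'r set" for R where
  zero: "0 \<in> left_ideal R"
| gen: "r \<in> R \<Longrightarrow> a * r \<in> left_ideal R"
| add: "x \<in> left_ideal R \<Longrightarrow> y \<in> left_ideal R \<Longrightarrow> x + y \<in> left_ideal R"

inductive_set subalgebra :: "'r::complex_algebra_1 set \<Rightarrow> 'r set" for X where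
  scalar: "c *\<^sub>C 1 \<in> subalgebra X"
| gen: "x \<in> X \<Longrightarrow> x \<in> subalgebra X"
| add: "u \<in> subalgebra X \<Longrightarrow> v \<in> subalgebra X \<Longrightarrow> u + v \<in> subalgebra X"
| mult: "u \<in> subalgebra X \<Longrightarrow> v \<in> subalgebra X \<Longrightarrow> u * v \<in> subalgebra X"

definition linear_relations :: "'a::complex_vector free_alg set" where
  "linear_relations =
     {free_gen (x + y) - free_gen x - free_gen y | x y. True} \<union>
     {free_gen (c *\<^sub>C x) - Poly_Mapping.single 0 c * free_gen x | c x. True}"

definition symalg_relations :: "'a::complex_vector free_alg set" where
  "symalg_relations = linear_relations \<union>
     {free_gen x * free_gen y - free_gen y * free_gen x | x y. True}"

definition uea_relations :: "'a::complex_lie_algebra free_alg set" where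
  "uea_relations = linear_relations \<union>
     {free_gen x * free_gen y - free_gen y * free_gen x - free_gen (lie_bracket x y) | x y. True}"

lemma two_sided_ideal_mult_left: "x \<in> two_sided_ideal R \<Longrightarrow> a * x \<in> two_sided_ideal R"
proof (induction rule: two_sided_ideal.induct)
  case (gen r b c)
  then show ?case using two_sided_ideal.gen[of r R "a * b" c] by (simp add: mult.assoc)
qed (auto simp: distrib_left intro: two_sided_ideal.intros)

lemma two_sided_ideal_mult_right: "x \<in> two_sided_ideal R \<Longrightarrow> x * a \<in> two_sided_ideal R"
proof (induction rule: two_sided_ideal.induct)
  case (gen r b c)
  then show ?case using two_sided_ideal.gen[of r R b "c * a"] by (simp add: mult.assoc)
qed (auto simp: distrib_right intro: two_sided_ideal.intros)

lemma two_sided_ideal_minus: "x \<in> two_sided_ideal R \<Longrightarrow> - x \<in> two_sided_ideal R"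
  using two_sided_ideal_mult_left[of x R "- 1"] by simp

lemma two_sided_ideal_diff:
  "x \<in> two_sided_ideal R \<Longrightarrow> y \<in> two_sided_ideal R \<Longrightarrow> x - y \<in> two_sided_ideal R"
  using two_sided_ideal.add[OF _ two_sided_ideal_minus, of x R y] by simp

lemma two_sided_ideal_base: "r \<in> R \<Longrightarrow> r \<in> two_sided_ideal R"
  using two_sided_ideal.gen[of r R 1 1] by simp

lemma equivp_two_sided_ideal: "equivp (\<lambda>p q. p - q \<in> two_sided_ideal R)"
proof (rule equivpI)
  show "reflp (\<lambda>p q. p - q \<in> two_sided_ideal R)"
    by (auto simp: reflp_def intro: two_sided_ideal.zero)
  show "symp (\<lambda>p q. p - q \<in> two_sided_ideal R)"
    using two_sided_ideal_minus by (force simp: symp_def)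
  show "transp (\<lambda>p q. p - q \<in> two_sided_ideal R)"
    using two_sided_ideal.add by (force simp: transp_def)
qed

lemma two_sided_ideal_mult_cong:
  assumes "p - p' \<in> two_sided_ideal R" "q - q' \<in> two_sided_ideal R"
  shows "p * q - p' * q' \<in> two_sided_ideal R"
proof -
  have "p * q - p' * q' = (p - p') * q + p' * (q - q')" by (simp add: algebra_simps)
  then show ?thesis
    using assms by (auto intro: two_sided_ideal.add two_sided_ideal_mult_left two_sided_ideal_mult_right)
qed

lemma two_sided_ideal_add_cong:
  assumes "p - p' \<in> two_sided_ideal R" "q - q' \<in> two_sided_ideal R"
  shows "(p + q) - (p' + q') \<in> two_sided_ideal R"
  using two_sided_ideal.add[OF assms] by (simp add: algebra_simps)

lemma two_sided_ideal_diff_cong: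
  assumes "p - p' \<in> two_sided_ideal R" "q - q' \<in> two_sided_ideal R"
  shows "(p - q) - (p' - q') \<in> two_sided_ideal R"
  using two_sided_ideal_diff[OF assms] by (simp add: algebra_simps)

lemma two_sided_ideal_minus_cong:
  assumes "p - p' \<in> two_sided_ideal R"
  shows "(- p) - (- p') \<in> two_sided_ideal R"
  using two_sided_ideal_minus[OF assms] by (simp add: algebra_simps)

lemma poly_mapping_add_induct [case_names zero single add]:
  assumes "P 0" "\<And>a b. P (Poly_Mapping.single a b)" "\<And>f g. P f \<Longrightarrow> P g \<Longrightarrow> P (f + g)"
  shows "P (f :: 'a \<Rightarrow>\<^sub>0 'b::comm_monoid_add)"
proof (induction f rule: update_induct)
  case const
  then show ?case by (rule assms)
next
  case (update f a b)
  have "Poly_Mapping.update a b f = f + Poly_Mapping.single a b"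
    by (rule poly_mapping_eqI)
      (use update in \<open>auto simp: lookup_update lookup_add lookup_single when_def in_keys_iff\<close>)
  then show ?case using update assms by simp
qed

lemma single_zero_mult_commute:
  fixes p :: "'a free_alg"
  shows "Poly_Mapping.single 0 c * p = p * Poly_Mapping.single 0 c"
  by (induction p rule: poly_mapping_add_induct)
    (simp_all add: distrib_left distrib_right mult_single mult.commute)

lemma nc_word_add_eq_0_iff [simp]: "v + w = (0 :: 'a nc_word) \<longleftrightarrow> v = 0 \<and> w = 0"
  by (cases v; cases w) (simp add: zero_nc_word_def plus_nc_word_def)

lemma lookup_mult_0:
  fixes p q :: "'a free_alg"
  shows "Poly_Mapping.lookup (p * q) 0 = Poly_Mapping.lookup p 0 * Poly_Mapping.lookup q 0"
proof (induction p rule: poly_mapping_add_induct)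
  case (single v b)
  show ?case
    by (induction q rule: poly_mapping_add_induct)
      (auto simp: mult_single lookup_single when_def lookup_add distrib_left)
qed (simp_all add: lookup_add distrib_right)

lemma lookup_free_gen_0 [simp]: "Poly_Mapping.lookup (free_gen x) 0 = 0"
  by (simp add: free_gen_def lookup_single zero_nc_word_def)

lemma lookup_ideal_0:
  assumes "p \<in> two_sided_ideal R" "\<And>r. r \<in> R \<Longrightarrow> Poly_Mapping.lookup r 0 = 0"
  shows "Poly_Mapping.lookup (p :: 'a free_alg) 0 = 0"
  using assms(1) by induction (simp_all add: lookup_mult_0 assms(2) lookup_add)

lemma one_notin_symalg_ideal: "0 - 1 \<notin> two_sided_ideal symalg_relations"
proof
  assume "0 - 1 \<in> two_sided_ideal (symalg_relations :: 'a free_alg set)"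
  then have "Poly_Mapping.lookup (0 - 1 :: 'a free_alg) 0 = 0"
    by (rule lookup_ideal_0)
      (auto simp: symalg_relations_def linear_relations_def lookup_minus lookup_mult_0)
  then show False by (simp add: lookup_minus lookup_one)
qed

lemma one_notin_uea_ideal: "0 - 1 \<notin> two_sided_ideal uea_relations"
proof
  assume "0 - 1 \<in> two_sided_ideal (uea_relations :: 'a free_alg set)"
  then have "Poly_Mapping.lookup (0 - 1 :: 'a free_alg) 0 = 0"
    by (rule lookup_ideal_0)
      (auto simp: uea_relations_def linear_relations_def lookup_minus lookup_mult_0)
  then show False by (simp add: lookup_minus lookup_one)
qed

quotient_type (overloaded) 'a symalg =
  "'a::complex_vector free_alg" / "\<lambda>p q. p - q \<in> two_sided_ideal symalg_relations"
  by (rule equivp_two_sided_ideal)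

quotient_type (overloaded) 'a uea =
  "'a::complex_lie_algebra free_alg" / "\<lambda>p q. p - q \<in> two_sided_ideal uea_relations"
  by (rule equivp_two_sided_ideal)

instantiation symalg :: (complex_vector) complex_algebra_1
begin

lift_definition zero_symalg :: "'a symalg" is 0 .
lift_definition one_symalg :: "'a symalg" is 1 .
lift_definition plus_symalg :: "'a symalg \<Rightarrow> 'a symalg \<Rightarrow> 'a symalg" is "(+)"
  by (rule two_sided_ideal_add_cong)
lift_definition minus_symalg :: "'a symalg \<Rightarrow> 'a symalg \<Rightarrow> 'a symalg" is "(-)"
  by (rule two_sided_ideal_diff_cong)
lift_definition uminus_symalg :: "'a symalg \<Rightarrow> 'a symalg" is uminus
  by (rule two_sided_ideal_minus_cong)
lift_definition times_symalg :: "'a symalg \<Rightarrow> 'a symalg \<Rightarrow> 'a symalg" is "(*)"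
  by (rule two_sided_ideal_mult_cong)
lift_definition scaleC_symalg :: "complex \<Rightarrow> 'a symalg \<Rightarrow> 'a symalg"
  is "\<lambda>c p. Poly_Mapping.single 0 c * p"
  by (metis right_diff_distrib two_sided_ideal_mult_left)

instance
proof
  fix a b c :: "'a symalg" and \<alpha> \<beta> :: complex
  show "a + b + c = a + (b + c)" by transfer (simp add: add.assoc two_sided_ideal.zero)
  show "a + b = b + a" by transfer (simp add: add.commute two_sided_ideal.zero)
  show "0 + a = a" by transfer (simp add: two_sided_ideal.zero)
  show "- a + a = 0" by transfer (simp add: two_sided_ideal.zero)
  show "a - b = a + - b" by transfer (simp add: two_sided_ideal.zero)
  show "a * b * c = a * (b * c)" by transfer (simp add: mult.assoc two_sided_ideal.zero)
  show "1 * a = a" by transfer (simp add: two_sided_ideal.zero)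
  show "a * 1 = a" by transfer (simp add: two_sided_ideal.zero)
  show "(a + b) * c = a * c + b * c" by transfer (simp add: distrib_right two_sided_ideal.zero)
  show "a * (b + c) = a * b + a * c" by transfer (simp add: distrib_left two_sided_ideal.zero)
  show "\<alpha> *\<^sub>C (a + b) = \<alpha> *\<^sub>C a + \<alpha> *\<^sub>C b"
    by transfer (simp add: distrib_left two_sided_ideal.zero)
  show "(\<alpha> + \<beta>) *\<^sub>C a = \<alpha> *\<^sub>C a + \<beta> *\<^sub>C a"
    by transfer (simp add: single_add distrib_right two_sided_ideal.zero)
  show "\<alpha> *\<^sub>C \<beta> *\<^sub>C a = (\<alpha> * \<beta>) *\<^sub>C a"
    by transfer (simp add: mult_single mult.assoc[symmetric] two_sided_ideal.zero)
  show "1 *\<^sub>C a = a" by transfer (simp add: two_sided_ideal.zero)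
  show "(\<alpha> *\<^sub>C a) * b = \<alpha> *\<^sub>C (a * b)"
    by transfer (simp add: mult.assoc two_sided_ideal.zero)
  show "a * (\<alpha> *\<^sub>C b) = \<alpha> *\<^sub>C (a * b)"
  proof transfer
    fix p q :: "'a free_alg" and c
    have "p * (Poly_Mapping.single 0 c * q) = Poly_Mapping.single 0 c * (p * q)"
      using single_zero_mult_commute[of c p] by (simp add: mult.assoc[symmetric])
    then show "p * (Poly_Mapping.single 0 c * q) - Poly_Mapping.single 0 c * (p * q)
        \<in> two_sided_ideal symalg_relations"
      by (simp add: two_sided_ideal.zero)
  qed
  show "(0 :: 'a symalg) \<noteq> 1" by transfer (rule one_notin_symalg_ideal)
qed

end

instantiation uea :: (complex_lie_algebra) complex_algebra_1
begin

lift_definition zero_uea :: "'a uea" is 0 .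
lift_definition one_uea :: "'a uea" is 1 .
lift_definition plus_uea :: "'a uea \<Rightarrow> 'a uea \<Rightarrow> 'a uea" is "(+)"
  by (rule two_sided_ideal_add_cong)
lift_definition minus_uea :: "'a uea \<Rightarrow> 'a uea \<Rightarrow> 'a uea" is "(-)"
  by (rule two_sided_ideal_diff_cong)
lift_definition uminus_uea :: "'a uea \<Rightarrow> 'a uea" is uminus
  by (rule two_sided_ideal_minus_cong)
lift_definition times_uea :: "'a uea \<Rightarrow> 'a uea \<Rightarrow> 'a uea" is "(*)"
  by (rule two_sided_ideal_mult_cong)
lift_definition scaleC_uea :: "complex \<Rightarrow> 'a uea \<Rightarrow> 'a uea"
  is "\<lambda>c p. Poly_Mapping.single 0 c * p"
  by (metis right_diff_distrib two_sided_ideal_mult_left)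

instance
proof
  fix a b c :: "'a uea" and \<alpha> \<beta> :: complex
  show "a + b + c = a + (b + c)" by transfer (simp add: add.assoc two_sided_ideal.zero)
  show "a + b = b + a" by transfer (simp add: add.commute two_sided_ideal.zero)
  show "0 + a = a" by transfer (simp add: two_sided_ideal.zero)
  show "- a + a = 0" by transfer (simp add: two_sided_ideal.zero)
  show "a - b = a + - b" by transfer (simp add: two_sided_ideal.zero)
  show "a * b * c = a * (b * c)" by transfer (simp add: mult.assoc two_sided_ideal.zero)
  show "1 * a = a" by transfer (simp add: two_sided_ideal.zero)
  show "a * 1 = a" by transfer (simp add: two_sided_ideal.zero)
  show "(a + b) * c = a * c + b * c" by transfer (simp add: distrib_right two_sided_ideal.zero)
  show "a * (b + c) = a * b + a * c" by transfer (simp add: distrib_left two_sided_ideal.zero)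
  show "\<alpha> *\<^sub>C (a + b) = \<alpha> *\<^sub>C a + \<alpha> *\<^sub>C b"
    by transfer (simp add: distrib_left two_sided_ideal.zero)
  show "(\<alpha> + \<beta>) *\<^sub>C a = \<alpha> *\<^sub>C a + \<beta> *\<^sub>C a"
    by transfer (simp add: single_add distrib_right two_sided_ideal.zero)
  show "\<alpha> *\<^sub>C \<beta> *\<^sub>C a = (\<alpha> * \<beta>) *\<^sub>C a"
    by transfer (simp add: mult_single mult.assoc[symmetric] two_sided_ideal.zero)
  show "1 *\<^sub>C a = a" by transfer (simp add: two_sided_ideal.zero)
  show "(\<alpha> *\<^sub>C a) * b = \<alpha> *\<^sub>C (a * b)"
    by transfer (simp add: mult.assoc two_sided_ideal.zero)
  show "a * (\<alpha> *\<^sub>C b) = \<alpha> *\<^sub>C (a * b)"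
  proof transfer
    fix p q :: "'a free_alg" and c
    have "p * (Poly_Mapping.single 0 c * q) = Poly_Mapping.single 0 c * (p * q)"
      using single_zero_mult_commute[of c p] by (simp add: mult.assoc[symmetric])
    then show "p * (Poly_Mapping.single 0 c * q) - Poly_Mapping.single 0 c * (p * q)
        \<in> two_sided_ideal uea_relations"
      by (simp add: two_sided_ideal.zero)
  qed
  show "(0 :: 'a uea) \<noteq> 1" by transfer (rule one_notin_uea_ideal)
qed

end


lift_definition sym_gen :: "'a::complex_vector \<Rightarrow> 'a symalg" is free_gen .

lift_definition uea_gen :: "'a::complex_lie_algebra \<Rightarrow> 'a uea" is free_gen .

lemma sym_gen_add: "sym_gen (x + y) = sym_gen x + sym_gen y"
proof transfer
  fix x y :: 'a
  have "free_gen (x + y) - free_gen x - free_gen y \<in> two_sided_ideal symalg_relations"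
    by (rule two_sided_ideal_base, unfold symalg_relations_def linear_relations_def, blast)
  then show "free_gen (x + y) - (free_gen x + free_gen y) \<in> two_sided_ideal symalg_relations"
    by (simp add: algebra_simps)
qed

lemma sym_gen_scaleC: "sym_gen (c *\<^sub>C x) = c *\<^sub>C sym_gen x"
  by transfer (rule two_sided_ideal_base, unfold symalg_relations_def linear_relations_def, blast)

lemma sym_gen_commute: "sym_gen x * sym_gen y = sym_gen y * sym_gen x"
  by transfer (rule two_sided_ideal_base, unfold symalg_relations_def, blast)

lemma uea_gen_add: "uea_gen (x + y) = uea_gen x + uea_gen y"
proof transfer
  fix x y :: 'a
  have "free_gen (x + y) - free_gen x - free_gen y \<in> two_sided_ideal uea_relations"
    by (rule two_sided_ideal_base, unfold uea_relations_def linear_relations_def, blast)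
  then show "free_gen (x + y) - (free_gen x + free_gen y) \<in> two_sided_ideal uea_relations"
    by (simp add: algebra_simps)
qed

lemma uea_gen_scaleC: "uea_gen (c *\<^sub>C x) = c *\<^sub>C uea_gen x"
  by transfer (rule two_sided_ideal_base, unfold uea_relations_def linear_relations_def, blast)

lemma uea_gen_commutator: "uea_gen x * uea_gen y - uea_gen y * uea_gen x = uea_gen (lie_bracket x y)"
  by transfer (rule two_sided_ideal_base, unfold uea_relations_def, blast)

lemma single_eq_prod_list:
  "Poly_Mapping.single (NC_Word xs) c = Poly_Mapping.single 0 c * prod_list (map free_gen xs)"
proof (induction xs)
  case Nil
  then show ?case by (simp add: zero_nc_word_def)
next
  case (Cons x xs)
  have "Poly_Mapping.single (NC_Word (x # xs)) c = free_gen x * Poly_Mapping.single (NC_Word xs) c"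
    by (simp add: free_gen_def mult_single plus_nc_word_def)
  then show ?case
    by (simp add: Cons single_zero_mult_commute mult.assoc)
qed

lemma abs_symalg_single:
  "abs_symalg (Poly_Mapping.single (NC_Word xs) c) = c *\<^sub>C prod_list (map sym_gen xs)"
proof -
  have "abs_symalg (prod_list (map free_gen xs)) = prod_list (map sym_gen xs)"
    by (induction xs)
      (simp_all add: times_symalg.abs_eq[symmetric] one_symalg.abs_eq sym_gen.abs_eq)
  then show ?thesis
    by (simp add: single_eq_prod_list scaleC_symalg.abs_eq[symmetric])
qed

lemma abs_uea_single:
  "abs_uea (Poly_Mapping.single (NC_Word xs) c) = c *\<^sub>C prod_list (map uea_gen xs)"
proof -
  have "abs_uea (prod_list (map free_gen xs)) = prod_list (map uea_gen xs)"
    by (induction xs)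
      (simp_all add: times_uea.abs_eq[symmetric] one_uea.abs_eq uea_gen.abs_eq)
  then show ?thesis
    by (simp add: single_eq_prod_list scaleC_uea.abs_eq[symmetric])
qed

lemma symalg_induct [case_names zero monomial add]:
  assumes "P 0" "\<And>c xs. P (c *\<^sub>C prod_list (map sym_gen xs))" "\<And>u v. P u \<Longrightarrow> P v \<Longrightarrow> P (u + v)"
  shows "P (u :: 'a::complex_vector symalg)"
proof -
  have "P (abs_symalg p)" for p
  proof (induction p rule: poly_mapping_add_induct)
    case (single a b)
    then show ?case using assms(2)[of b "letters a"] by (simp add: abs_symalg_single[symmetric])
  qed (use assms in \<open>simp_all add: zero_symalg_def plus_symalg.abs_eq[symmetric]\<close>)
  from this[of "rep_symalg u"] show ?thesis by (simp add: Quotient_abs_rep[OF Quotient_symalg])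
qed

lemma uea_induct [case_names zero monomial add]:
  assumes "P 0" "\<And>c xs. P (c *\<^sub>C prod_list (map uea_gen xs))" "\<And>u v. P u \<Longrightarrow> P v \<Longrightarrow> P (u + v)"
  shows "P (u :: 'a::complex_lie_algebra uea)"
proof -
  have "P (abs_uea p)" for p
  proof (induction p rule: poly_mapping_add_induct)
    case (single a b)
    then show ?case using assms(2)[of b "letters a"] by (simp add: abs_uea_single[symmetric])
  qed (use assms in \<open>simp_all add: zero_uea_def plus_uea.abs_eq[symmetric]\<close>)
  from this[of "rep_uea u"] show ?thesis by (simp add: Quotient_abs_rep[OF Quotient_uea])
qed

instance symalg :: (complex_vector) comm_ring_1
proof
  fix u v :: "'a symalg"
  have gen: "sym_gen x * prod_list (map sym_gen ys) = prod_list (map sym_gen ys) * sym_gen x"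
    for x :: 'a and ys
  proof (induction ys)
    case (Cons y ys)
    have "sym_gen x * (sym_gen y * prod_list (map sym_gen ys))
        = sym_gen y * (sym_gen x * prod_list (map sym_gen ys))"
      by (simp only: mult.assoc[symmetric] sym_gen_commute[of x y])
    then show ?case by (simp add: Cons mult.assoc)
  qed simp
  have mono: "prod_list (map sym_gen xs) * prod_list (map sym_gen ys)
      = prod_list (map sym_gen ys) * prod_list (map sym_gen xs)" for xs ys :: "'a list"
  proof (induction xs)
    case (Cons x xs)
    have "prod_list (map sym_gen (x # xs)) * prod_list (map sym_gen ys)
        = (sym_gen x * prod_list (map sym_gen ys)) * prod_list (map sym_gen xs)"
      by (simp add: mult.assoc Cons)
    then show ?case by (simp add: gen mult.assoc)
  qed simp
  have mono': "(c *\<^sub>C prod_list (map sym_gen xs)) * v = v * (c *\<^sub>C prod_list (map sym_gen xs))"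
    for c and xs :: "'a list"
  proof (induction v rule: symalg_induct)
    case (monomial d ys)
    show ?case using mono[of xs ys] by (simp add: mult.commute[of c d])
  next
    case (add u v)
    then show ?case by (simp only: distrib_left distrib_right)
  qed simp
  show "u * v = v * u"
  proof (induction u rule: symalg_induct)
    case (add u w)
    then show ?case by (simp only: distrib_left distrib_right)
  qed (simp_all only: mono' mult_zero_left mult_zero_right)
qed (simp_all add: distrib_right)

section \<open>Linear maps given on words\<close>

definition lin_ext :: "('a list \<Rightarrow> 'b::complex_vector) \<Rightarrow> 'a free_alg \<Rightarrow> 'b" where
  "lin_ext f p = (\<Sum>w\<in>Poly_Mapping.keys p. Poly_Mapping.lookup p w *\<^sub>C f (letters w))"

lemma lin_ext_superset:
  assumes "finite A" "Poly_Mapping.keys p \<subseteq> A"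
  shows "lin_ext f p = (\<Sum>w\<in>A. Poly_Mapping.lookup p w *\<^sub>C f (letters w))"
  unfolding lin_ext_def using assms
  by (intro sum.mono_neutral_left) (auto simp: in_keys_iff)

lemma lin_ext_zero [simp]: "lin_ext f 0 = 0"
  by (simp add: lin_ext_def)

lemma lin_ext_add: "lin_ext f (p + q) = lin_ext f p + lin_ext f q"
proof -
  let ?A = "Poly_Mapping.keys p \<union> Poly_Mapping.keys q"
  have "finite ?A" "Poly_Mapping.keys (p + q) \<subseteq> ?A" by (simp_all add: keys_add)
  then show ?thesis
    by (simp add: lin_ext_superset[of ?A] lookup_add scaleC_add_left sum.distrib)
qed

lemma lin_ext_single [simp]: "lin_ext f (Poly_Mapping.single w c) = c *\<^sub>C f (letters w)"
  by (simp add: lin_ext_superset[of "{w}"])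

lemma lin_ext_minus: "lin_ext f (- p) = - lin_ext f p"
  using lin_ext_add[of f p "- p"] by (simp add: eq_neg_iff_add_eq_0 add.commute)

lemma lin_ext_diff: "lin_ext f (p - q) = lin_ext f p - lin_ext f q"
  using lin_ext_add[of f p "- q"] by (simp add: lin_ext_minus)

lemma lin_ext_scaleC: "lin_ext f (Poly_Mapping.single 0 c * p) = c *\<^sub>C lin_ext f p"
  by (induction p rule: poly_mapping_add_induct)
    (simp_all add: mult_single distrib_left lin_ext_add scaleC_add_right)

lemma lin_ext_ideal:
  assumes "\<And>r us vs. r \<in> R \<Longrightarrow>
    lin_ext f (Poly_Mapping.single (NC_Word us) 1 * r * Poly_Mapping.single (NC_Word vs) 1) = 0"
    and "p \<in> two_sided_ideal R"
  shows "lin_ext f p = 0"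
  using assms(2)
proof induction
  case (gen r a b)
  show ?case
  proof (induction a rule: poly_mapping_add_induct)
    case (single v c)
    show ?case
    proof (induction b rule: poly_mapping_add_induct)
      case (single w d)
      have v: "Poly_Mapping.single v c = Poly_Mapping.single 0 c * Poly_Mapping.single v 1"
        and w: "Poly_Mapping.single w d = Poly_Mapping.single 0 d * Poly_Mapping.single w 1"
        by (simp_all add: mult_single)
      have comm: "(Poly_Mapping.single v 1 * r) * Poly_Mapping.single 0 d
          = Poly_Mapping.single 0 d * (Poly_Mapping.single v 1 * r)"
        by (rule single_zero_mult_commute[symmetric])
      have "Poly_Mapping.single v c * r * Poly_Mapping.single w d
          = Poly_Mapping.single 0 c * (((Poly_Mapping.single v 1 * r) * Poly_Mapping.single 0 d)
              * Poly_Mapping.single w 1)"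
        by (subst v, subst w) (simp only: mult.assoc)
      also have "\<dots> = Poly_Mapping.single 0 c * (Poly_Mapping.single 0 d *
          (Poly_Mapping.single v 1 * r * Poly_Mapping.single w 1))"
        by (simp only: comm) (simp only: mult.assoc)
      finally have "Poly_Mapping.single v c * r * Poly_Mapping.single w d
          = Poly_Mapping.single 0 c * (Poly_Mapping.single 0 d *
              (Poly_Mapping.single v 1 * r * Poly_Mapping.single w 1))" .
      then show ?case
        using assms(1)[OF gen, of "letters v" "letters w"] by (simp add: lin_ext_scaleC)
    qed (simp_all add: distrib_left lin_ext_add)
  qed (simp_all add: distrib_right lin_ext_add)
qed (simp_all add: lin_ext_add)

definition multilinear_word :: "('a::complex_vector list \<Rightarrow> 'b::complex_vector) \<Rightarrow> bool" where
  "multilinear_word f \<longleftrightarrow>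
     (\<forall>us vs x y. f (us @ (x + y) # vs) = f (us @ x # vs) + f (us @ y # vs)) \<and>
     (\<forall>us vs c x. f (us @ (c *\<^sub>C x) # vs) = c *\<^sub>C f (us @ x # vs))"

lemma lin_ext_linear_relations:
  assumes "multilinear_word f" "r \<in> linear_relations"
  shows "lin_ext f (Poly_Mapping.single (NC_Word us) 1 * r * Poly_Mapping.single (NC_Word vs) 1) = 0"
  using assms unfolding linear_relations_def multilinear_word_def free_gen_def
  by (elim UnE CollectE exE conjE)
    (simp_all add: left_diff_distrib right_diff_distrib mult_single
      plus_nc_word_def zero_nc_word_def lin_ext_diff)

lemma lin_ext_abs_symalg:
  assumes "multilinear_word f" "\<And>us vs x y. f (us @ x # y # vs) = f (us @ y # x # vs)"
  shows "lin_ext f (rep_symalg (abs_symalg p)) = lin_ext f p"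
proof -
  have "rep_symalg (abs_symalg p) - p \<in> two_sided_ideal symalg_relations"
    using Quotient_rep_abs[OF Quotient_symalg] two_sided_ideal.zero by force
  then have "lin_ext f (rep_symalg (abs_symalg p) - p) = 0"
  proof (rule lin_ext_ideal[rotated])
    fix r :: "'a free_alg" and us vs
    assume r: "r \<in> symalg_relations"
    show "lin_ext f (Poly_Mapping.single (NC_Word us) 1 * r * Poly_Mapping.single (NC_Word vs) 1) = 0"
    proof (cases "r \<in> linear_relations")
      case True
      then show ?thesis by (rule lin_ext_linear_relations[OF assms(1)])
    next
      case False
      with r obtain x y where "r = free_gen x * free_gen y - free_gen y * free_gen x"
        by (auto simp: symalg_relations_def)
      then show ?thesis
        using assms(2)[of us x y vs]
        by (simp add: free_gen_def left_diff_distrib right_diff_distrib mult_single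
            plus_nc_word_def lin_ext_diff)
    qed
  qed
  then show ?thesis by (simp add: lin_ext_diff)
qed

lemma lin_ext_abs_uea:
  assumes "multilinear_word f"
    "\<And>us vs x y. f (us @ x # y # vs) - f (us @ y # x # vs) = f (us @ lie_bracket x y # vs)"
  shows "lin_ext f (rep_uea (abs_uea p)) = lin_ext f p"
proof -
  have "rep_uea (abs_uea p) - p \<in> two_sided_ideal uea_relations"
    using Quotient_rep_abs[OF Quotient_uea] two_sided_ideal.zero by force
  then have "lin_ext f (rep_uea (abs_uea p) - p) = 0"
  proof (rule lin_ext_ideal[rotated])
    fix r :: "'a free_alg" and us vs
    assume r: "r \<in> uea_relations"
    show "lin_ext f (Poly_Mapping.single (NC_Word us) 1 * r * Poly_Mapping.single (NC_Word vs) 1) = 0"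
    proof (cases "r \<in> linear_relations")
      case True
      then show ?thesis by (rule lin_ext_linear_relations[OF assms(1)])
    next
      case False
      with r obtain x y
        where "r = free_gen x * free_gen y - free_gen y * free_gen x - free_gen (lie_bracket x y)"
        by (auto simp: uea_relations_def)
      then show ?thesis
        using assms(2)[of us x y vs]
        by (simp add: free_gen_def left_diff_distrib right_diff_distrib mult_single
            plus_nc_word_def lin_ext_diff)
    qed
  qed
  then show ?thesis by (simp add: lin_ext_diff)
qed


section \<open>Symmetrisation\<close>

definition ordering_average :: "('a list \<Rightarrow> 'b::complex_vector) \<Rightarrow> 'a list \<Rightarrow> 'b" where
  "ordering_average g xs = (1 / fact (length xs)) *\<^sub>C
     (\<Sum>\<sigma> | \<sigma> permutes {..<length xs}. g (permute_list \<sigma> xs))"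

lemma ordering_average_mset_cong:
  assumes "mset xs = mset ys"
  shows "ordering_average g xs = ordering_average g ys"
proof -
  obtain \<pi> where \<pi>: "\<pi> permutes {..<length ys}" "permute_list \<pi> ys = xs"
    using mset_eq_permutation[OF assms] .
  have len: "length xs = length ys" using assms by (rule mset_eq_length)
  have "(\<Sum>\<sigma> | \<sigma> permutes {..<length ys}. g (permute_list \<sigma> ys))
      = (\<Sum>\<sigma> | \<sigma> permutes {..<length ys}. g (permute_list (\<pi> \<circ> \<sigma>) ys))"
    by (rule setum_permutations_compose_left[OF \<pi>(1)])
  also have "\<dots> = (\<Sum>\<sigma> | \<sigma> permutes {..<length ys}. g (permute_list \<sigma> xs))"
    using \<pi> by (intro sum.cong) (auto simp: permute_list_compose)
  finally show ?thesis by (simp add: ordering_average_def len)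
qed

lemma permute_list_slot:
  assumes "\<sigma> permutes {..<Suc (length us + length vs)}"
  obtains us' vs' where "\<And>z. permute_list \<sigma> (us @ z # vs) = us' @ z # vs'"
proof -
  let ?n = "Suc (length us + length vs)" and ?p = "length us"
  obtain q where q: "\<sigma> q = ?p" "q < ?n"
    using permutes_surj[OF assms] permutes_in_image[OF assms] by (metis less_add_Suc1 lessThan_iff surjD)
  have inj: "\<sigma> i = ?p \<longleftrightarrow> i = q" for i
    using q permutes_inj[OF assms] by (metis injD)
  let ?w = "permute_list \<sigma> (us @ undefined # vs)"
  have "permute_list \<sigma> (us @ z # vs) = take q ?w @ z # drop (Suc q) ?w" for z
  proof -
    have "permute_list \<sigma> (us @ z # vs) = ?w[q := z]"
    proof (rule nth_equalityI)
      fix i assume "i < length (permute_list \<sigma> (us @ z # vs))"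
      then have i: "i < ?n" by simp
      then have "permute_list \<sigma> (us @ z # vs) ! i = (us @ z # vs) ! \<sigma> i"
        "?w ! i = (us @ undefined # vs) ! \<sigma> i"
        by (simp_all add: permute_list_def del: upt_Suc)
      then show "permute_list \<sigma> (us @ z # vs) ! i = ?w[q := z] ! i"
        using i inj[of i] q by (cases "i = q") (auto simp: nth_append nth_Cons split: nat.split)
    qed simp
    also have "\<dots> = take q ?w @ z # drop (Suc q) ?w"
      using q by (simp add: upd_conv_take_nth_drop)
    finally show ?thesis .
  qed
  then show ?thesis by (rule that)
qed

lemma ordering_average_slot_add:
  assumes "\<And>us vs. g (us @ E (x + y) # vs) = g (us @ E x # vs) + g (us @ E y # vs)"
  shows "ordering_average g (us @ E (x + y) # vs)
    = ordering_average g (us @ E x # vs) + ordering_average g (us @ E y # vs)"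
proof -
  have "g (permute_list \<sigma> (us @ E (x + y) # vs))
      = g (permute_list \<sigma> (us @ E x # vs)) + g (permute_list \<sigma> (us @ E y # vs))"
    if \<sigma>: "\<sigma> permutes {..<Suc (length us + length vs)}" for \<sigma>
    by (rule permute_list_slot[OF \<sigma>]) (simp add: assms)
  then show ?thesis
    by (simp add: ordering_average_def sum.distrib scaleC_add_right)
qed

lemma ordering_average_slot_scaleC:
  assumes "\<And>us vs. g (us @ E (c *\<^sub>C x) # vs) = c *\<^sub>C g (us @ E x # vs)"
  shows "ordering_average g (us @ E (c *\<^sub>C x) # vs) = c *\<^sub>C ordering_average g (us @ E x # vs)"
proof -
  have "g (permute_list \<sigma> (us @ E (c *\<^sub>C x) # vs)) = c *\<^sub>C g (permute_list \<sigma> (us @ E x # vs))"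
    if \<sigma>: "\<sigma> permutes {..<Suc (length us + length vs)}" for \<sigma>
    by (rule permute_list_slot[OF \<sigma>]) (simp add: assms)
  then show ?thesis
    by (simp add: ordering_average_def scaleC_sum_right[symmetric] mult.commute)
qed

definition symmetrisation :: "'a::complex_lie_algebra symalg \<Rightarrow> 'a uea" where
  "symmetrisation F = lin_ext (ordering_average (\<lambda>zs. prod_list (map uea_gen zs))) (rep_symalg F)"

lemma symmetrisation_abs:
  "symmetrisation (abs_symalg p) = lin_ext (ordering_average (\<lambda>zs. prod_list (map uea_gen zs))) p"
  unfolding symmetrisation_def
proof (rule lin_ext_abs_symalg)
  show "multilinear_word (ordering_average (\<lambda>zs. prod_list (map (uea_gen :: 'a \<Rightarrow> _) zs)))"
    unfolding multilinear_word_def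
    by (intro conjI allI ordering_average_slot_add[where E = "\<lambda>x. x"]
        ordering_average_slot_scaleC[where E = "\<lambda>x. x"])
      (simp_all add: uea_gen_add uea_gen_scaleC distrib_left distrib_right)
qed (simp add: ordering_average_mset_cong)

lemma symmetrisation_add: "symmetrisation (F + G) = symmetrisation F + symmetrisation G"
proof -
  have "symmetrisation (abs_symalg p + abs_symalg q)
      = symmetrisation (abs_symalg p) + symmetrisation (abs_symalg q)" for p q :: "'a free_alg"
    by (simp add: plus_symalg.abs_eq symmetrisation_abs lin_ext_add)
  from this[of "rep_symalg F" "rep_symalg G"] show ?thesis
    by (simp add: Quotient_abs_rep[OF Quotient_symalg])
qed

lemma symmetrisation_monomial:
  "symmetrisation (c *\<^sub>C prod_list (map sym_gen ys)) = c *\<^sub>C ((1 / fact (length ys)) *\<^sub>C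
     (\<Sum>\<sigma> | \<sigma> permutes {..<length ys}. prod_list (map uea_gen (permute_list \<sigma> ys))))"
  by (simp add: abs_symalg_single[symmetric] symmetrisation_abs ordering_average_def
      del: scaleC_scaleC)

section \<open>Derivations of the enveloping algebra\<close>

fun leibniz_word :: "('a \<Rightarrow> 'a) \<Rightarrow> 'a::complex_lie_algebra list \<Rightarrow> 'a uea" where
  "leibniz_word D [] = 0"
| "leibniz_word D (x # xs) =
     uea_gen (D x) * prod_list (map uea_gen xs) + uea_gen x * leibniz_word D xs"

definition uea_derivation :: "('a \<Rightarrow> 'a) \<Rightarrow> 'a::complex_lie_algebra uea \<Rightarrow> 'a uea" where
  "uea_derivation D u = lin_ext (leibniz_word D) (rep_uea u)"

definition lie_derivation :: "('a::complex_lie_algebra \<Rightarrow> 'a) \<Rightarrow> bool" where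
  "lie_derivation D \<longleftrightarrow>
     (\<forall>x y. D (x + y) = D x + D y) \<and> (\<forall>c x. D (c *\<^sub>C x) = c *\<^sub>C D x) \<and>
     (\<forall>x y. D (lie_bracket x y) = lie_bracket (D x) y + lie_bracket x (D y))"

lemma leibniz_word_append:
  "leibniz_word D (us @ vs) =
     leibniz_word D us * prod_list (map uea_gen vs) + prod_list (map uea_gen us) * leibniz_word D vs"
  by (induction us) (simp_all add: algebra_simps)

lemma uea_derivation_abs:
  assumes "lie_derivation D"
  shows "uea_derivation D (abs_uea p) = lin_ext (leibniz_word D) p"
  unfolding uea_derivation_def
proof (rule lin_ext_abs_uea)
  show "multilinear_word (leibniz_word D)"
    using assms by (simp add: multilinear_word_def lie_derivation_def leibniz_word_append
        uea_gen_add uea_gen_scaleC distrib_left distrib_right scaleC_add_right)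
  fix us vs and x y :: 'a
  have br: "uea_gen x * (uea_gen y * v) - uea_gen y * (uea_gen x * v) = uea_gen (lie_bracket x y) * v"
    for x y :: 'a and v
    by (simp add: uea_gen_commutator[symmetric] left_diff_distrib mult.assoc)
  let ?U = "prod_list (map uea_gen us)" and ?dU = "leibniz_word D us"
    and ?V = "prod_list (map uea_gen vs)" and ?dV = "leibniz_word D vs"
  have "leibniz_word D (us @ x # y # vs) - leibniz_word D (us @ y # x # vs)
     = ?dU * (uea_gen x * (uea_gen y * ?V) - uea_gen y * (uea_gen x * ?V))
     + ?U * ((uea_gen (D x) * (uea_gen y * ?V) - uea_gen y * (uea_gen (D x) * ?V))
           + (uea_gen x * (uea_gen (D y) * ?V) - uea_gen (D y) * (uea_gen x * ?V))
           + (uea_gen x * (uea_gen y * ?dV) - uea_gen y * (uea_gen x * ?dV)))"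
    by (simp add: leibniz_word_append distrib_left right_diff_distrib)
  also have "\<dots> = leibniz_word D (us @ lie_bracket x y # vs)"
    using assms by (simp add: br leibniz_word_append lie_derivation_def uea_gen_add distrib_left distrib_right add.assoc)
  finally show "leibniz_word D (us @ x # y # vs) - leibniz_word D (us @ y # x # vs)
    = leibniz_word D (us @ lie_bracket x y # vs)" .
qed

lemma uea_derivation_add:
  assumes "lie_derivation D"
  shows "uea_derivation D (u + v) = uea_derivation D u + uea_derivation D v"
proof -
  have "uea_derivation D (abs_uea p + abs_uea q)
      = uea_derivation D (abs_uea p) + uea_derivation D (abs_uea q)" for p q
    using assms by (simp add: plus_uea.abs_eq uea_derivation_abs lin_ext_add)
  from this[of "rep_uea u" "rep_uea v"] show ?thesis
    by (simp add: Quotient_abs_rep[OF Quotient_uea])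
qed

lemma uea_derivation_zero [simp]:
  assumes "lie_derivation D"
  shows "uea_derivation D 0 = 0"
  using uea_derivation_add[OF assms, of 0 0] by simp

lemma uea_derivation_monomial:
  assumes "lie_derivation D"
  shows "uea_derivation D (c *\<^sub>C prod_list (map uea_gen xs)) = c *\<^sub>C leibniz_word D xs"
  using assms by (simp add: abs_uea_single[symmetric] uea_derivation_abs)

lemma uea_derivation_scaleC:
  assumes "lie_derivation D"
  shows "uea_derivation D (c *\<^sub>C u) = c *\<^sub>C uea_derivation D u"
proof -
  have "uea_derivation D (c *\<^sub>C abs_uea p) = c *\<^sub>C uea_derivation D (abs_uea p)" for p
    using assms by (simp add: scaleC_uea.abs_eq uea_derivation_abs lin_ext_scaleC)
  from this[of "rep_uea u"] show ?thesis
    by (simp add: Quotient_abs_rep[OF Quotient_uea])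
qed

lemma uea_derivation_one:
  assumes "lie_derivation D"
  shows "uea_derivation D 1 = 0"
  using uea_derivation_monomial[OF assms, of 1 "[]"] by simp

lemma uea_derivation_gen:
  assumes "lie_derivation D"
  shows "uea_derivation D (uea_gen x) = uea_gen (D x)"
  using uea_derivation_monomial[OF assms, of 1 "[x]"] by simp

lemma uea_derivation_mult:
  assumes "lie_derivation D"
  shows "uea_derivation D (u * v) = uea_derivation D u * v + u * uea_derivation D v"
proof (induction u rule: uea_induct)
  case (monomial c xs)
  show ?case
  proof (induction v rule: uea_induct)
    case (monomial d ys)
    have "(c *\<^sub>C prod_list (map uea_gen xs)) * (d *\<^sub>C prod_list (map uea_gen ys))
        = (c * d) *\<^sub>C prod_list (map uea_gen (xs @ ys))"
      by (simp add: mult.commute)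
    then show ?case
      by (simp only: uea_derivation_monomial[OF assms] leibniz_word_append)
        (simp add: scaleC_add_right mult.commute)
  qed (simp_all add: assms uea_derivation_add algebra_simps)
qed (simp_all add: assms uea_derivation_add algebra_simps)

section \<open>Affine Kac--Moody algebras\<close>

text \<open>\<open>Affine f c\<close> stands for \<open>\<Sum>\<^sub>a f\<^sub>a t\<^sup>a + c K\<close>, with \<open>K\<close> the central element.\<close>

context notes [[typedef_overloaded]]
begin

datatype 'g affine = Affine (loop_part: "int \<Rightarrow>\<^sub>0 'g::zero") (central_part: complex)

end

definition loop_scale :: "complex \<Rightarrow> (int \<Rightarrow>\<^sub>0 'g::complex_vector) \<Rightarrow> int \<Rightarrow>\<^sub>0 'g" where
  "loop_scale c f = Poly_Mapping.map (scaleC c) f"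

definition loop_bracket ::
  "(int \<Rightarrow>\<^sub>0 'g::complex_lie_algebra) \<Rightarrow> (int \<Rightarrow>\<^sub>0 'g) \<Rightarrow> int \<Rightarrow>\<^sub>0 'g" where
  "loop_bracket f g = (\<Sum>a\<in>Poly_Mapping.keys f. \<Sum>b\<in>Poly_Mapping.keys g.
     Poly_Mapping.single (a + b) (lie_bracket (Poly_Mapping.lookup f a) (Poly_Mapping.lookup g b)))"

definition loop_cocycle ::
  "(int \<Rightarrow>\<^sub>0 'g::quadratic_lie_algebra) \<Rightarrow> (int \<Rightarrow>\<^sub>0 'g) \<Rightarrow> complex" where
  "loop_cocycle f g = (\<Sum>a\<in>Poly_Mapping.keys f.
     of_int a * inv_form (Poly_Mapping.lookup f a) (Poly_Mapping.lookup g (- a)))"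

lemma lie_bracket_zero_left [simp]: "lie_bracket 0 (y :: 'g::complex_lie_algebra) = 0"
  using lie_bracket_add_left[of 0 0 y] by simp

lemma lie_bracket_zero_right [simp]: "lie_bracket (x :: 'g::complex_lie_algebra) 0 = 0"
  using lie_bracket_add_right[of x 0 0] by simp

lemma inv_form_zero_left [simp]: "inv_form 0 (y :: 'g::quadratic_lie_algebra) = 0"
  using inv_form_add_left[of 0 0 y] by simp

lemma inv_form_zero_right [simp]: "inv_form (x :: 'g::quadratic_lie_algebra) 0 = 0"
  using inv_form_zero_left[of x] by (simp add: inv_form_sym)

lemma inv_form_add_right:
  "inv_form (x :: 'g::quadratic_lie_algebra) (y + z) = inv_form x y + inv_form x z"
  by (metis inv_form_add_left inv_form_sym)

lemma inv_form_scaleC_right: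
  "inv_form (x :: 'g::quadratic_lie_algebra) (c *\<^sub>C y) = c * inv_form x y"
  by (metis inv_form_scaleC_left inv_form_sym)

lemma lookup_loop_scale [simp]:
  "Poly_Mapping.lookup (loop_scale c f) a = c *\<^sub>C Poly_Mapping.lookup f a"
  by (simp add: loop_scale_def map.rep_eq when_def)

lemma loop_scale_single [simp]:
  "loop_scale c (Poly_Mapping.single a x) = Poly_Mapping.single a (c *\<^sub>C x)"
  by (rule poly_mapping_eqI) (simp add: lookup_single when_def)

lemma loop_bracket_superset:
  assumes "finite A" "Poly_Mapping.keys f \<subseteq> A" "finite B" "Poly_Mapping.keys g \<subseteq> B"
  shows "loop_bracket f g = (\<Sum>a\<in>A. \<Sum>b\<in>B.
     Poly_Mapping.single (a + b) (lie_bracket (Poly_Mapping.lookup f a) (Poly_Mapping.lookup g b)))"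
proof -
  have "(\<Sum>b\<in>Poly_Mapping.keys g. Poly_Mapping.single (a + b)
        (lie_bracket (Poly_Mapping.lookup f a) (Poly_Mapping.lookup g b)))
      = (\<Sum>b\<in>B. Poly_Mapping.single (a + b)
        (lie_bracket (Poly_Mapping.lookup f a) (Poly_Mapping.lookup g b)))" for a
    using assms by (intro sum.mono_neutral_left) (auto simp: in_keys_iff)
  then show ?thesis unfolding loop_bracket_def using assms
    by (simp, intro sum.mono_neutral_left) (auto simp: in_keys_iff)
qed

lemma loop_bracket_add_left: "loop_bracket (f + g) h = loop_bracket f h + loop_bracket g h"
proof -
  let ?A = "Poly_Mapping.keys f \<union> Poly_Mapping.keys g"
  have "finite ?A" "Poly_Mapping.keys (f + g) \<subseteq> ?A" by (simp_all add: keys_add)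
  then show ?thesis
    by (simp add: loop_bracket_superset[of ?A _ "Poly_Mapping.keys h"] lookup_add
        lie_bracket_add_left single_add sum.distrib)
qed

lemma loop_bracket_add_right: "loop_bracket h (f + g) = loop_bracket h f + loop_bracket h g"
proof -
  let ?A = "Poly_Mapping.keys f \<union> Poly_Mapping.keys g"
  have "finite ?A" "Poly_Mapping.keys (f + g) \<subseteq> ?A" by (simp_all add: keys_add)
  then show ?thesis
    by (simp add: loop_bracket_superset[of "Poly_Mapping.keys h" _ ?A] lookup_add
        lie_bracket_add_right single_add sum.distrib)
qed

lemma loop_bracket_zero [simp]: "loop_bracket 0 g = 0" "loop_bracket f 0 = 0"
  by (simp_all add: loop_bracket_def)

lemma loop_bracket_single [simp]:
  "loop_bracket (Poly_Mapping.single a x) (Poly_Mapping.single b y)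
    = Poly_Mapping.single (a + b) (lie_bracket x y)"
  by (simp add: loop_bracket_superset[of "{a}" _ "{b}"])

lemma loop_scale_add [simp]: "loop_scale c (f + g) = loop_scale c f + loop_scale c g"
  by (rule poly_mapping_eqI) (simp add: lookup_add scaleC_add_right)

lemma loop_scale_zero [simp]: "loop_scale c 0 = 0"
  by (rule poly_mapping_eqI) simp

lemma loop_bracket_scale:
  "loop_bracket (loop_scale c f) g = loop_scale c (loop_bracket f g)"
  "loop_bracket f (loop_scale c g) = loop_scale c (loop_bracket f g)"
proof -
  have 1: "loop_bracket (loop_scale c (Poly_Mapping.single a x)) g
      = loop_scale c (loop_bracket (Poly_Mapping.single a x) g)" for a x
    by (induction g rule: poly_mapping_add_induct)
      (simp_all add: loop_bracket_add_right lie_bracket_scaleC_left del: loop_scale_single,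
        simp_all add: lie_bracket_scaleC_left)
  show "loop_bracket (loop_scale c f) g = loop_scale c (loop_bracket f g)"
    by (induction f rule: poly_mapping_add_induct)
      (simp_all add: loop_bracket_add_left 1 del: loop_scale_single)
  have 2: "loop_bracket f (loop_scale c (Poly_Mapping.single a x))
      = loop_scale c (loop_bracket f (Poly_Mapping.single a x))" for a x
    by (induction f rule: poly_mapping_add_induct)
      (simp_all add: loop_bracket_add_left lie_bracket_scaleC_right del: loop_scale_single,
        simp_all add: lie_bracket_scaleC_right)
  show "loop_bracket f (loop_scale c g) = loop_scale c (loop_bracket f g)"
    by (induction g rule: poly_mapping_add_induct)
      (simp_all add: loop_bracket_add_right 2 del: loop_scale_single)
qed

lemma loop_cocycle_superset:
  assumes "finite A" "Poly_Mapping.keys f \<subseteq> A"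
  shows "loop_cocycle f g =
    (\<Sum>a\<in>A. of_int a * inv_form (Poly_Mapping.lookup f a) (Poly_Mapping.lookup g (- a)))"
  unfolding loop_cocycle_def using assms by (intro sum.mono_neutral_left) (auto simp: in_keys_iff)

lemma loop_cocycle_add_left: "loop_cocycle (f + g) h = loop_cocycle f h + loop_cocycle g h"
proof -
  let ?A = "Poly_Mapping.keys f \<union> Poly_Mapping.keys g"
  have "finite ?A" "Poly_Mapping.keys (f + g) \<subseteq> ?A" by (simp_all add: keys_add)
  then show ?thesis
    by (simp add: loop_cocycle_superset[of ?A] lookup_add inv_form_add_left distrib_left sum.distrib)
qed

lemma loop_cocycle_add_right: "loop_cocycle h (f + g) = loop_cocycle h f + loop_cocycle h g"
  by (simp add: loop_cocycle_def lookup_add inv_form_add_right distrib_left sum.distrib)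

lemma loop_cocycle_zero [simp]: "loop_cocycle 0 g = 0" "loop_cocycle f 0 = 0"
  by (simp_all add: loop_cocycle_def)

lemma loop_cocycle_single [simp]:
  "loop_cocycle (Poly_Mapping.single a x) (Poly_Mapping.single b y)
    = (if a + b = 0 then of_int a * inv_form x y else 0)"
  by (auto simp: loop_cocycle_superset[of "{a}"] lookup_single when_def)

lemma loop_cocycle_scale:
  "loop_cocycle (loop_scale c f) g = c * loop_cocycle f g"
  "loop_cocycle f (loop_scale c g) = c * loop_cocycle f g"
proof -
  have "Poly_Mapping.keys (loop_scale c f) \<subseteq> Poly_Mapping.keys f"
    by (auto simp: in_keys_iff)
  then show "loop_cocycle (loop_scale c f) g = c * loop_cocycle f g"
    by (simp add: loop_cocycle_superset[of "Poly_Mapping.keys f"] inv_form_scaleC_left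
        sum_distrib_left mult.left_commute)
  show "loop_cocycle f (loop_scale c g) = c * loop_cocycle f g"
    by (simp add: loop_cocycle_def inv_form_scaleC_right sum_distrib_left mult.left_commute)
qed

lemma loop_bracket_swap: "loop_bracket f g = - loop_bracket g f"
proof -
  have 1: "loop_bracket (Poly_Mapping.single a x) g = - loop_bracket g (Poly_Mapping.single a x)" for a x
  proof (induction g rule: poly_mapping_add_induct)
    case (single b y)
    show ?case
      by (simp add: lie_bracket_swap[of x y] single_uminus[symmetric] add.commute)
  qed (simp_all add: loop_bracket_add_left loop_bracket_add_right)
  show ?thesis
    by (induction f rule: poly_mapping_add_induct)
      (simp_all add: 1 loop_bracket_add_left loop_bracket_add_right)
qed

lemma loop_cocycle_swap: "loop_cocycle f g = - loop_cocycle g f"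
proof -
  have 1: "loop_cocycle (Poly_Mapping.single a x) g = - loop_cocycle g (Poly_Mapping.single a x)" for a x
  proof (induction g rule: poly_mapping_add_induct)
    case (single b y)
    show ?case
      by (auto simp: inv_form_sym[of x y] add.commute add_eq_0_iff2)
  qed (simp_all add: loop_cocycle_add_left loop_cocycle_add_right)
  show ?thesis
    by (induction f rule: poly_mapping_add_induct)
      (simp_all add: 1 loop_cocycle_add_left loop_cocycle_add_right)
qed

lemma loop_jacobi:
  "loop_bracket f (loop_bracket g h) + loop_bracket g (loop_bracket h f)
    + loop_bracket h (loop_bracket f g) = 0"
proof (induction f rule: poly_mapping_add_induct)
  case (single a x)
  show ?case
  proof (induction g rule: poly_mapping_add_induct)
    case (single b y)
    show ?case
    proof (induction h rule: poly_mapping_add_induct)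
      case (single c z)
      have "Poly_Mapping.single (a + b + c) (lie_bracket x (lie_bracket y z)
          + lie_bracket y (lie_bracket z x) + lie_bracket z (lie_bracket x y)) = 0"
        by (simp add: jacobi)
      then show ?case by (simp add: single_add ac_simps)
    next
      case (add f g)
      show ?case
        using arg_cong2[where f = "(+)", OF add]
        by (simp add: loop_bracket_add_left loop_bracket_add_right ac_simps)
    qed simp
  next
    case (add f g)
    show ?case
      using arg_cong2[where f = "(+)", OF add]
      by (simp add: loop_bracket_add_left loop_bracket_add_right ac_simps)
  qed simp
next
  case (add f g)
  show ?case
    using arg_cong2[where f = "(+)", OF add]
    by (simp add: loop_bracket_add_left loop_bracket_add_right ac_simps)
qed simp

lemma loop_cocycle_jacobi:
  "loop_cocycle f (loop_bracket g h) + loop_cocycle g (loop_bracket h f)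
    + loop_cocycle h (loop_bracket f g) = 0"
proof (induction f rule: poly_mapping_add_induct)
  case (single a x)
  show ?case
  proof (induction g rule: poly_mapping_add_induct)
    case (single b y)
    show ?case
    proof (induction h rule: poly_mapping_add_induct)
      case (single c z)
      have y: "inv_form y (lie_bracket z x) = inv_form x (lie_bracket y z)"
        using inv_form_invariant[of x y z] inv_form_invariant[of y z x]
        by (metis inv_form_sym)
      have z: "inv_form z (lie_bracket x y) = inv_form x (lie_bracket y z)"
        by (metis inv_form_invariant inv_form_sym)
      have e: "b + (c + a) = a + (b + c)" "c + (a + b) = a + (b + c)" by simp_all
      have "of_int a * p + of_int b * p + of_int c * p = (of_int (a + (b + c)) * p :: complex)" for p
        by (simp add: algebra_simps)
      then have "of_int a * p + of_int b * p + of_int c * p = (0 :: complex)" if "a + (b + c) = 0" for p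
        using that by simp
      then show ?case by (simp add: loop_bracket_single loop_cocycle_single y z e del: of_int_add)
    next
      case (add f g)
      show ?case
        using arg_cong2[where f = "(+)", OF add]
        by (simp add: loop_bracket_add_left loop_bracket_add_right
            loop_cocycle_add_left loop_cocycle_add_right ac_simps)
    qed simp
  next
    case (add f g)
    show ?case
      using arg_cong2[where f = "(+)", OF add]
      by (simp add: loop_bracket_add_left loop_bracket_add_right
          loop_cocycle_add_left loop_cocycle_add_right ac_simps)
  qed simp
next
  case (add f g)
  show ?case
    using arg_cong2[where f = "(+)", OF add]
    by (simp add: loop_bracket_add_left loop_bracket_add_right
        loop_cocycle_add_left loop_cocycle_add_right ac_simps)
qed simp

instantiation affine :: (complex_vector) complex_vector
begin

definition "zero_affine = Affine 0 0"
definition "plus_affine X Y =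
  Affine (loop_part X + loop_part Y) (central_part X + central_part Y)"
definition "minus_affine X Y =
  Affine (loop_part X - loop_part Y) (central_part X - central_part Y)"
definition "uminus_affine X = Affine (- loop_part X) (- central_part X)"
definition "scaleC_affine c X = Affine (loop_scale c (loop_part X)) (c * central_part X)"

instance
proof
  fix X Y Z :: "'a affine" and c d :: complex
  show "c *\<^sub>C (X + Y) = c *\<^sub>C X + c *\<^sub>C Y"
    by (simp add: scaleC_affine_def plus_affine_def distrib_left)
  show "(c + d) *\<^sub>C X = c *\<^sub>C X + d *\<^sub>C X"
    by (auto simp: scaleC_affine_def plus_affine_def distrib_right lookup_add scaleC_add_left
        intro: poly_mapping_eqI)
  show "c *\<^sub>C d *\<^sub>C X = (c * d) *\<^sub>C X"
    by (auto simp: scaleC_affine_def intro: poly_mapping_eqI)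
  show "1 *\<^sub>C X = X"
    by (cases X) (auto simp: scaleC_affine_def intro: poly_mapping_eqI)
qed (simp_all add: zero_affine_def plus_affine_def minus_affine_def uminus_affine_def add.assoc
    add.commute)

end

instantiation affine :: (quadratic_lie_algebra) complex_lie_algebra
begin

definition "lie_bracket_affine X Y =
  Affine (loop_bracket (loop_part X) (loop_part Y)) (loop_cocycle (loop_part X) (loop_part Y))"

instance
proof
  fix X Y Z :: "'a affine" and c :: complex
  show "lie_bracket (X + Y) Z = lie_bracket X Z + lie_bracket Y Z"
    by (simp add: lie_bracket_affine_def plus_affine_def loop_bracket_add_left loop_cocycle_add_left)
  show "lie_bracket X (Y + Z) = lie_bracket X Y + lie_bracket X Z"
    by (simp add: lie_bracket_affine_def plus_affine_def loop_bracket_add_right loop_cocycle_add_right)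
  show "lie_bracket (c *\<^sub>C X) Y = c *\<^sub>C lie_bracket X Y"
    by (simp add: lie_bracket_affine_def scaleC_affine_def loop_bracket_scale loop_cocycle_scale)
  show "lie_bracket X (c *\<^sub>C Y) = c *\<^sub>C lie_bracket X Y"
    by (simp add: lie_bracket_affine_def scaleC_affine_def loop_bracket_scale loop_cocycle_scale)
  have self: "loop_bracket f f = 0" for f :: "int \<Rightarrow>\<^sub>0 'a"
  proof (induction f rule: poly_mapping_add_induct)
    case (add f g)
    then show ?case
      using loop_bracket_swap[of f g] by (simp add: loop_bracket_add_left loop_bracket_add_right)
  qed (simp_all add: lie_bracket_self)
  have "loop_cocycle f f = 0" for f :: "int \<Rightarrow>\<^sub>0 'a"
    using loop_cocycle_swap[of f f] by (simp add: eq_neg_iff_add_eq_0)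
  with self show "lie_bracket X X = 0"
    by (simp add: lie_bracket_affine_def zero_affine_def)
  show "lie_bracket X (lie_bracket Y Z) + lie_bracket Y (lie_bracket Z X)
      + lie_bracket Z (lie_bracket X Y) = 0"
    by (simp add: lie_bracket_affine_def plus_affine_def zero_affine_def loop_jacobi
        loop_cocycle_jacobi)
qed

end

definition loop_elem :: "'g::complex_vector \<Rightarrow> int \<Rightarrow> 'g affine" where
  "loop_elem x a = Affine (Poly_Mapping.single a x) 0"

definition central_elem :: "'g::complex_vector affine" where
  "central_elem = Affine 0 1"

lemma lie_bracket_loop_elem:
  "lie_bracket (loop_elem x a) (loop_elem y b) =
     loop_elem (lie_bracket x y) (a + b)
     + (if a + b = 0 then of_int a * inv_form x y else 0) *\<^sub>C central_elem"
  by (simp add: lie_bracket_affine_def loop_elem_def central_elem_def plus_affine_def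
      scaleC_affine_def)

lemma lie_bracket_central_elem: "lie_bracket central_elem X = 0"
  by (simp add: lie_bracket_affine_def central_elem_def zero_affine_def)

definition minus_dt :: "'g::complex_vector affine \<Rightarrow> 'g affine" where
  "minus_dt X = Affine (\<Sum>a\<in>Poly_Mapping.keys (loop_part X).
     Poly_Mapping.single (a - 1) (of_int (- a) *\<^sub>C Poly_Mapping.lookup (loop_part X) a)) 0"

lemma minus_dt_loop_elem: "minus_dt (loop_elem x a) = of_int (- a) *\<^sub>C loop_elem x (a - 1)"
  by (simp add: minus_dt_def loop_elem_def scaleC_affine_def scaleC_minus_left)

lemma minus_dt_central_elem: "minus_dt central_elem = 0"
  by (simp add: minus_dt_def central_elem_def zero_affine_def)

lemma affine_induct [case_names zero loop central add]:
  assumes "P 0" "\<And>x a. P (loop_elem x a)" "\<And>c. P (c *\<^sub>C central_elem)"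
    "\<And>X Y. P X \<Longrightarrow> P Y \<Longrightarrow> P (X + Y)"
  shows "P (X :: 'g::complex_vector affine)"
proof (cases X)
  case (Affine f c)
  have "P (Affine f 0)"
  proof (induction f rule: poly_mapping_add_induct)
    case (add f g)
    then show ?case using assms(4)[OF add] by (simp add: plus_affine_def)
  qed (use assms in \<open>simp_all add: zero_affine_def loop_elem_def\<close>)
  then show ?thesis
    using assms(4)[OF _ assms(3)[of c]] Affine
    by (force simp: plus_affine_def central_elem_def scaleC_affine_def)
qed

lemma minus_dt_add: "minus_dt (X + Y) = minus_dt X + minus_dt Y"
proof -
  have eq: "minus_dt X = Affine (\<Sum>a\<in>A.
      Poly_Mapping.single (a - 1) (of_int (- a) *\<^sub>C Poly_Mapping.lookup (loop_part X) a)) 0"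
    if "finite A" "Poly_Mapping.keys (loop_part X) \<subseteq> A" for A and X :: "'a affine"
    unfolding minus_dt_def affine.inject using that
    by (intro conjI sum.mono_neutral_left) (auto simp: in_keys_iff)
  let ?A = "Poly_Mapping.keys (loop_part X) \<union> Poly_Mapping.keys (loop_part Y)"
  have "finite ?A" "Poly_Mapping.keys (loop_part (X + Y)) \<subseteq> ?A"
    by (simp_all add: plus_affine_def keys_add)
  then show ?thesis
    by (simp add: eq[of ?A] plus_affine_def lookup_add scaleC_add_right single_add sum.distrib)
qed

lemma minus_dt_zero [simp]: "minus_dt 0 = 0"
  by (simp add: minus_dt_def zero_affine_def)

lemma minus_dt_scaleC: "minus_dt (c *\<^sub>C X) = c *\<^sub>C minus_dt X"
proof (induction X rule: affine_induct)
  case (loop x a)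
  have "c *\<^sub>C loop_elem x a = loop_elem (c *\<^sub>C x) a"
    by (simp add: loop_elem_def scaleC_affine_def)
  then show ?case
    by (simp only: minus_dt_loop_elem) (simp add: loop_elem_def scaleC_affine_def mult.commute)
next
  case (central d)
  show ?case by (simp add: minus_dt_def central_elem_def scaleC_affine_def)
qed (simp_all add: minus_dt_add scaleC_add_right)

lemma lie_derivation_minus_dt: "lie_derivation (minus_dt :: 'g::quadratic_lie_algebra affine \<Rightarrow> _)"
  unfolding lie_derivation_def
proof (intro conjI allI)
  fix X Y :: "'g affine" and c
  show "minus_dt (X + Y) = minus_dt X + minus_dt Y" by (rule minus_dt_add)
  show "minus_dt (c *\<^sub>C X) = c *\<^sub>C minus_dt X" by (rule minus_dt_scaleC)
  have cent: "lie_bracket Z (d *\<^sub>C central_elem) = 0" for Z :: "'g affine" and d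
    by (metis lie_bracket_central_elem lie_bracket_scaleC_right lie_bracket_swap neg_equal_zero
        neg_0_equal_iff_equal scaleC_zero_right)
  show "minus_dt (lie_bracket X Y) = lie_bracket (minus_dt X) Y + lie_bracket X (minus_dt Y)"
  proof (induction X rule: affine_induct)
    case (loop x a)
    show ?case
    proof (induction Y rule: affine_induct)
      case (loop y b)
      have "a - 1 + b = 0 \<longleftrightarrow> b = 1 - a" "a + (b - 1) = 0 \<longleftrightarrow> b = 1 - a" by auto
      then show ?case
        by (simp add: lie_bracket_loop_elem minus_dt_loop_elem minus_dt_add minus_dt_scaleC
            minus_dt_central_elem lie_bracket_scaleC_left lie_bracket_scaleC_right)
          (simp add: loop_elem_def central_elem_def plus_affine_def scaleC_affine_def
            single_add[symmetric] scaleC_add_left[symmetric] algebra_simps)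
    qed (simp_all add: cent minus_dt_add lie_bracket_add_right minus_dt_scaleC
        minus_dt_central_elem algebra_simps)
  next
    case (central d)
    show ?case
      by (simp add: lie_bracket_scaleC_left lie_bracket_central_elem minus_dt_scaleC
          minus_dt_central_elem)
  qed (simp_all add: minus_dt_add lie_bracket_add_left algebra_simps)
qed

section \<open>The Feigin--Frenkel centre\<close>

text \<open>By the Poincare--Birkhoff--Witt theorem, the subalgebra generated by \<open>t\<^sup>-\<^sup>1\<gg>[t\<^sup>-\<^sup>1]\<close> is its
  enveloping algebra, and it is a complement in the full enveloping algebra to the left ideal
  \<open>vacuum_ideal \<kappa>\<close>, the quotient by which is the vacuum module at level \<open>\<kappa>\<close>. An element of the
  subalgebra thus represents a unique vector of the vacuum module, and that vector is annihilated by
  \<open>\<gg>[t]\<close> iff left multiplication by \<open>\<gg>[t]\<close> sends the element into the left ideal.\<close>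

definition negative_subalgebra :: "'g::quadratic_lie_algebra affine uea set" where
  "negative_subalgebra = subalgebra {uea_gen (loop_elem x a) | x a. a < 0}"

definition vacuum_ideal :: "complex \<Rightarrow> 'g::quadratic_lie_algebra affine uea set" where
  "vacuum_ideal \<kappa> = left_ideal
     ({uea_gen (loop_elem x a) | x a. a \<ge> 0} \<union> {uea_gen central_elem - \<kappa> *\<^sub>C 1})"

definition vacuum_invariants :: "complex \<Rightarrow> 'g::quadratic_lie_algebra affine uea set" where
  "vacuum_invariants \<kappa> = {u \<in> negative_subalgebra.
     \<forall>x a. a \<ge> 0 \<longrightarrow> uea_gen (loop_elem x a) * u \<in> vacuum_ideal \<kappa>}"

section \<open>Symmetrisation with powers of \<open>\<tau> = -\<partial>\<^sub>t\<close>\<close>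

definition at_minus_one :: "'g::complex_vector symalg \<Rightarrow> 'g affine symalg" where
  "at_minus_one F =
     lin_ext (\<lambda>ys. prod_list (map (\<lambda>y. sym_gen (loop_elem y (- 1))) ys)) (rep_symalg F)"

lemma loop_elem_add: "loop_elem (x + y) a = loop_elem x a + loop_elem y a"
  by (simp add: loop_elem_def plus_affine_def single_add)

lemma loop_elem_scaleC: "loop_elem (c *\<^sub>C x) a = c *\<^sub>C loop_elem x a"
  by (simp add: loop_elem_def scaleC_affine_def)

lemma at_minus_one_abs:
  "at_minus_one (abs_symalg p) =
     lin_ext (\<lambda>ys. prod_list (map (\<lambda>y. sym_gen (loop_elem y (- 1))) ys)) p"
  unfolding at_minus_one_def
  by (rule lin_ext_abs_symalg)
    (simp_all add: multilinear_word_def loop_elem_add loop_elem_scaleC sym_gen_add sym_gen_scaleC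
      distrib_left distrib_right mult.left_commute)

lemma at_minus_one_add: "at_minus_one (F + G) = at_minus_one F + at_minus_one G"
proof -
  have "at_minus_one (abs_symalg p + abs_symalg q)
      = at_minus_one (abs_symalg p) + at_minus_one (abs_symalg q)" for p q :: "'a free_alg"
    by (simp add: plus_symalg.abs_eq at_minus_one_abs lin_ext_add)
  from this[of "rep_symalg F" "rep_symalg G"] show ?thesis
    by (simp add: Quotient_abs_rep[OF Quotient_symalg])
qed

lemma at_minus_one_monomial:
  "at_minus_one (c *\<^sub>C prod_list (map sym_gen ys)) =
     c *\<^sub>C prod_list (map sym_gen (map (\<lambda>y. loop_elem y (- 1)) ys))"
  by (simp add: abs_symalg_single[symmetric] at_minus_one_abs o_def)

lemma at_minus_one_zero [simp]: "at_minus_one 0 = 0"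
  using at_minus_one_add[of 0 0] by simp

lemma at_minus_one_mult: "at_minus_one (F * G) = at_minus_one F * at_minus_one G"
proof (induction F rule: symalg_induct)
  case zero
  show ?case by simp
next
  case (monomial c xs)
  show ?case
  proof (induction G rule: symalg_induct)
    case zero
    show ?case by simp
  next
    case (monomial d ys)
    have "(c *\<^sub>C prod_list (map sym_gen xs)) * (d *\<^sub>C prod_list (map sym_gen ys))
        = (c * d) *\<^sub>C prod_list (map sym_gen (xs @ ys))"
      by (simp add: mult.commute)
    then show ?case
      by (simp only: at_minus_one_monomial) (simp add: mult.commute)
  qed (simp only: at_minus_one_add distrib_left)
qed (simp only: at_minus_one_add distrib_right)

text \<open>A list over \<open>'g affine option\<close> is a product of the operators \<open>\<tau>\<close> (\<open>None\<close>) and \<open>y\<close> (\<open>Some y\<close>).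
  Moving every \<open>\<tau>\<close> to the right and putting \<open>\<tau> \<cdot> 1 = 0\<close> amounts to letting \<open>y\<close> act by left
  multiplication and \<open>\<tau>\<close> as the derivation with \<open>\<tau>(x[a]) = -a x[a-1]\<close>, and applying the product
  to 1.\<close>

definition tau :: "'g::quadratic_lie_algebra affine uea \<Rightarrow> 'g affine uea" where
  "tau = uea_derivation minus_dt"

fun tau_product :: "'g::quadratic_lie_algebra affine option list \<Rightarrow> 'g affine uea" where
  "tau_product [] = 1"
| "tau_product (None # zs) = tau (tau_product zs)"
| "tau_product (Some y # zs) = uea_gen y * tau_product zs"

text \<open>For \<open>F = y\<^sub>1 \<cdots> y\<^sub>m\<close> this is \<open>\<varpi>(\<tau>\<^sup>r F) \<cdot> 1\<close>.\<close>

definition symmetrisation_tau ::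
  "nat \<Rightarrow> 'g::quadratic_lie_algebra affine symalg \<Rightarrow> 'g affine uea" where
  "symmetrisation_tau r F =
     lin_ext (\<lambda>ys. ordering_average tau_product (replicate r None @ map Some ys)) (rep_symalg F)"

lemma tau_zero [simp]: "tau 0 = 0"
  and tau_one: "tau 1 = 0"
  and tau_add: "tau (u + v) = tau u + tau v"
  and tau_scaleC: "tau (c *\<^sub>C u) = c *\<^sub>C tau u"
  and tau_mult: "tau (u * v) = tau u * v + u * tau v"
  by (simp_all add: tau_def lie_derivation_minus_dt uea_derivation_one uea_derivation_add
      uea_derivation_scaleC uea_derivation_mult)

lemma tau_loop_elem: "tau (uea_gen (loop_elem x a)) = of_int (- a) *\<^sub>C uea_gen (loop_elem x (a - 1))"
  by (simp only: tau_def uea_derivation_gen[OF lie_derivation_minus_dt] minus_dt_loop_elem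
      uea_gen_scaleC)

lemma tau_product_slot_add:
  "tau_product (us @ Some (x + y) # vs) = tau_product (us @ Some x # vs) + tau_product (us @ Some y # vs)"
  by (induction us rule: tau_product.induct)
    (simp_all add: uea_gen_add tau_add distrib_left distrib_right)

lemma tau_product_slot_scaleC:
  "tau_product (us @ Some (c *\<^sub>C x) # vs) = c *\<^sub>C tau_product (us @ Some x # vs)"
  by (induction us rule: tau_product.induct) (simp_all add: uea_gen_scaleC tau_scaleC)

lemma symmetrisation_tau_abs:
  "symmetrisation_tau r (abs_symalg p) =
     lin_ext (\<lambda>ys. ordering_average tau_product (replicate r None @ map Some ys)) p"
  unfolding symmetrisation_tau_def
proof (rule lin_ext_abs_symalg)
  have "ordering_average tau_product (us @ Some (x + y) # vs)
      = ordering_average tau_product (us @ Some x # vs) + ordering_average tau_product (us @ Some y # vs)"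
    for us vs and x y :: "'a affine"
    by (rule ordering_average_slot_add) (rule tau_product_slot_add)
  moreover have "ordering_average tau_product (us @ Some (c *\<^sub>C x) # vs)
      = c *\<^sub>C ordering_average tau_product (us @ Some x # vs)"
    for us vs c and x :: "'a affine"
    by (rule ordering_average_slot_scaleC) (rule tau_product_slot_scaleC)
  ultimately show "multilinear_word
    (\<lambda>ys. ordering_average tau_product (replicate r None @ map Some (ys :: 'a affine list)))"
    by (simp add: multilinear_word_def append_assoc[symmetric] del: append_assoc)
qed (simp add: ordering_average_mset_cong)

lemma symmetrisation_tau_add:
  "symmetrisation_tau r (F + G) = symmetrisation_tau r F + symmetrisation_tau r G"
proof -
  have "symmetrisation_tau r (abs_symalg p + abs_symalg q)
      = symmetrisation_tau r (abs_symalg p) + symmetrisation_tau r (abs_symalg q)"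
    for p q :: "'a affine free_alg"
    by (simp add: plus_symalg.abs_eq symmetrisation_tau_abs lin_ext_add)
  from this[of "rep_symalg F" "rep_symalg G"] show ?thesis
    by (simp add: Quotient_abs_rep[OF Quotient_symalg])
qed

lemma symmetrisation_tau_monomial:
  "symmetrisation_tau r (c *\<^sub>C prod_list (map sym_gen ys)) = c *\<^sub>C ((1 / fact (r + length ys)) *\<^sub>C
     (\<Sum>\<sigma> | \<sigma> permutes {..<r + length ys}.
        tau_product (permute_list \<sigma> (replicate r None @ map Some ys))))"
  by (simp add: abs_symalg_single[symmetric] symmetrisation_tau_abs ordering_average_def
      del: scaleC_scaleC)

section \<open>The symplectic Lie algebra\<close>

instantiation complex :: complex_vector
begin

definition scaleC_complex :: "complex \<Rightarrow> complex \<Rightarrow> complex" where "scaleC_complex = (*)"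

instance
  by standard (simp_all add: scaleC_complex_def algebra_simps)

end

instantiation vec :: (complex_vector, finite) complex_vector
begin

definition "scaleC_vec c v = (\<chi> i. c *\<^sub>C v $ i)"

instance
  by standard (simp_all add: scaleC_vec_def vec_eq_iff scaleC_add_left scaleC_add_right)

end

lemma scaleC_vec_component [simp]: "(c *\<^sub>C v) $ i = c *\<^sub>C v $ i"
  by (simp add: scaleC_vec_def)

text \<open>The index set \<open>{1, \<dots>, 2n}\<close>, where \<open>n = CARD('n)\<close>.\<close>

typedef ('n::finite) idx = "{1..2 * CARD('n)}"
proof -
  have "CARD('n) > 0" by (rule zero_less_card_finite)
  then have "1 \<in> {1..2 * CARD('n)}" by simp
  then show ?thesis by blast
qed

instance idx :: (finite) finite
proof
  have "inj (Rep_idx :: 'a idx \<Rightarrow> nat)" by (simp add: inj_def Rep_idx_inject)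
  moreover have "finite (range (Rep_idx :: 'a idx \<Rightarrow> nat))"
    by (rule finite_subset[of _ "{1..2 * CARD('a)}"]) (use Rep_idx[where 'n = 'a] in blast, simp)
  ultimately show "finite (UNIV :: 'a idx set)" by (metis finite_imageD)
qed

definition idx_prime :: "'n::finite idx \<Rightarrow> 'n idx" where
  "idx_prime i = Abs_idx (2 * CARD('n) + 1 - Rep_idx i)"

definition idx_sign :: "'n::finite idx \<Rightarrow> complex" where
  "idx_sign i = (if Rep_idx i \<le> CARD('n) then 1 else - 1)"

definition matrix_unit :: "'i \<Rightarrow> 'i \<Rightarrow> complex^'i^'i" where
  "matrix_unit i j = (\<chi> a b. if a = i \<and> b = j then 1 else 0)"

definition F_matrix :: "'n::finite idx \<Rightarrow> 'n idx \<Rightarrow> complex^'n idx^'n idx" where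
  "F_matrix i j = matrix_unit i j
     - (idx_sign i * idx_sign j) *\<^sub>C matrix_unit (idx_prime j) (idx_prime i)"

typedef ('n::finite) sp =
  "{A :: complex^'n idx^'n idx. \<exists>c. A = (\<Sum>i\<in>UNIV. \<Sum>j\<in>UNIV. c i j *\<^sub>C F_matrix i j)}"
  by blast

lemma Rep_idx_prime: "Rep_idx (idx_prime (i :: 'n::finite idx)) = 2 * CARD('n) + 1 - Rep_idx i"
  unfolding idx_prime_def using Rep_idx[of i] by (subst Abs_idx_inverse) auto

lemma idx_prime_prime [simp]: "idx_prime (idx_prime i) = i"
  using Rep_idx[of i] by (simp add: Rep_idx_inject[symmetric] Rep_idx_prime)

lemma idx_prime_eq_iff: "a = idx_prime b \<longleftrightarrow> b = idx_prime a"
  by (metis idx_prime_prime)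

lemma idx_sign_prime [simp]: "idx_sign (idx_prime i) = - idx_sign i"
  using Rep_idx[of i] by (auto simp: idx_sign_def Rep_idx_prime)

lemma idx_sign_square [simp]: "idx_sign i * idx_sign i = 1" "idx_sign i * (idx_sign i * z) = z"
  by (simp_all add: idx_sign_def)

lemma F_matrix_component:
  "F_matrix i j $ a $ b = (if a = i \<and> b = j then 1 else 0)
     - idx_sign a * idx_sign b * (if idx_prime b = i \<and> idx_prime a = j then 1 else 0)"
  by (auto simp: F_matrix_def matrix_unit_def scaleC_complex_def idx_prime_eq_iff[of a]
      idx_prime_eq_iff[of b] mult.commute)

lemma F_matrix_sum_component:
  fixes c :: "'n::finite idx \<Rightarrow> 'n idx \<Rightarrow> complex"
  shows "(\<Sum>i\<in>UNIV. \<Sum>j\<in>UNIV. c i j *\<^sub>C F_matrix i j) $ a $ b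
    = c a b - idx_sign a * idx_sign b * c (idx_prime b) (idx_prime a)"
proof -
  have delta: "(\<Sum>i\<in>UNIV. \<Sum>j\<in>UNIV. c i j * (if p = i \<and> q = j then 1 else 0)) = c p q"
    for c :: "'n idx \<Rightarrow> 'n idx \<Rightarrow> complex" and p q
  proof -
    have "(\<Sum>j\<in>UNIV. c i j * (if p = i \<and> q = j then 1 else 0)) = (if p = i then c i q else 0)" for i
      by (auto simp: if_distrib[of "(*) _"] cong: if_cong)
    then show ?thesis by simp
  qed
  have "(\<Sum>i\<in>UNIV. \<Sum>j\<in>UNIV. c i j *\<^sub>C F_matrix i j) $ a $ b
      = (\<Sum>i\<in>UNIV. \<Sum>j\<in>UNIV. c i j * (if a = i \<and> b = j then 1 else 0))
      - idx_sign a * idx_sign b *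
        (\<Sum>i\<in>UNIV. \<Sum>j\<in>UNIV. c i j * (if idx_prime b = i \<and> idx_prime a = j then 1 else 0))"
    by (simp add: F_matrix_component scaleC_complex_def right_diff_distrib sum_subtractf
        sum_distrib_left mult.left_commute mult.assoc)
  then show ?thesis by (simp only: delta)
qed

lemma mem_sp_iff:
  "(\<exists>c. A = (\<Sum>i\<in>UNIV. \<Sum>j\<in>UNIV. c i j *\<^sub>C F_matrix i j)) \<longleftrightarrow>
     (\<forall>a b. A $ a $ b = - idx_sign a * idx_sign b * A $ idx_prime b $ idx_prime a)"
  (is "?L \<longleftrightarrow> ?R")
proof
  assume ?L
  then obtain c where A: "A = (\<Sum>i\<in>UNIV. \<Sum>j\<in>UNIV. c i j *\<^sub>C F_matrix i j)" ..
  show ?R unfolding A F_matrix_sum_component by (simp add: algebra_simps)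
next
  assume R: ?R
  have "A = (\<Sum>i\<in>UNIV. \<Sum>j\<in>UNIV. (A $ i $ j / 2) *\<^sub>C F_matrix i j)"
    unfolding vec_eq_iff F_matrix_sum_component
  proof (intro allI)
    fix a b
    show "A $ a $ b = A $ a $ b / 2 - idx_sign a * idx_sign b * (A $ idx_prime b $ idx_prime a / 2)"
      using R[rule_format, of a b] by simp
  qed
  then show ?L by (intro exI[where x = "\<lambda>i j. A $ i $ j / 2"])
qed

lemma Rep_sp_iff:
  "Rep_sp x $ a $ b = - idx_sign a * idx_sign b * Rep_sp x $ idx_prime b $ idx_prime a"
  using Rep_sp[of x] unfolding mem_Collect_eq mem_sp_iff by blast

lemma matrix_mult_prime:
  fixes A B :: "complex^'n::finite idx^'n idx"
  assumes "\<And>a b. A $ a $ b = - idx_sign a * idx_sign b * A $ idx_prime b $ idx_prime a"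
    and "\<And>a b. B $ a $ b = - idx_sign a * idx_sign b * B $ idx_prime b $ idx_prime a"
  shows "(A ** B) $ a $ b = idx_sign a * idx_sign b * (B ** A) $ idx_prime b $ idx_prime a"
proof -
  have "(A ** B) $ a $ b = (\<Sum>c\<in>UNIV. A $ a $ c * B $ c $ b)"
    by (simp add: matrix_matrix_mult_def)
  also have "\<dots> = (\<Sum>c\<in>UNIV. idx_sign a * idx_sign b *
      (B $ idx_prime b $ idx_prime c * A $ idx_prime c $ idx_prime a))"
  proof (rule sum.cong[OF refl])
    fix c
    show "A $ a $ c * B $ c $ b = idx_sign a * idx_sign b *
        (B $ idx_prime b $ idx_prime c * A $ idx_prime c $ idx_prime a)"
      by (subst assms(1), subst assms(2)) (simp add: ac_simps)
  qed
  also have "\<dots> = (\<Sum>c\<in>UNIV. idx_sign a * idx_sign b * (B $ idx_prime b $ c * A $ c $ idx_prime a))"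
    by (rule sum.reindex_bij_witness[of _ idx_prime idx_prime]) auto
  finally show ?thesis
    by (simp add: matrix_matrix_mult_def sum_distrib_left)
qed

lemma scaleC_matrix_mult:
  fixes A B :: "complex^'n^'n"
  shows "(c *\<^sub>C A) ** B = c *\<^sub>C (A ** B)" "A ** (c *\<^sub>C B) = c *\<^sub>C (A ** B)"
  by (simp_all add: matrix_matrix_mult_def vec_eq_iff scaleC_complex_def sum_distrib_left ac_simps)

lemma trace_scaleC: "trace (c *\<^sub>C (A :: complex^'n^'n)) = c * trace A"
  by (simp add: trace_def scaleC_complex_def sum_distrib_left)

lemma matrix_add_rdistrib': "(A + B) ** C = A ** C + B ** (C :: complex^'n^'n)"
  by (simp add: vec_eq_iff matrix_matrix_mult_def distrib_right sum.distrib)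

lemma matrix_diff_distrib:
  fixes A B C :: "complex^'n^'n"
  shows "(A - B) ** C = A ** C - B ** C" "C ** (A - B) = C ** A - C ** B"
  by (simp_all add: vec_eq_iff matrix_matrix_mult_def algebra_simps sum_subtractf)

setup_lifting type_definition_sp

lift_definition F_sp :: "'n::finite idx \<Rightarrow> 'n idx \<Rightarrow> 'n sp" is F_matrix
  unfolding mem_sp_iff by (auto simp: F_matrix_component mult.assoc)

instantiation sp :: (finite) quadratic_lie_algebra
begin

lift_definition zero_sp :: "'a sp" is 0
  unfolding mem_sp_iff by simp

lift_definition plus_sp :: "'a sp \<Rightarrow> 'a sp \<Rightarrow> 'a sp" is "(+)"
  unfolding mem_sp_iff
proof (intro allI)
  fix A B :: "complex^'a idx^'a idx" and a b
  assume A: "\<forall>a b. A $ a $ b = - idx_sign a * idx_sign b * A $ idx_prime b $ idx_prime a"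
    and B: "\<forall>a b. B $ a $ b = - idx_sign a * idx_sign b * B $ idx_prime b $ idx_prime a"
  show "(A + B) $ a $ b = - idx_sign a * idx_sign b * (A + B) $ idx_prime b $ idx_prime a"
    using A[rule_format, of a b] B[rule_format, of a b] by (simp add: algebra_simps)
qed

lift_definition minus_sp :: "'a sp \<Rightarrow> 'a sp \<Rightarrow> 'a sp" is "(-)"
  unfolding mem_sp_iff
proof (intro allI)
  fix A B :: "complex^'a idx^'a idx" and a b
  assume A: "\<forall>a b. A $ a $ b = - idx_sign a * idx_sign b * A $ idx_prime b $ idx_prime a"
    and B: "\<forall>a b. B $ a $ b = - idx_sign a * idx_sign b * B $ idx_prime b $ idx_prime a"
  show "(A - B) $ a $ b = - idx_sign a * idx_sign b * (A - B) $ idx_prime b $ idx_prime a"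
    using A[rule_format, of a b] B[rule_format, of a b] by (simp add: algebra_simps)
qed

lift_definition uminus_sp :: "'a sp \<Rightarrow> 'a sp" is uminus
  unfolding mem_sp_iff
proof (intro allI)
  fix A :: "complex^'a idx^'a idx" and a b
  assume A: "\<forall>a b. A $ a $ b = - idx_sign a * idx_sign b * A $ idx_prime b $ idx_prime a"
  show "(- A) $ a $ b = - idx_sign a * idx_sign b * (- A) $ idx_prime b $ idx_prime a"
    using A[rule_format, of a b] by (simp add: scaleC_complex_def)
qed

lift_definition scaleC_sp :: "complex \<Rightarrow> 'a sp \<Rightarrow> 'a sp" is scaleC
  unfolding mem_sp_iff
proof (intro allI)
  fix c :: complex and A :: "complex^'a idx^'a idx" and a b
  assume A: "\<forall>a b. A $ a $ b = - idx_sign a * idx_sign b * A $ idx_prime b $ idx_prime a"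
  show "(c *\<^sub>C A) $ a $ b = - idx_sign a * idx_sign b * (c *\<^sub>C A) $ idx_prime b $ idx_prime a"
    using A[rule_format, of a b] by (simp add: scaleC_complex_def)
qed

lift_definition lie_bracket_sp :: "'a sp \<Rightarrow> 'a sp \<Rightarrow> 'a sp" is "\<lambda>A B. A ** B - B ** A"
  unfolding mem_sp_iff
proof (intro allI)
  fix A B :: "complex^'a idx^'a idx" and a b
  assume A: "\<forall>a b. A $ a $ b = - idx_sign a * idx_sign b * A $ idx_prime b $ idx_prime a"
    and B: "\<forall>a b. B $ a $ b = - idx_sign a * idx_sign b * B $ idx_prime b $ idx_prime a"
  have "(A ** B) $ a $ b = idx_sign a * idx_sign b * (B ** A) $ idx_prime b $ idx_prime a"
    by (rule matrix_mult_prime) (rule A[rule_format] B[rule_format])+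
  moreover have "(B ** A) $ a $ b = idx_sign a * idx_sign b * (A ** B) $ idx_prime b $ idx_prime a"
    by (rule matrix_mult_prime) (rule A[rule_format] B[rule_format])+
  ultimately show "(A ** B - B ** A) $ a $ b
      = - idx_sign a * idx_sign b * (A ** B - B ** A) $ idx_prime b $ idx_prime a"
    by (simp add: right_diff_distrib)
qed

lift_definition inv_form_sp :: "'a sp \<Rightarrow> 'a sp \<Rightarrow> complex" is "\<lambda>A B. trace (A ** B)" .

instance
proof
  fix x y z :: "'a sp" and c d :: complex
  show "x + y + z = x + (y + z)" by transfer (rule add.assoc)
  show "x + y = y + x" by transfer (rule add.commute)
  show "0 + x = x" by transfer simp
  show "- x + x = 0" by transfer simp
  show "x - y = x + - y" by transfer simp
  show "c *\<^sub>C (x + y) = c *\<^sub>C x + c *\<^sub>C y" by transfer (rule scaleC_add_right)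
  show "(c + d) *\<^sub>C x = c *\<^sub>C x + d *\<^sub>C x" by transfer (rule scaleC_add_left)
  show "c *\<^sub>C d *\<^sub>C x = (c * d) *\<^sub>C x" by transfer (rule scaleC_scaleC)
  show "1 *\<^sub>C x = x" by transfer (rule scaleC_one)
  show "lie_bracket (x + y) z = lie_bracket x z + lie_bracket y z"
    by transfer (simp add: matrix_add_rdistrib' matrix_add_ldistrib)
  show "lie_bracket x (y + z) = lie_bracket x y + lie_bracket x z"
    by transfer (simp add: matrix_add_rdistrib' matrix_add_ldistrib)
  show "lie_bracket (c *\<^sub>C x) y = c *\<^sub>C lie_bracket x y"
    by transfer (simp add: scaleC_matrix_mult scaleC_diff_right)
  show "lie_bracket x (c *\<^sub>C y) = c *\<^sub>C lie_bracket x y"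
    by transfer (simp add: scaleC_matrix_mult scaleC_diff_right)
  show "lie_bracket x x = 0" by transfer simp
  show "lie_bracket x (lie_bracket y z) + lie_bracket y (lie_bracket z x)
      + lie_bracket z (lie_bracket x y) = 0"
    by transfer (simp add: matrix_diff_distrib matrix_mul_assoc)
  show "inv_form (x + y) z = inv_form x z + inv_form y z"
    by transfer (simp add: matrix_add_rdistrib' trace_add)
  show "inv_form (c *\<^sub>C x) y = c * inv_form x y"
    by transfer (simp add: scaleC_matrix_mult trace_scaleC)
  show "inv_form x y = inv_form y x" by transfer (rule trace_mul_sym)
  show "inv_form (lie_bracket x y) z = inv_form x (lie_bracket y z)"
  proof transfer
    fix x y z :: "complex^'a idx^'a idx"
    have "trace (y ** x ** z) = trace (x ** z ** y)"
      using trace_mul_sym[of y "x ** z"] by (simp add: matrix_mul_assoc)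
    then show "trace ((x ** y - y ** x) ** z) = trace (x ** (y ** z - z ** y))"
      by (simp add: matrix_diff_distrib trace_sub matrix_mul_assoc)
  qed
qed

end

text \<open>\<open>\<Delta>\<^sub>m\<close>: the sum over \<open>I\<close> with \<open>m\<close> elements of the determinants of \<open>(F\<^sub>i\<^sub>j)\<close> with \<open>i, j \<in> I\<close>.\<close>

definition Delta :: "nat \<Rightarrow> 'n::finite sp symalg" where
  "Delta m = (\<Sum>I | card I = m. \<Sum>\<sigma> | \<sigma> permutes I.
     of_int (sign \<sigma>) * (\<Prod>i\<in>I. sym_gen (F_sp i (\<sigma> i))))"

text \<open>The critical level is \<open>-h\<close>, where the dual Coxeter number is \<open>h = n + 1\<close>, for the invariant form
  for which the long roots have square length 2. This form is \<open>inv_form\<close>, that is, \<open>tr(XY)\<close>, and the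
  Killing form is \<open>2(n + 1) tr(XY)\<close>.\<close>

definition feigin_frenkel_centre :: "'n::finite sp affine uea set" where
  "feigin_frenkel_centre = vacuum_invariants (- of_nat (CARD('n) + 1))"

end

theory Submission
  imports Defs "HOL-Computational_Algebra.Formal_Power_Series" "HOL-Combinatorics.Multiset_Permutations"
begin

text \<open>Write \<open>\<gg>\<close> in terms of \<open>F\<^sub>i\<^sub>j\<close> and let \<open>\<psi>\<^sub>i, \<eta>\<^sub>j\<close> be Grassmann variables. Up to a factor, the symmetrisation of \<open>\<Delta>\<^sub>m\<close>
  is the coefficient of the top form in \<open>\<gamma>\<^sup>2\<^sup>n\<^sup>-\<^sup>m Q\<^sup>m\<close>, where \<open>Q = \<Sum> \<psi>\<^sub>i \<eta>\<^sub>j F\<^sub>i\<^sub>j[-1]\<close> and \<open>\<gamma> = -\<Sum> \<psi>\<^sub>i \<eta>\<^sub>i\<close>, and the binomial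
  coefficients are such that \<open>S\<^sub>k\<close> is the coefficient of the top form in
  \<open>\<Sum>\<^sub>r (2n - 2k + r + 1) \<gamma>\<^sup>2\<^sup>n\<^sup>-\<^sup>2\<^sup>k\<^sup>+\<^sup>r W\<^sub>r\<close>, where \<open>W\<^sub>r\<close> is the sum of the words of length \<open>2k\<close> with \<open>r\<close> letters \<open>\<tau>\<close> and
  \<open>2k - r\<close> letters \<open>Q\<close>. Move \<open>x[1]\<close>, for \<open>x\<close> of rank one, to the right: it turns one letter at place \<open>j\<close> of a shorter word
  into a double commutator or, if \<open>\<tau>\<close> was met first, into \<open>[x, Q]\<close>, with weight \<open>j\<close>. Since \<open>F\<^sub>i\<^sub>j\<close> is symmetric after
  lowering an index, \<open>Q\<close> is invariant under the \<open>sl\<^sub>2\<close> that mixes the two families of Grassmann variables,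
  and integration by parts along \<open>sl\<^sub>2\<close> expresses the double commutator through a derivation of \<open>Q\<close>. The part of the
  weights that is constant in \<open>j\<close> then cancels by integration by parts, precisely at the critical level. The remaining weights have
  sum zero, so Abel summation leaves commutators of adjacent letters, that is, words with one letter in degree
  \<open>-2\<close>, and these cancel by the same identities. Finally, \<open>\<gg>[t]\<close> is generated by \<open>\<gg>\<close> and the \<open>x[1]\<close>.\<close>

section \<open>Insertions into powers\<close>

text \<open>The binomial coefficients come from the top coefficients: with d = 2n - 2k, that of
  \<gamma>^(d+r) W_r is (d+r)! (2k)! / r! times the symmetrisation of \<tau>^r \<Delta>_(2k-r), and
  the factor d + r + 1 turns this into (2k)! (d+1)! times (d+r+1) choose r. The same factor suits
  integration by parts. Under sl_2, [x, Q] is a singlet, and the double commutator involves a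
  triplet Y, V, Z; modulo N, both (k+1) \<gamma>^k \<alpha> Y and (k+1) \<gamma>^k \<beta> Z become
  -\<gamma>^(k+1) V, so that a weight k + 1 on the double commutator becomes a weight k + 3 on V.
  The level enters through a single integer, which at K = -(n+1) is a multiple of d + 2k - 2n and
  hence zero. Each group of terms that cancels comes from exponents r of one parity, so r may be
  restricted to even values. The obstacle is that currents, \<tau> and Grassmann variables must be
  multiplied freely before anything is set to zero: all of them become operators on a Fock space,
  and vanishing in the vacuum module becomes membership in an additive subgroup of the operator
  ring.\<close>

definition ins :: "'a::ring_1 \<Rightarrow> (nat \<Rightarrow> int) \<Rightarrow> 'a \<Rightarrow> nat \<Rightarrow> 'a" where
  "ins L w Y m = (\<Sum>p<m. of_int (w p) * (L ^ p * Y * L ^ (m - 1 - p)))"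

lemma of_int_mult_commute: "of_int z * (x :: 'a::ring_1) = x * of_int z"
  by (metis mult_of_int_commute)

lemma mult_of_nat_left: "x * (of_nat i * y) = of_nat i * (x * (y :: 'a::ring_1))"
  by (simp only: mult.assoc[symmetric] mult_of_nat_commute[of i x])

lemma mult_of_int_left: "x * (of_int i * y) = of_int i * (x * (y :: 'a::ring_1))"
  by (simp only: mult.assoc[symmetric] of_int_mult_commute[of i x])

lemma mult_2_left: "x * (2 * y) = 2 * (x * (y :: 'a::ring_1))"
  using mult_of_nat_left[of x 2 y] by simp

text \<open>These are the partial sums of the weights \<open>m - 2 * q\<close> over q \<le> p, which
  Abel summation puts in front of the commutators of adjacent letters.\<close>

definition quadratic_weight :: "nat \<Rightarrow> nat \<Rightarrow> int" where
  "quadratic_weight m p = (int p + 1) * (int m - int p)"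

lemma ins_0 [simp]: "ins L w Y 0 = 0"
  by (simp add: ins_def)

lemma ins_Suc: "ins L w Y (Suc m) = of_int (w 0) * (Y * L ^ m) + L * ins L (\<lambda>p. w (Suc p)) Y m"
proof -
  have "L * (of_int z * (L ^ p * Y * C)) = of_int z * (L ^ Suc p * Y * C)" for z p C
    by (simp only: mult.assoc[symmetric] of_int_mult_commute[of z L, symmetric] power_Suc)
  then show ?thesis
    unfolding ins_def by (simp only: sum.lessThan_Suc_shift sum_distrib_left) simp
qed

lemma ins_add: "ins L w (Y + Z) m = ins L w Y m + ins L w Z m"
  by (simp add: ins_def algebra_simps sum.distrib)

lemma ins_diff: "ins L w (Y - Z) m = ins L w Y m - ins L w Z m"
  by (simp add: ins_def algebra_simps sum_subtractf)

lemma ins_weight_add: "ins L (\<lambda>p. v p + w p) Y m = ins L v Y m + ins L w Y m"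
  by (simp add: ins_def algebra_simps sum.distrib)

lemma ins_central:
  assumes "z * L = L * z"
  shows "ins L w (z * Y) m = z * ins L w Y m"
proof -
  have "L ^ p * (z * Y) * C = z * (L ^ p * Y * C)" for p C
    using power_commuting_commutes[OF assms[symmetric], of p] by (simp only: mult.assoc[symmetric])
  then show ?thesis
    by (simp only: ins_def sum_distrib_left mult.assoc[symmetric] of_int_mult_commute[of _ z, symmetric])
qed

lemma commute_power:
  assumes "y * L = L * y + (c :: 'a::ring_1)"
  shows "y * L ^ m = L ^ m * y + ins L (\<lambda>_. 1) c m"
proof (induction m)
  case (Suc m)
  have "y * L ^ Suc m = L * (y * L ^ m) + c * L ^ m"
    by (simp add: assms distrib_right mult.assoc[symmetric])
  then show ?case by (simp add: Suc ins_Suc distrib_left mult.assoc)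
qed simp

text \<open>One more factor L on the left moves every insertion one place to the right; the missing
  unit of weight is supplied by the unweighted insertion. This is the recursion that arises when the
  first mode passes one more letter.\<close>

lemma ins_linear_weight_Suc:
  "ins L (\<lambda>p. int p + 1) Y (Suc m) = ins L (\<lambda>_. 1) Y (Suc m) + L * ins L (\<lambda>p. int p + 1) Y m"
proof -
  have "ins L (\<lambda>p. int p + 1 + 1) Y m = ins L (\<lambda>p. int p + 1) Y m + ins L (\<lambda>_. 1) Y m"
    by (rule ins_weight_add)
  then show ?thesis by (simp add: ins_Suc algebra_simps)
qed

text \<open>Abel summation: the weights \<open>2(p + 1) - (m + 1)\<close> have sum zero.\<close>

lemma ins_linear_weight:
  "2 * ins L (\<lambda>p. int p + 1) Y (Suc m) = of_nat (m + 2) * ins L (\<lambda>_. 1) Y (Suc m)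
     + ins L (quadratic_weight m) (L * Y - Y * L) m"
proof -
  define T where "T p = L ^ p * Y * L ^ (m - p)" for p
  have T: "L ^ p * (L * Y - Y * L) * L ^ (m - 1 - p) = T (Suc p) - T p" if "p < m" for p
  proof -
    have "L ^ (m - p) = L * L ^ (m - 1 - p)" using that by (metis Suc_diff_Suc diff_Suc_eq_diff_pred power_Suc)
    moreover have "L ^ p * (L * Z) = L * (L ^ p * Z)" for Z
      by (simp only: mult.assoc[symmetric] power_commutes)
    ultimately show ?thesis
      using that by (simp add: T_def algebra_simps)
  qed
  \<comment> \<open>At \<open>q = m\<close> the boundary term is \<open>m * T m\<close>, which is
    exactly the term \<open>p = m\<close> of the sum on the right, so that the sum extends to
    \<open>p < Suc m\<close>.\<close>
  have abel: "(\<Sum>p<q. of_int ((int p + 1) * (int m - int p)) * (T (Suc p) - T p))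
     = (\<Sum>p<q. of_int (2 * int p - int m) * T p) + of_int (int q * (int m + 1 - int q)) * T q" for q
    by (induction q) (simp_all add: algebra_simps mult_2)
  have "ins L (quadratic_weight m) (L * Y - Y * L) m
     = (\<Sum>p<m. of_int ((int p + 1) * (int m - int p)) * (T (Suc p) - T p))"
    unfolding ins_def quadratic_weight_def using T by (intro sum.cong) auto
  also have "\<dots> = (\<Sum>p<Suc m. of_int (2 * int p - int m) * T p)"
    unfolding abel by (simp add: algebra_simps mult_2)
  also have "\<dots> = (\<Sum>p<Suc m. 2 * (of_int (int p + 1) * T p) - of_nat (m + 2) * T p)"
  proof (rule sum.cong[OF refl])
    fix p
    have "of_int (2 * int p - int m) = (2 * of_int (int p + 1) - of_nat (m + 2) :: 'a)" by simp
    then show "of_int (2 * int p - int m) * T p = 2 * (of_int (int p + 1) * T p) - of_nat (m + 2) * T p"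
      by (simp only: left_diff_distrib mult.assoc)
  qed
  finally show ?thesis
    by (simp add: ins_def T_def sum_subtractf sum_distrib_left mult.assoc del: sum.lessThan_Suc of_nat_add of_int_add)
qed

section \<open>Invariance under the first positive mode\<close>

text \<open>The subgroup \<open>N\<close> consists of the operators whose matrix coefficient between the vacuum and the
  top form vanishes modulo the vacuum ideal. An operator is null if it
  annihilates the vacuum and the range of its transpose misses the top form, so that integration by
  parts is possible along it.\<close>

locale coefficient_kernel =
  fixes N :: "'r::ring_1 set"
  assumes N_zero: "0 \<in> N"
    and N_add: "A \<in> N \<Longrightarrow> B \<in> N \<Longrightarrow> A + B \<in> N"
    and N_minus: "A \<in> N \<Longrightarrow> - A \<in> N"
    and N_divide: "of_nat (Suc k) * A \<in> N \<Longrightarrow> A \<in> N"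
begin

definition null :: "'r \<Rightarrow> bool" where
  "null e \<longleftrightarrow> (\<forall>A. e * A \<in> N \<and> A * e \<in> N)"

text \<open>The half of \<open>null\<close> that nonnegative modes satisfy: they kill the vacuum,
  but nothing is claimed about them as left factors.\<close>

definition annihilates :: "'r \<Rightarrow> bool" where
  "annihilates e \<longleftrightarrow> (\<forall>A. A * e \<in> N)"

lemma N_diff: "A \<in> N \<Longrightarrow> B \<in> N \<Longrightarrow> A - B \<in> N"
  using N_add[OF _ N_minus] by simp

lemma N_sum: "(\<And>i. i \<in> T \<Longrightarrow> A i \<in> N) \<Longrightarrow> (\<Sum>i\<in>T. A i) \<in> N"
  by (induction T rule: infinite_finite_induct) (auto intro: N_zero N_add)

lemma N_of_nat: "A \<in> N \<Longrightarrow> of_nat m * A \<in> N"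
  by (induction m) (auto intro: N_zero N_add simp: distrib_right)

lemma N_of_int: "A \<in> N \<Longrightarrow> of_int z * A \<in> N"
  by (cases z) (auto intro: N_of_nat N_minus simp: minus_add_distrib[symmetric] simp del: of_int_add of_nat_Suc minus_add_distrib)

lemma power_commutator:
  assumes "e * g = g * e + (a :: 'r)" and "a * g = g * a"
  shows "e * g ^ Suc k = g ^ Suc k * e + of_nat (Suc k) * (g ^ k * a)"
proof (induction k)
  case (Suc k)
  have "e * g ^ Suc (Suc k) = (e * g) * g ^ Suc k"
    by (simp only: power_Suc[of g "Suc k"] mult.assoc)
  also have "\<dots> = g * (e * g ^ Suc k) + a * g ^ Suc k"
    by (simp only: assms(1) distrib_right mult.assoc)
  also have "a * g ^ Suc k = g ^ Suc k * a"
    by (rule power_commuting_commutes[symmetric]) (rule assms(2)[symmetric])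
  finally show ?case
    by (simp only: Suc.IH) (simp add: algebra_simps mult_of_nat_commute)
qed (simp add: assms(1))

text \<open>As e is null, its commutator with \<gamma>^(k+1) B lies in N, where \<gamma> is the
  element \<open>g\<close>; the Leibniz rule expands this commutator into the two terms.\<close>

lemma integrate_by_parts:
  assumes "null e" and "e * g = g * e + a" and "a * g = g * a"
    and "e * B = B * e + B'"
  shows "of_nat (Suc k) * (g ^ k * a * B) + g ^ Suc k * B' \<in> N"
proof -
  have "e * (g ^ Suc k * B) = of_nat (Suc k) * (g ^ k * a * B) + g ^ Suc k * B' + g ^ Suc k * B * e"
    by (simp only: mult.assoc[symmetric] power_commutator[OF assms(2,3)] distrib_right)
      (simp add: mult.assoc assms(4) distrib_left)
  then have "of_nat (Suc k) * (g ^ k * a * B) + g ^ Suc k * B'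
      = e * (g ^ Suc k * B) - g ^ Suc k * B * e" by simp
  then show ?thesis using assms(1) by (simp add: N_diff null_def)
qed

end


lemma ins_commutator:
  assumes "e * L = L * e" and "e * Y = Y * e + (V :: 'a::ring_1)"
  shows "e * ins L w Y m = ins L w Y m * e + ins L w V m"
proof -
  have "e * (of_int z * (L ^ p * Y * L ^ q))
      = of_int z * (L ^ p * Y * L ^ q) * e + of_int z * (L ^ p * V * L ^ q)" for z p q
  proof -
    have L: "e * L ^ i = L ^ i * e" for i
      by (rule power_commuting_commutes[symmetric]) (rule assms(1)[symmetric])
    have "e * (L ^ p * Y * L ^ q) = L ^ p * Y * L ^ q * e + L ^ p * V * L ^ q"
      by (simp only: mult.assoc[symmetric] L) 
        (simp only: mult.assoc assms(2) distrib_left distrib_right L)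
    then show ?thesis
      by (simp only: mult_of_int_left distrib_left) (simp only: mult.assoc)
  qed
  then show ?thesis
    by (simp only: ins_def sum_distrib_left sum_distrib_right sum.distrib[symmetric])
qed

section \<open>Words in \<tau> and Q through a generating series\<close>

locale tau_line = coefficient_kernel N
  for N :: "'r::ring_1 set" +
  fixes \<tau> Q :: 'r
begin

text \<open>The coefficient of \<open>\<lambda>\<^sup>r\<close> in \<open>(Q + \<lambda>\<tau>)\<^sup>m\<close> is the sum of the words of length \<open>m\<close> with \<open>r\<close>
  letters \<open>\<tau>\<close>.\<close>

definition L :: "'r fps" where
  "L = fps_const Q + fps_X * fps_const \<tau>"

text \<open>The inserted letter carries no power of \<lambda>, so r counts the letters \<tau> among
  the other \<open>m - 1\<close> letters.\<close>

definition coeff_ins :: "(nat \<Rightarrow> int) \<Rightarrow> 'r \<Rightarrow> nat \<Rightarrow> nat \<Rightarrow> 'r" where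
  "coeff_ins w Y m r = fps_nth (ins L w (fps_const Y) m) r"

lemma commutator_L:
  assumes "y * \<tau> = \<tau> * y + p" "y * Q = Q * y + q"
  shows "fps_const y * L = L * fps_const y + (fps_const q + fps_X * fps_const p)"
proof -
  have "fps_const y * L = fps_const (y * Q) + fps_X * fps_const (y * \<tau>)"
    by (simp add: L_def distrib_left fps_mult_fps_X_commute mult.assoc[symmetric])
  also have "\<dots> = L * fps_const y + (fps_const q + fps_X * fps_const p)"
    by (simp add: L_def assms distrib_right distrib_left fps_const_add[symmetric] mult.assoc
        del: fps_const_add)
  finally show ?thesis .
qed

lemma commutes_L:
  assumes "y * \<tau> = \<tau> * y" "y * Q = Q * y"
  shows "fps_const y * L = L * fps_const y"
  using commutator_L[of y 0 0] assms by simp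

lemma coeff_power_commutes:
  assumes "y * \<tau> = \<tau> * y" "y * Q = Q * y"
  shows "y * fps_nth (L ^ m) r = fps_nth (L ^ m) r * y"
proof -
  have "fps_const y * L ^ m = L ^ m * fps_const y"
    using power_commuting_commutes[OF commutes_L[OF assms, symmetric]] by metis
  then show ?thesis by (metis fps_mult_left_const_nth fps_mult_right_const_nth)
qed

lemma coeff_ins_add: "coeff_ins w (Y + Z) m r = coeff_ins w Y m r + coeff_ins w Z m r"
  by (simp add: coeff_ins_def ins_add fps_const_add[symmetric] del: fps_const_add)

lemma coeff_ins_diff: "coeff_ins w (Y - Z) m r = coeff_ins w Y m r - coeff_ins w Z m r"
  by (simp add: coeff_ins_def ins_diff fps_const_sub[symmetric] del: fps_const_sub)

lemma coeff_ins_zero [simp]: "coeff_ins w 0 m r = 0"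
  using coeff_ins_diff[of w 0 0 m r] by simp

lemma coeff_ins_central:
  assumes "z * \<tau> = \<tau> * z" "z * Q = Q * z"
  shows "coeff_ins w (z * Y) m r = z * coeff_ins w Y m r"
proof -
  have "ins L w (fps_const z * fps_const Y) m = fps_const z * ins L w (fps_const Y) m"
    by (rule ins_central) (rule commutes_L[OF assms])
  then show ?thesis by (simp add: coeff_ins_def)
qed

lemma coeff_ins_commutator:
  assumes "e * \<tau> = \<tau> * e" "e * Q = Q * e" and "e * Y = Y * e + V"
  shows "e * coeff_ins w Y m r = coeff_ins w Y m r * e + coeff_ins w V m r"
proof -
  have "fps_const e * ins L w (fps_const Y) m
      = ins L w (fps_const Y) m * fps_const e + ins L w (fps_const V) m"
    by (rule ins_commutator) (simp_all add: commutes_L assms)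
  from arg_cong[OF this, of "\<lambda>A. fps_nth A r"] show ?thesis by (simp add: coeff_ins_def)
qed

lemma coeff_power_commutator:
  assumes "y * \<tau> = \<tau> * y" "y * Q = Q * y + c"
  shows "y * fps_nth (L ^ m) r = fps_nth (L ^ m) r * y + coeff_ins (\<lambda>_. 1) c m r"
proof -
  have "fps_const y * L ^ m = L ^ m * fps_const y + ins L (\<lambda>_. 1) (fps_const c) m"
    by (rule commute_power) (use commutator_L[of y 0 c] assms in simp)
  from arg_cong[OF this, of "\<lambda>A. fps_nth A r"] show ?thesis by (simp add: coeff_ins_def)
qed

lemma coeff_L_mult:
  "fps_nth (L * A) r = Q * fps_nth A r + (if r = 0 then 0 else \<tau> * fps_nth A (r - 1))"
  by (simp add: L_def distrib_right mult.assoc)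

lemma coeff_power_eq_0: "m < r \<Longrightarrow> fps_nth (L ^ m) r = 0"
  by (induction m arbitrary: r) (auto simp: coeff_L_mult)

text \<open>Besides Y only \<open>m - 1\<close> letters remain, too few for r letters
  \<tau>.\<close>

lemma coeff_ins_eq_0: "m \<le> r \<Longrightarrow> coeff_ins w Y m r = 0"
proof (induction m arbitrary: w r)
  case (Suc m)
  have "fps_nth (ins L v (fps_const Y) m) r = 0" "fps_nth (ins L v (fps_const Y) m) (r - 1) = 0" for v
    using Suc.IH[of _ v] Suc.prems unfolding coeff_ins_def by auto
  moreover have "fps_nth (of_int z * A) r = of_int z * fps_nth A r" for z and A :: "'r fps"
    by (simp add: fps_of_int[symmetric])
  ultimately show ?case
    using Suc.prems by (simp add: coeff_ins_def ins_Suc coeff_L_mult coeff_power_eq_0)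
qed (simp add: coeff_ins_def)

text \<open>A word of length m with r letters \<tau> has \<open>m - r\<close> letters Q, and each of
  them can be the marked one. The induction marks the letters \<tau> instead and subtracts from the
  marking of all m letters.\<close>

lemma count_Q: "coeff_ins (\<lambda>_. 1) Q m r = of_int (int m - int r) * fps_nth (L ^ m) r"
proof -
  have "fps_nth (ins L (\<lambda>_. 1) (fps_X * fps_const \<tau>) m) r = of_nat r * fps_nth (L ^ m) r"
  proof (induction m arbitrary: r)
    case (Suc m)
    have "fps_nth (ins L (\<lambda>_. 1) (fps_X * fps_const \<tau>) (Suc m)) r
       = (if r = 0 then 0 else \<tau> * fps_nth (L ^ m) (r - 1)) + (Q * (of_nat r * fps_nth (L ^ m) r)
         + (if r = 0 then 0 else \<tau> * (of_nat (r - 1) * fps_nth (L ^ m) (r - 1))))"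
      by (simp add: ins_Suc coeff_L_mult Suc mult.assoc)
    also have "\<dots> = of_nat r * fps_nth (L ^ Suc m) r"
    proof -
      have "z * (of_nat i * w) = of_nat i * (z * w)" for z w :: 'r and i
        by (simp only: mult.assoc[symmetric] mult_of_nat_commute[of i z])
      then show ?thesis
        by (cases r) (simp_all add: coeff_L_mult algebra_simps)
    qed
    finally show ?case .
  qed simp
  moreover have "ins L (\<lambda>_. 1) L m = of_nat m * L ^ m"
    by (induction m) (simp_all add: ins_Suc algebra_simps mult_of_nat_commute)
  moreover have "ins L (\<lambda>_. 1) L m = ins L (\<lambda>_. 1) (fps_const Q) m + ins L (\<lambda>_. 1) (fps_X * fps_const \<tau>) m"
    using ins_add[of L "\<lambda>_. 1" "fps_const Q" "fps_X * fps_const \<tau>" m] by (simp only: L_def)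
  ultimately have "of_nat m * fps_nth (L ^ m) r = coeff_ins (\<lambda>_. 1) Q m r + of_nat r * fps_nth (L ^ m) r"
    unfolding coeff_ins_def by (metis fps_add_nth fps_mult_left_const_nth fps_of_nat)
  then show ?thesis by (simp add: algebra_simps)
qed

end


text \<open>Dictionary: \<open>x\<^sub>1\<close> and \<open>x\<^sub>0\<close> are x[1] and x[0];
  \<open>H\<^sub>0\<close>, \<open>H\<close>, \<open>H'\<close> are the sums of currents [x, Q] in
  degrees 0, -1, -2; a prime on Q, V, Y, Z also means degree -2. \<open>X\<close> and
  \<open>U\<close> are the sum and the difference of the rotations by x of the two Grassmann
  families, and \<open>t\<close>, \<open>\<alpha>\<close>, \<open>\<beta>\<close>,
  \<open>\<gamma>\<close> are quadratic in the Grassmann variables. By \<open>level\<close>, the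
  central K acts as -(n + 1).\<close>

locale first_mode = tau_line N \<tau> Q
  for N :: "'r::ring_1 set" and \<tau> Q :: 'r +
  fixes \<gamma> t \<alpha> \<beta> Q' H\<^sub>0 H H' V V' Y Y' Z Z' x\<^sub>0 x\<^sub>1 K E F X U :: 'r
    and n :: nat
  assumes central:
      "\<gamma> * \<tau> = \<tau> * \<gamma>" "\<gamma> * Q = Q * \<gamma>" "t * \<tau> = \<tau> * t" "t * Q = Q * t"
      "\<alpha> * \<tau> = \<tau> * \<alpha>" "\<alpha> * Q = Q * \<alpha>" "\<beta> * \<tau> = \<tau> * \<beta>" "\<beta> * Q = Q * \<beta>"
      "K * \<tau> = \<tau> * K" "K * Q = Q * K" "\<alpha> * \<gamma> = \<gamma> * \<alpha>" "\<beta> * \<gamma> = \<gamma> * \<beta>" "t * \<gamma> = \<gamma> * t"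
      "x\<^sub>1 * \<gamma> = \<gamma> * x\<^sub>1" "X * \<gamma> = \<gamma> * X"
    and x\<^sub>1: "x\<^sub>1 * \<tau> = \<tau> * x\<^sub>1 + x\<^sub>0" "x\<^sub>1 * Q = Q * x\<^sub>1 + (H\<^sub>0 + t * K)"
    and x\<^sub>0: "x\<^sub>0 * \<tau> = \<tau> * x\<^sub>0" "x\<^sub>0 * Q = Q * x\<^sub>0 + H"
    and H\<^sub>0: "H\<^sub>0 * \<tau> = \<tau> * H\<^sub>0" "H\<^sub>0 * Q = Q * H\<^sub>0 + (t * Q + (\<gamma> * V - \<alpha> * Y - \<beta> * Z))"
    and tau: "\<tau> * Q = Q * \<tau> + Q'" "\<tau> * H = H * \<tau> + H'" "\<tau> * V = V * \<tau> + V'"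
    and H: "H * Q = Q * H + (t * Q' + (\<gamma> * V' - \<alpha> * Y' - \<beta> * Z'))"
    and V: "V * Q = Q * V + (\<gamma> * H' + (\<alpha> * Y' - \<beta> * Z'))"
    and E: "E * \<tau> = \<tau> * E" "E * Q = Q * E" "E * \<gamma> = \<gamma> * E + \<alpha>" "E * Y = Y * E + V" "E * Y' = Y' * E + V'"
    and F: "F * \<tau> = \<tau> * F" "F * Q = Q * F" "F * \<gamma> = \<gamma> * F + \<beta>" "F * Z = Z * F + V" "F * Z' = Z' * F + V'"
    and X: "X * \<tau> = \<tau> * X" "X * Q = Q * X + H"
    and U: "U * \<tau> = \<tau> * U" "U * Q = Q * U + V" "U * \<gamma> = \<gamma> * U - t"
    and null: "null E" "null F" "null X" "null U"
    and annihilates: "annihilates x\<^sub>0" "annihilates x\<^sub>1" "annihilates H\<^sub>0"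
    and level: "A * (K + of_nat (Suc n)) \<in> N"
begin

text \<open>Integration by parts along E turns the term with \<alpha>, and along F the term with
  \<beta>, into one more copy of \<gamma>^(k+1) v each; this raises the factor from
  \<open>k + 1\<close> to \<open>k + 3\<close>.\<close>

lemma coeff_ins_W:
  assumes "E * y = y * E + v" "F * z = z * F + v"
  shows "of_nat (k + 1) * (\<gamma> ^ k * coeff_ins w (\<gamma> * v - \<alpha> * y - \<beta> * z) m r)
    - of_nat (k + 3) * (\<gamma> ^ Suc k * coeff_ins w v m r) \<in> N"
proof -
  have "of_nat (Suc k) * (\<gamma> ^ k * \<alpha> * coeff_ins w y m r) + \<gamma> ^ Suc k * coeff_ins w v m r \<in> N"
    by (rule integrate_by_parts[where e = E]) (use central E null coeff_ins_commutator assms in auto)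
  moreover have "of_nat (Suc k) * (\<gamma> ^ k * \<beta> * coeff_ins w z m r) + \<gamma> ^ Suc k * coeff_ins w v m r \<in> N"
    by (rule integrate_by_parts[where e = F]) (use central F null coeff_ins_commutator assms in auto)
  ultimately have "- (of_nat (Suc k) * (\<gamma> ^ k * \<alpha> * coeff_ins w y m r) + \<gamma> ^ Suc k * coeff_ins w v m r)
      - (of_nat (Suc k) * (\<gamma> ^ k * \<beta> * coeff_ins w z m r) + \<gamma> ^ Suc k * coeff_ins w v m r) \<in> N"
    by (intro N_diff N_minus)
  moreover have "coeff_ins w (\<gamma> * v - \<alpha> * y - \<beta> * z) m r = \<gamma> * coeff_ins w v m r - \<alpha> * coeff_ins w y m r - \<beta> * coeff_ins w z m r"
    by (simp add: coeff_ins_diff coeff_ins_central central)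
  moreover have "of_nat (k + 3) = of_nat (Suc k) + 1 + (1 :: 'r)" by simp
  moreover have "\<gamma> ^ k * (\<gamma> * A) = \<gamma> * (\<gamma> ^ k * A)" for A
    by (simp only: mult.assoc[symmetric] power_commutes)
  ultimately show ?thesis
    by (simp only:) (simp add: algebra_simps)
qed

text \<open>Integration by parts, along E for Y' and along F for Z', turns both terms into the same
  multiple of the insertion of V'.\<close>

lemma coeff_ins_difference:
  "\<gamma> ^ k * coeff_ins w (\<alpha> * Y' - \<beta> * Z') m r \<in> N"
proof (rule N_divide)
  have "of_nat (Suc k) * (\<gamma> ^ k * \<alpha> * coeff_ins w Y' m r) + \<gamma> ^ Suc k * coeff_ins w V' m r \<in> N"
    by (rule integrate_by_parts[where e = E]) (use central E null coeff_ins_commutator in auto)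
  moreover have "of_nat (Suc k) * (\<gamma> ^ k * \<beta> * coeff_ins w Z' m r) + \<gamma> ^ Suc k * coeff_ins w V' m r \<in> N"
    by (rule integrate_by_parts[where e = F]) (use central F null coeff_ins_commutator in auto)
  ultimately have "(of_nat (Suc k) * (\<gamma> ^ k * \<alpha> * coeff_ins w Y' m r) + \<gamma> ^ Suc k * coeff_ins w V' m r)
      - (of_nat (Suc k) * (\<gamma> ^ k * \<beta> * coeff_ins w Z' m r) + \<gamma> ^ Suc k * coeff_ins w V' m r) \<in> N"
    by (rule N_diff)
  moreover have "coeff_ins w (\<alpha> * Y' - \<beta> * Z') m r = \<alpha> * coeff_ins w Y' m r - \<beta> * coeff_ins w Z' m r"
    by (simp add: coeff_ins_diff coeff_ins_central central)
  ultimately show "of_nat (Suc k) * (\<gamma> ^ k * coeff_ins w (\<alpha> * Y' - \<beta> * Z') m r) \<in> N"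
    by (simp only:) (simp add: algebra_simps)
qed

text \<open>The unweighted insertion of H into a power of L is its commutator with X, which is null
  and commutes with \<gamma>.\<close>

lemma coeff_ins_H: "\<gamma> ^ k * coeff_ins (\<lambda>_. 1) H m r \<in> N"
proof -
  have "X * \<gamma> ^ k = \<gamma> ^ k * X"
    by (rule power_commuting_commutes[symmetric]) (rule central(15)[symmetric])
  then have "\<gamma> ^ k * (X * A) = X * (\<gamma> ^ k * A)" for A
    by (simp only: mult.assoc[symmetric])
  moreover have "coeff_ins (\<lambda>_. 1) H m r = X * fps_nth (L ^ m) r - fps_nth (L ^ m) r * X"
    by (simp add: coeff_power_commutator[OF X])
  ultimately have "\<gamma> ^ k * coeff_ins (\<lambda>_. 1) H m r
      = X * (\<gamma> ^ k * fps_nth (L ^ m) r) - \<gamma> ^ k * fps_nth (L ^ m) r * X"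
    by (simp add: right_diff_distrib mult.assoc)
  then show ?thesis using null by (simp add: N_diff null_def)
qed

text \<open>U produces V from Q just as X produces H, but it also moves \<gamma> by -t, so
  integration by parts leaves the term with t.\<close>

lemma coeff_ins_V:
  "\<gamma> ^ Suc k * coeff_ins (\<lambda>_. 1) V m r - of_nat (Suc k) * (\<gamma> ^ k * t * fps_nth (L ^ m) r) \<in> N"
proof -
  have "of_nat (Suc k) * (\<gamma> ^ k * (- t) * fps_nth (L ^ m) r) + \<gamma> ^ Suc k * coeff_ins (\<lambda>_. 1) V m r \<in> N"
    by (rule integrate_by_parts[where e = U])
      (use null central U coeff_power_commutator in auto)
  then show ?thesis by (simp add: add.commute)
qed

text \<open>The arbitrary left factor makes this stable under left multiplication by L, so that the
  induction on the power of L can run modulo such series.\<close>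

definition kills :: "'r fps \<Rightarrow> bool" where
  "kills A \<longleftrightarrow> (\<forall>c r. c * fps_nth A r \<in> N)"

lemma kills_add: "kills A \<Longrightarrow> kills B \<Longrightarrow> kills (A + B)"
  by (simp add: kills_def distrib_left N_add)

lemma kills_mult: "kills A \<Longrightarrow> kills (B * A)"
  unfolding kills_def by (simp add: fps_mult_nth sum_distrib_left mult.assoc[symmetric] N_sum)

lemma kills_annihilates: "annihilates e \<Longrightarrow> kills (A * fps_const e)"
  by (simp add: kills_def annihilates_def mult.assoc[symmetric])

text \<open>A letter at place p of the shorter word had \<open>p + 1\<close> places to its left at
  which \<open>x\<^sub>1\<close> could have become \<open>H\<^sub>0\<close>, at a letter Q, or
  \<open>x\<^sub>0\<close>, at a letter \<tau>; hence the weight. The term with K is the central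
  part of [x[1], Q], which arises once at each of the \<open>m + 1\<close> places. Terms ending in
  \<open>x\<^sub>1\<close>, \<open>x\<^sub>0\<close> or \<open>H\<^sub>0\<close> are
  dropped.\<close>

lemma first_mode_power:
  "kills (fps_const x\<^sub>1 * L ^ Suc m
     - ins L (\<lambda>p. int p + 1) (fps_const (t * Q + (\<gamma> * V - \<alpha> * Y - \<beta> * Z)) + fps_X * fps_const H) m
     - of_nat (Suc m) * fps_const t * L ^ m * fps_const K)"
  (is "kills (?D m)")
proof (induction m)
  case 0
  have "fps_const x\<^sub>1 * L = L * fps_const x\<^sub>1 + (fps_const (H\<^sub>0 + t * K) + fps_X * fps_const x\<^sub>0)"
    by (rule commutator_L[OF x\<^sub>1])
  then have "?D 0 = L * fps_const x\<^sub>1 + 1 * fps_const H\<^sub>0 + fps_X * fps_const x\<^sub>0"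
    by (simp add: fps_const_add[symmetric] del: fps_const_add)
  then show ?case
    by (simp only:) (intro kills_add kills_annihilates annihilates)
next
  case (Suc m)
  let ?W = "fps_const (t * Q + (\<gamma> * V - \<alpha> * Y - \<beta> * Z))" and ?H = "fps_X * fps_const H"
  have 1: "fps_const x\<^sub>1 * L = L * fps_const x\<^sub>1 + (fps_const (H\<^sub>0 + t * K) + fps_X * fps_const x\<^sub>0)"
    by (rule commutator_L[OF x\<^sub>1])
  have h0: "fps_const H\<^sub>0 * L ^ Suc m = L ^ Suc m * fps_const H\<^sub>0 + ins L (\<lambda>_. 1) ?W (Suc m)"
    by (rule commute_power) (use commutator_L[OF _ H\<^sub>0(2), of 0] H\<^sub>0 in simp)
  have "fps_const x\<^sub>0 * L ^ Suc m = L ^ Suc m * fps_const x\<^sub>0 + ins L (\<lambda>_. 1) (fps_const H) (Suc m)"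
    by (rule commute_power) (use commutator_L[OF _ x\<^sub>0(2), of 0] x\<^sub>0 in simp)
  then have x0: "fps_X * (fps_const x\<^sub>0 * L ^ Suc m)
      = fps_X * L ^ Suc m * fps_const x\<^sub>0 + ins L (\<lambda>_. 1) ?H (Suc m)"
    by (simp only: ins_central[OF fps_mult_fps_X_commute] distrib_left mult.assoc)
  have k: "fps_const K * L ^ Suc m = L ^ Suc m * fps_const K"
    by (rule power_commuting_commutes[symmetric]) (rule commutes_L[OF central(9,10), symmetric])
  have tL: "fps_const t * L = L * fps_const t"
    by (rule commutes_L[OF central(3,4)])
  have "fps_const x\<^sub>1 * L ^ Suc (Suc m) = fps_const x\<^sub>1 * L * L ^ Suc m"
    by (simp add: mult.assoc)
  also have "\<dots> = L * (fps_const x\<^sub>1 * L ^ Suc m) + fps_const H\<^sub>0 * L ^ Suc m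
      + fps_const t * (fps_const K * L ^ Suc m) + fps_X * (fps_const x\<^sub>0 * L ^ Suc m)"
    by (simp only: 1 distrib_right mult.assoc fps_const_add[symmetric] fps_const_mult[symmetric] add.assoc)
  also have "\<dots> = L * (fps_const x\<^sub>1 * L ^ Suc m) + L ^ Suc m * fps_const H\<^sub>0 + fps_X * L ^ Suc m * fps_const x\<^sub>0
      + ins L (\<lambda>_. 1) (?W + ?H) (Suc m) + fps_const t * L ^ Suc m * fps_const K"
    by (simp only: h0 x0 k ins_add mult.assoc add_ac)
  finally have e: "fps_const x\<^sub>1 * L ^ Suc (Suc m) = L * (fps_const x\<^sub>1 * L ^ Suc m) + L ^ Suc m * fps_const H\<^sub>0 + fps_X * L ^ Suc m * fps_const x\<^sub>0
      + ins L (\<lambda>_. 1) (?W + ?H) (Suc m) + fps_const t * L ^ Suc m * fps_const K" .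
  have "L * (of_nat j * fps_const t * B) = of_nat j * fps_const t * (L * B)" for B j
    by (simp only: mult.assoc[symmetric] mult_of_nat_commute[symmetric, of L])
      (simp only: mult.assoc[of _ L "fps_const t"] mult.assoc[of _ "fps_const t" L] tL)
  moreover have "L * (fps_const t * B) = fps_const t * (L * B)" for B
    by (simp only: mult.assoc[symmetric] tL)
  ultimately have "?D (Suc m) = L * ?D m + L ^ Suc m * fps_const H\<^sub>0 + fps_X * L ^ Suc m * fps_const x\<^sub>0"
    by (simp only: e ins_linear_weight_Suc) (simp add: algebra_simps)
  then show ?case
    using Suc.IH by (simp only:) (intro kills_add kills_mult kills_annihilates annihilates)
qed


text \<open>In degree r of \<lambda>, with K replaced by -(n + 1). The insertion of H has used up
  one \<tau>, hence the index \<open>r - 1\<close>.\<close>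

lemma coeff_first_mode_power:
  "c * (x\<^sub>1 * fps_nth (L ^ Suc m) r
     - coeff_ins (\<lambda>p. int p + 1) (t * Q + (\<gamma> * V - \<alpha> * Y - \<beta> * Z)) m r
     - (if r = 0 then 0 else coeff_ins (\<lambda>p. int p + 1) H m (r - 1))
     + of_nat (Suc m * Suc n) * (t * fps_nth (L ^ m) r)) \<in> N"
proof -
  let ?W = "t * Q + (\<gamma> * V - \<alpha> * Y - \<beta> * Z)"
  have "ins L (\<lambda>p. int p + 1) (fps_const ?W + fps_X * fps_const H) m
      = ins L (\<lambda>p. int p + 1) (fps_const ?W) m + fps_X * ins L (\<lambda>p. int p + 1) (fps_const H) m"
    by (simp only: ins_add ins_central[OF fps_mult_fps_X_commute])
  moreover have "fps_nth (of_nat (Suc m) * fps_const t * L ^ m * fps_const K) r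
      = of_nat (Suc m) * (t * fps_nth (L ^ m) r * K)"
    by (simp add: fps_of_nat[symmetric] mult.assoc del: fps_const_mult of_nat_Suc)
  moreover have "c * fps_nth (fps_const x\<^sub>1 * L ^ Suc m
     - ins L (\<lambda>p. int p + 1) (fps_const ?W + fps_X * fps_const H) m
     - of_nat (Suc m) * fps_const t * L ^ m * fps_const K) r \<in> N"
    using first_mode_power[of m] unfolding kills_def by blast
  ultimately have "c * (x\<^sub>1 * fps_nth (L ^ Suc m) r - (coeff_ins (\<lambda>p. int p + 1) ?W m r
     + (if r = 0 then 0 else coeff_ins (\<lambda>p. int p + 1) H m (r - 1)))
     - of_nat (Suc m) * (t * fps_nth (L ^ m) r * K)) \<in> N"
    by (simp only: fps_sub_nth fps_add_nth fps_mult_left_const_nth fps_X_mult_nth coeff_ins_def)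
  note N_add[OF this level[of "c * of_nat (Suc m) * t * fps_nth (L ^ m) r"]]
  moreover have "c * of_nat (Suc m) * t * fps_nth (L ^ m) r * (K + of_nat (Suc n))
      = c * (of_nat (Suc m) * (t * fps_nth (L ^ m) r * K))
      + c * (of_nat (Suc m * Suc n) * (t * fps_nth (L ^ m) r))"
  proof -
    have "c * (of_nat i * z) = of_nat i * (c * z)" for i z
      by (simp only: mult.assoc[symmetric] mult_of_nat_commute[of i c])
    then show ?thesis
      by (simp only: distrib_left of_nat_mult mult.assoc mult_of_nat_commute[of "Suc n", symmetric])
  qed
  moreover have "a - (b + h) - p + (p + q) = a - b - h + q" for a b h p q :: 'r by simp
  ultimately show ?thesis by (simp only: distrib_left[symmetric])
qed

section \<open>Splitting the linear weights into their mean and a part with sum zero\<close>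

lemma coeff_ins_linear_weight:
  "2 * coeff_ins (\<lambda>p. int p + 1) A (Suc m) r = of_nat (m + 2) * coeff_ins (\<lambda>_. 1) A (Suc m) r
     + coeff_ins (quadratic_weight m) (Q * A - A * Q) m r
     + (if r = 0 then 0 else coeff_ins (quadratic_weight m) (\<tau> * A - A * \<tau>) m (r - 1))"
proof -
  have "L * fps_const A - fps_const A * L
      = fps_const (Q * A - A * Q) + fps_X * fps_const (\<tau> * A - A * \<tau>)"
    by (simp add: L_def algebra_simps fps_const_sub[symmetric] fps_mult_fps_X_commute[symmetric]
        del: fps_const_sub) (simp add: mult.assoc[symmetric] fps_mult_fps_X_commute)
  then have "ins L w (L * fps_const A - fps_const A * L) m
      = ins L w (fps_const (Q * A - A * Q)) m + fps_X * ins L w (fps_const (\<tau> * A - A * \<tau>)) m" for w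
    by (simp only: ins_add ins_central[OF fps_mult_fps_X_commute])
  from arg_cong[OF ins_linear_weight[of L "fps_const A" m, unfolded this], of "\<lambda>A. fps_nth A r"]
  show ?thesis
    by (simp add: coeff_ins_def numeral_fps_const fps_of_nat[symmetric] del: of_nat_add of_nat_Suc)
qed

abbreviation (input) Kw :: "'r \<Rightarrow> nat \<Rightarrow> nat \<Rightarrow> 'r" where
  "Kw A m r \<equiv> coeff_ins (quadratic_weight m) A m r"

text \<open>The mean of the weights leaves three multiples of \<gamma>^k t L^(m+1): from the
  insertion of Q, from that of V after integration by parts along U, and from the level. Their sum
  has the factor d + (m + 2) - 2n, which is zero. Only terms with the quadratic weight
  survive.\<close>

lemma even_part:
  assumes "d + (m + 2) = 2 * n" and k: "k = d + r"
  shows "of_nat (k + 1) * (\<gamma> ^ k * (2 * coeff_ins (\<lambda>p. int p + 1) (t * Q + (\<gamma> * V - \<alpha> * Y - \<beta> * Z)) (Suc m) r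
       - of_nat (2 * (Suc (Suc m) * Suc n)) * (t * fps_nth (L ^ Suc m) r)))
     - (of_nat (k + 1) * (\<gamma> ^ k * (t * (if r = 0 then 0 else Kw Q' m (r - 1))))
      + of_nat (k + 3) * (\<gamma> ^ Suc k * (Kw (Q * V - V * Q) m r + (if r = 0 then 0 else Kw V' m (r - 1)))))
     \<in> N" (is "?lhs - (?q + ?v) \<in> N")
proof -
  let ?J = "\<lambda>A. coeff_ins (\<lambda>p. int p + 1) A (Suc m) r" and ?C = "fps_nth (L ^ Suc m) r"
  let ?W = "\<gamma> * V - \<alpha> * Y - \<beta> * Z"
  have JQ: "2 * ?J (t * Q) = t * (of_nat (m + 2) * (of_int (int (Suc m) - int r) * ?C)
      + (if r = 0 then 0 else Kw Q' m (r - 1)))"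
  proof -
    have "2 * ?J (t * Q) = t * (2 * ?J Q)"
      by (simp add: coeff_ins_central[OF central(3,4)] mult_2 distrib_left)
    then show ?thesis by (simp only: coeff_ins_linear_weight count_Q) (simp add: tau)
  qed
  have JV: "2 * ?J V = of_nat (m + 2) * coeff_ins (\<lambda>_. 1) V (Suc m) r + Kw (Q * V - V * Q) m r
      + (if r = 0 then 0 else Kw V' m (r - 1))"
    by (simp only: coeff_ins_linear_weight) (simp add: tau)
  have "of_nat 2 * (of_nat (k + 1) * (\<gamma> ^ k * ?J ?W) - of_nat (k + 3) * (\<gamma> ^ Suc k * ?J V)) \<in> N"
    by (intro N_of_nat coeff_ins_W E F)
  moreover have "of_nat ((k + 3) * (m + 2)) * (\<gamma> ^ Suc k * coeff_ins (\<lambda>_. 1) V (Suc m) r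
      - of_nat (Suc k) * (\<gamma> ^ k * t * ?C)) \<in> N"
    by (intro N_of_nat coeff_ins_V)
  ultimately have sum: "of_nat 2 * (of_nat (k + 1) * (\<gamma> ^ k * ?J ?W) - of_nat (k + 3) * (\<gamma> ^ Suc k * ?J V))
     + of_nat ((k + 3) * (m + 2)) * (\<gamma> ^ Suc k * coeff_ins (\<lambda>_. 1) V (Suc m) r
      - of_nat (Suc k) * (\<gamma> ^ k * t * ?C)) \<in> N" (is "?s \<in> N")
    by (rule N_add)
  \<comment> \<open>The noncommutative monomials are frozen under names, so that only integer
    coefficients remain to be compared.\<close>
  define G W1 V1 I1 Kq Kv Kqv where "G = \<gamma> ^ k * (t * ?C)" and "W1 = \<gamma> ^ k * ?J ?W"
    and "V1 = \<gamma> ^ Suc k * ?J V" and "I1 = \<gamma> ^ Suc k * coeff_ins (\<lambda>_. 1) V (Suc m) r"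
    and "Kq = \<gamma> ^ k * (t * (if r = 0 then 0 else Kw Q' m (r - 1)))"
    and "Kv = \<gamma> ^ Suc k * (if r = 0 then 0 else Kw V' m (r - 1))"
    and "Kqv = \<gamma> ^ Suc k * Kw (Q * V - V * Q) m r"
  note defs = G_def W1_def V1_def I1_def Kq_def Kv_def Kqv_def
  have v1: "of_nat 2 * V1 = of_nat (m + 2) * I1 + Kqv + Kv"
    unfolding V1_def I1_def Kqv_def Kv_def
    by (simp only: of_nat_numeral mult_2_left[symmetric] JV distrib_left mult_of_nat_left[of "\<gamma> ^ Suc k"])
  have lhs: "?lhs = of_nat (k + 1) * (of_nat (m + 2) * (of_int (int (Suc m) - int r) * G) + Kq
      + of_nat 2 * W1 - of_nat (2 * (Suc (Suc m) * Suc n)) * G)"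
    by (simp only: coeff_ins_add distrib_left[of 2] JQ)
      (simp only: G_def Kq_def W1_def mult_of_nat_left[of t] mult_of_int_left[of t] mult_of_nat_left[of "\<gamma> ^ k"]
        mult_of_int_left[of "\<gamma> ^ k"] mult_2_left[of "\<gamma> ^ k"] distrib_left right_diff_distrib of_nat_numeral)
  have v: "?v = of_nat (k + 3) * (Kqv + Kv)"
    by (simp only: Kqv_def Kv_def distrib_left)
  have s: "?s = of_nat 2 * (of_nat (k + 1) * W1) - of_nat (k + 3) * (of_nat (m + 2) * I1 + Kqv + Kv)
      + of_nat ((k + 3) * (m + 2)) * (I1 - of_nat (Suc k) * G)"
    by (simp only: v1[symmetric] right_diff_distrib mult_of_nat_left[of "of_nat 2"]) (simp only: defs mult.assoc)
  have lc: "of_nat i * (of_nat j * w) = of_nat (i * j) * w" "of_nat i * (of_int b * w) = of_int (int i * b) * w"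
    "of_int b * (of_int b' * w) = of_int (b * b') * w" "of_int b * (of_nat j * w) = of_int (b * int j) * w"
    "of_nat i * w = of_int (int i) * w" for w :: 'r and i j b b'
    by (simp_all add: mult.assoc)
  have of_int_l: "of_int (b + b') * w = of_int b * w + of_int b' * w"
    "of_int (b - b') * w = of_int b * w - of_int b' * w" for w :: 'r and b b'
    by (simp_all add: algebra_simps)
  have "?lhs - (?q + ?v) - ?s = of_int (int (k + 1) * (int (m + 2) * (int (Suc m) - int r)
      - int (2 * (Suc (Suc m) * Suc n)) + int ((k + 3) * (m + 2)))) * G"
    unfolding lhs v s Kq_def[symmetric]
    by (simp only: lc distrib_left right_diff_distrib distrib_right left_diff_distrib of_int_l)
      (simp add: algebra_simps)
  \<comment> \<open>The number \<open>Suc n\<close> is minus the critical level; another level would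
    leave a nonzero multiple of \<open>G\<close> here.\<close>
  also have "int (k + 1) * (int (m + 2) * (int (Suc m) - int r)
      - int (2 * (Suc (Suc m) * Suc n)) + int ((k + 3) * (m + 2)))
      = int (k + 1) * int (m + 2) * (int (d + (m + 2)) - int (2 * n))"
    by (simp add: k algebra_simps)
  also have "\<dots> = 0" using assms by simp
  finally have "?lhs - (?q + ?v) = ?s" by simp
  with sum show ?thesis by simp
qed


text \<open>The mean of the weights gives an unweighted insertion of H, which lies in N because X is
  null; only the quadratic weight remains.\<close>

lemma odd_part:
  "of_nat (k + 2) * (\<gamma> ^ Suc k * (2 * coeff_ins (\<lambda>p. int p + 1) H (Suc m) r))
   - of_nat (k + 2) * (\<gamma> ^ Suc k * (Kw (Q * H - H * Q) m r + (if r = 0 then 0 else Kw H' m (r - 1))))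
   \<in> N"
proof -
  have J: "2 * coeff_ins (\<lambda>p. int p + 1) H (Suc m) r = of_nat (m + 2) * coeff_ins (\<lambda>_. 1) H (Suc m) r
      + (Kw (Q * H - H * Q) m r + (if r = 0 then 0 else Kw H' m (r - 1)))"
    by (simp only: coeff_ins_linear_weight) (simp add: tau)
  have "of_nat (k + 2) * (of_nat (m + 2) * (\<gamma> ^ Suc k * coeff_ins (\<lambda>_. 1) H (Suc m) r)) \<in> N"
    by (intro N_of_nat coeff_ins_H)
  then show ?thesis
    unfolding J by (simp only: distrib_left mult_of_nat_left[of "\<gamma> ^ Suc k"] add_diff_cancel_right')
qed

text \<open>The coefficients \<open>u\<^sub>1\<close> and \<open>u\<^sub>0\<close> belong to
  exponents r of opposite parity, and each group vanishes by itself. In the first, [Q, H] cancels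
  the term with Q', and its triplet part becomes \<open>k + 4\<close> times V' by integration by
  parts. In the second, [Q, V] cancels H' up to a difference of triplet terms that integrates to
  zero.\<close>

lemma final_cancellation:
  fixes u\<^sub>0 u\<^sub>1 :: int
  shows "of_int u\<^sub>1 * (of_nat (k + 2) * (\<gamma> ^ Suc k * (t * Kw Q' m r))
      + of_nat (k + 4) * (\<gamma> ^ Suc (Suc k) * Kw V' m r)
      + of_nat (k + 2) * (\<gamma> ^ Suc k * Kw (Q * H - H * Q) m r))
    + of_int u\<^sub>0 * (of_nat (k + 3) * (\<gamma> ^ Suc k * Kw (Q * V - V * Q) m r)
      + of_nat (k + 3) * (\<gamma> ^ Suc (Suc k) * Kw H' m r)) \<in> N"
proof (rule N_add[OF N_of_int N_of_int])
  have eq: "Kw (Q * H - H * Q) m r = - (t * Kw Q' m r) - Kw (\<gamma> * V' - \<alpha> * Y' - \<beta> * Z') m r"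
  proof -
    have "Q * H - H * Q = 0 - t * Q' - (\<gamma> * V' - \<alpha> * Y' - \<beta> * Z')" by (simp add: H)
    then show ?thesis by (simp only: coeff_ins_diff coeff_ins_zero coeff_ins_central[OF central(3,4)]) simp
  qed
  have e: "k + 2 = Suc k + 1" "k + 4 = Suc k + 3" by simp_all
  have "- (of_nat (k + 2) * (\<gamma> ^ Suc k * Kw (\<gamma> * V' - \<alpha> * Y' - \<beta> * Z') m r)
      - of_nat (k + 4) * (\<gamma> ^ Suc (Suc k) * Kw V' m r)) \<in> N"
    unfolding e by (intro N_minus coeff_ins_W E F)
  then show "of_nat (k + 2) * (\<gamma> ^ Suc k * (t * Kw Q' m r))
      + of_nat (k + 4) * (\<gamma> ^ Suc (Suc k) * Kw V' m r)
      + of_nat (k + 2) * (\<gamma> ^ Suc k * Kw (Q * H - H * Q) m r) \<in> N"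
    unfolding eq by (simp add: right_diff_distrib del: of_nat_add of_nat_Suc power_Suc)
  have eq: "Kw (Q * V - V * Q) m r = - (\<gamma> * Kw H' m r) - Kw (\<alpha> * Y' - \<beta> * Z') m r"
  proof -
    have "Q * V - V * Q = 0 - \<gamma> * H' - (\<alpha> * Y' - \<beta> * Z')" by (simp add: V)
    then show ?thesis by (simp only: coeff_ins_diff[of _ "0 - \<gamma> * H'"] coeff_ins_diff[of _ 0] coeff_ins_zero coeff_ins_central[OF central(1,2)]) simp
  qed
  have "- (of_nat (k + 3) * (\<gamma> ^ Suc k * Kw (\<alpha> * Y' - \<beta> * Z') m r)) \<in> N"
    by (intro N_minus N_of_nat coeff_ins_difference)
  moreover have "\<gamma> ^ Suc k * (\<gamma> * A) = \<gamma> ^ Suc (Suc k) * A" for A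
    by (simp only: mult.assoc[symmetric] power_Suc2)
  ultimately show "of_nat (k + 3) * (\<gamma> ^ Suc k * Kw (Q * V - V * Q) m r)
      + of_nat (k + 3) * (\<gamma> ^ Suc (Suc k) * Kw H' m r) \<in> N"
    unfolding eq by (simp only: right_diff_distrib mult_minus_right diff_add_eq) simp
qed

lemma sum_shift:
  assumes "P M = (0 :: 'r)"
  shows "(\<Sum>r\<le>M. a r * (if r = 0 then 0 else P (r - 1))) = (\<Sum>r\<le>M. a (Suc r) * P r)"
proof -
  have "(\<Sum>r\<le>M. a r * (if r = 0 then 0 else P (r - 1))) = (\<Sum>r<M. a (Suc r) * P r)"
    by (cases M) (simp_all add: sum.atMost_Suc_shift lessThan_Suc_atMost del: sum.atMost_Suc)
  then show ?thesis using assms by (simp add: lessThan_Suc_atMost[symmetric])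
qed

text \<open>To be read with m + 2 = 2k and d = 2n - 2k. After the shifts of the index, H' comes with
  the weight of index r + 2 and has to meet [Q, V] with that of index r; this is why u must have
  period 2.\<close>

theorem first_mode_invariance:
  fixes u :: "nat \<Rightarrow> int"
  assumes "d + (m + 2) = 2 * n" and u: "\<And>r. u (r + 2) = u r"
  shows "x\<^sub>1 * (\<Sum>r\<le>m + 2. of_int (u r) * (of_nat (d + r + 1) * (\<gamma> ^ (d + r) * fps_nth (L ^ (m + 2)) r))) \<in> N"
\<comment> \<open>The claim is doubled, since the mean \<open>(m + 2) / 2\<close> of the linear
  weights need not be an integer.\<close>
proof (rule N_divide[of 1])
  let ?J = "\<lambda>A. coeff_ins (\<lambda>p. int p + 1) A (Suc m)" and ?M = "m + 2"
  let ?W = "t * Q + (\<gamma> * V - \<alpha> * Y - \<beta> * Z)" and ?c = "\<lambda>r. of_nat (2 * (Suc (Suc m) * Suc n)) * (t * fps_nth (L ^ Suc m) r)"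
  define a where "a r = of_int (u r) * (of_nat (d + r + 1) * \<gamma> ^ (d + r))" for r
  have x\<gamma>: "x\<^sub>1 * a r = a r * x\<^sub>1" for r
  proof -
    have "x\<^sub>1 * \<gamma> ^ (d + r) = \<gamma> ^ (d + r) * x\<^sub>1"
      by (rule power_commuting_commutes[symmetric]) (rule central(14)[symmetric])
    then show ?thesis
      unfolding a_def mult_of_nat_left[of x\<^sub>1] mult_of_int_left[of x\<^sub>1] by (simp only: mult.assoc)
  qed
  have I0: "Kw A m (?M) = 0" "Kw A m (?M - 1) = 0" "?J A ?M = 0" for A
    by (simp_all add: coeff_ins_eq_0)
  have 1: "(\<Sum>r\<le>?M. 2 * a r * (x\<^sub>1 * fps_nth (L ^ ?M) r - ?J ?W r - (if r = 0 then 0 else ?J H (r - 1))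
      + of_nat (Suc (Suc m) * Suc n) * (t * fps_nth (L ^ Suc m) r))) \<in> N"
    by (rule N_sum) (use coeff_first_mode_power[of _ "Suc m"] in simp)
  have 2: "(\<Sum>r\<le>?M. a r * (2 * ?J ?W r - ?c r)
      - a r * (t * (if r = 0 then 0 else Kw Q' m (r - 1)))
      - of_int (u r) * (of_nat (d + r + 3) * (\<gamma> ^ Suc (d + r) * (Kw (Q * V - V * Q) m r + (if r = 0 then 0 else Kw V' m (r - 1)))))) \<in> N"
    (is "(\<Sum>r\<le>?M. ?e r) \<in> N")
  proof (rule N_sum)
    fix r
    show "?e r \<in> N"
      using N_of_int[OF even_part[OF assms(1) refl, of r], of "u r"]
      by (simp only: a_def right_diff_distrib distrib_left mult.assoc diff_diff_eq add.assoc)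
  qed
  have 3: "(\<Sum>r\<le>?M. a (Suc r) * (2 * ?J H r)
      - a (Suc r) * (Kw (Q * H - H * Q) m r + (if r = 0 then 0 else Kw H' m (r - 1)))) \<in> N"
    (is "(\<Sum>r\<le>?M. ?o r) \<in> N")
  proof (rule N_sum)
    fix r
    show "?o r \<in> N"
      using N_of_int[OF odd_part[of "d + r" m r], of "u (Suc r)"]
      by (simp add: a_def right_diff_distrib mult.assoc add.commute del: of_nat_add of_nat_Suc)
  qed
  \<comment> \<open>The weight of V after integration by parts, with \<open>d + r + 3\<close> in
    place of \<open>d + r + 1\<close> and one more factor \<gamma>.\<close>
  define b where "b r = of_int (u r) * (of_nat (d + r + 3) * \<gamma> ^ Suc (d + r))" for r
  have 4: "(\<Sum>r\<le>?M. a (Suc r) * (t * Kw Q' m r) + b (Suc r) * Kw V' m r + a (Suc r) * Kw (Q * H - H * Q) m r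
      + (b r * Kw (Q * V - V * Q) m r + a (Suc (Suc r)) * Kw H' m r)) \<in> N" (is "(\<Sum>r\<le>?M. ?f r) \<in> N")
  proof (rule N_sum)
    fix r
    have "u (Suc (Suc r)) = u r" using u[of r] by simp
    moreover have "d + Suc r + 1 = d + r + 2" "d + Suc (Suc r) + 1 = d + r + 3" "d + Suc r + 3 = d + r + 4"
      "d + Suc r = Suc (d + r)" "d + Suc (Suc r) = Suc (Suc (d + r))" by simp_all
    ultimately have "?f r = of_int (u (Suc r)) * (of_nat (d + r + 2) * (\<gamma> ^ Suc (d + r) * (t * Kw Q' m r))
      + of_nat (d + r + 4) * (\<gamma> ^ Suc (Suc (d + r)) * Kw V' m r)
      + of_nat (d + r + 2) * (\<gamma> ^ Suc (d + r) * Kw (Q * H - H * Q) m r))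
    + of_int (u r) * (of_nat (d + r + 3) * (\<gamma> ^ Suc (d + r) * Kw (Q * V - V * Q) m r)
      + of_nat (d + r + 3) * (\<gamma> ^ Suc (Suc (d + r)) * Kw H' m r))"
      by (simp only: a_def b_def distrib_left mult.assoc)
    then show "?f r \<in> N"
      by (simp only: final_cancellation)
  qed
  have s: "(\<Sum>r\<le>?M. a r * (if r = 0 then 0 else 2 * ?J H (r - 1))) = (\<Sum>r\<le>?M. a (Suc r) * (2 * ?J H r))"
    "(\<Sum>r\<le>?M. a (Suc r) * (if r = 0 then 0 else Kw H' m (r - 1))) = (\<Sum>r\<le>?M. a (Suc (Suc r)) * Kw H' m r)"
    "(\<Sum>r\<le>?M. a r * (if r = 0 then 0 else t * Kw Q' m (r - 1))) = (\<Sum>r\<le>?M. a (Suc r) * (t * Kw Q' m r))"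
    "(\<Sum>r\<le>?M. b r * (if r = 0 then 0 else Kw V' m (r - 1))) = (\<Sum>r\<le>?M. b (Suc r) * Kw V' m r)"
    using sum_shift[of "\<lambda>r. 2 * ?J H r" ?M a] sum_shift[of "\<lambda>r. Kw H' m r" ?M "\<lambda>r. a (Suc r)"]
      sum_shift[of "\<lambda>r. t * Kw Q' m r" ?M a] sum_shift[of "\<lambda>r. Kw V' m r" ?M b]
    by (simp_all only: I0 mult_zero_right)
  have ti: "t * (if r = 0 then 0 else A) = (if r = 0 then 0 else t * A)"
    "2 * (if r = 0 then 0 else A) = (if r = 0 then 0 else 2 * A)" for A and r :: nat by simp_all
  have two: "2 * a r * A = a r * (2 * A)" for r A
    by (simp add: mult_2 distrib_left distrib_right)
  have "x\<^sub>1 * (\<Sum>r\<le>?M. of_int (u r) * (of_nat (d + r + 1) * (\<gamma> ^ (d + r) * fps_nth (L ^ ?M) r)))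
      = (\<Sum>r\<le>?M. a r * (x\<^sub>1 * fps_nth (L ^ ?M) r))"
  proof -
    have "x\<^sub>1 * (of_int (u r) * (of_nat (d + r + 1) * (\<gamma> ^ (d + r) * A))) = a r * (x\<^sub>1 * A)" for r A
    proof -
      have "x\<^sub>1 * (of_int (u r) * (of_nat (d + r + 1) * (\<gamma> ^ (d + r) * A))) = (x\<^sub>1 * a r) * A"
        by (simp only: a_def mult.assoc)
      then show ?thesis by (simp only: x\<gamma> mult.assoc)
    qed
    then show ?thesis by (simp only: sum_distrib_left)
  qed
  then have "of_nat (Suc 1) * (x\<^sub>1 * (\<Sum>r\<le>?M. of_int (u r) * (of_nat (d + r + 1) * (\<gamma> ^ (d + r) * fps_nth (L ^ ?M) r))))
      = (\<Sum>r\<le>?M. a r * (2 * (x\<^sub>1 * fps_nth (L ^ ?M) r)))"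
    by (simp add: sum_distrib_left two[symmetric] mult.assoc)
  moreover have "(\<Sum>r\<le>?M. a r * (2 * (x\<^sub>1 * fps_nth (L ^ ?M) r))) \<in> N"
  proof -
    have c: "2 * (of_nat (Suc (Suc m) * Suc n) * A) = of_nat (2 * (Suc (Suc m) * Suc n)) * A" for A :: 'r
      by (simp only: of_nat_mult mult.assoc of_nat_numeral)
    have bb: "of_int (u r) * (of_nat (d + r + 3) * (\<gamma> ^ Suc (d + r) * A)) = b r * A" for r A
      by (simp only: b_def mult.assoc)
    have "(\<Sum>r\<le>?M. a r * (2 * (x\<^sub>1 * fps_nth (L ^ ?M) r))) - (\<Sum>r\<le>?M. a r * (2 * ?J ?W r))
        - (\<Sum>r\<le>?M. a (Suc r) * (2 * ?J H r)) + (\<Sum>r\<le>?M. a r * ?c r) \<in> N"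
      using 1 by (simp only: two c right_diff_distrib distrib_left ti sum_subtractf sum.distrib s)
    moreover have "(\<Sum>r\<le>?M. a r * (2 * ?J ?W r)) - (\<Sum>r\<le>?M. a r * ?c r)
        - (\<Sum>r\<le>?M. a (Suc r) * (t * Kw Q' m r)) - ((\<Sum>r\<le>?M. b r * Kw (Q * V - V * Q) m r)
        + (\<Sum>r\<le>?M. b (Suc r) * Kw V' m r)) \<in> N"
      using 2 by (simp only: bb right_diff_distrib distrib_left ti sum_subtractf sum.distrib s)
    moreover have "(\<Sum>r\<le>?M. a (Suc r) * (2 * ?J H r)) - ((\<Sum>r\<le>?M. a (Suc r) * Kw (Q * H - H * Q) m r)
        + (\<Sum>r\<le>?M. a (Suc (Suc r)) * Kw H' m r)) \<in> N"
      using 3 by (simp only: distrib_left sum_subtractf sum.distrib s)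
    ultimately show ?thesis
      using N_add[OF N_add N_add[OF _ 4]] by (fastforce simp: sum.distrib algebra_simps)
  qed
  ultimately show "of_nat (Suc 1) * (x\<^sub>1 * (\<Sum>r\<le>?M. of_int (u r) * (of_nat (d + r + 1) * (\<gamma> ^ (d + r) * fps_nth (L ^ ?M) r)))) \<in> N"
    by simp
qed

end

section \<open>Symplectic fermions\<close>

definition commutator_is :: "'r::ring_1 \<Rightarrow> 'r \<Rightarrow> 'r \<Rightarrow> bool" where
  "commutator_is e x y \<longleftrightarrow> e * x = x * e + y"

lemma commutator_is_mult:
  assumes "commutator_is e x x'" "commutator_is e y y'"
  shows "commutator_is e (x * y) (x' * y + x * y')"
proof -
  have "e * (x * y) = e * x * y" by (simp add: mult.assoc)
  also have "\<dots> = x * (e * y) + x' * y"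
    using assms(1) by (simp add: commutator_is_def distrib_right mult.assoc)
  also have "\<dots> = x * y * e + (x' * y + x * y')"
    using assms(2) by (simp add: commutator_is_def distrib_left mult.assoc add_ac)
  finally show ?thesis by (simp add: commutator_is_def)
qed

lemma commutator_is_sum:
  assumes "\<And>i. i \<in> A \<Longrightarrow> commutator_is e (x i) (y i)"
  shows "commutator_is e (\<Sum>i\<in>A. x i) (\<Sum>i\<in>A. y i)"
  using assms by (simp add: commutator_is_def sum_distrib_left sum_distrib_right sum.distrib[symmetric])

lemma commutator_is_of_int: "commutator_is e x x' \<Longrightarrow> commutator_is e (of_int z * x) (of_int z * x')"
  by (simp add: commutator_is_def mult_of_int_left distrib_left mult.assoc)

lemma commutator_is_left:
  assumes "commutator_is e x x'" "commutator_is g x x''"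
  shows "commutator_is (e + g) x (x' + x'')" "commutator_is (e - g) x (x' - x'')"
  using assms by (simp_all add: commutator_is_def algebra_simps)

lemma commutator_is_sum_left:
  assumes "\<And>i. i \<in> A \<Longrightarrow> commutator_is (e i) x (y i)"
  shows "commutator_is (\<Sum>i\<in>A. e i) x (\<Sum>i\<in>A. y i)"
  using assms by (simp add: commutator_is_def sum_distrib_left sum_distrib_right sum.distrib[symmetric])

text \<open>Here \<phi> is the second Grassmann family after its index has been lowered with the
  symplectic form, so that sl_2 can mix \<psi>_i with \<phi>_i. Squares are required to vanish
  separately, because anticommutation does not force this in a ring with 2-torsion.\<close>

locale symplectic_fermions =
  fixes \<psi> \<phi> d\<psi> d\<phi> :: "'i::finite \<Rightarrow> 'r::ring_1" and sg :: "'i \<Rightarrow> int" and pr :: "'i \<Rightarrow> 'i"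
  assumes pr_pr [simp]: "pr (pr i) = i" and sg_pr [simp]: "sg (pr i) = - sg i"
    and sg_sg: "sg i * sg i = 1"
    and odd: "\<psi> j * \<psi> i = - (\<psi> i * \<psi> j)" "\<phi> j * \<phi> i = - (\<phi> i * \<phi> j)" "\<phi> j * \<psi> i = - (\<psi> i * \<phi> j)"
    and square: "\<psi> i * \<psi> i = 0" "\<phi> i * \<phi> i = 0"
    and d\<psi>: "d\<psi> i * \<psi> j = (if i = j then 1 else 0) - \<psi> j * d\<psi> i" "d\<psi> i * \<phi> j = - (\<phi> j * d\<psi> i)"
    and d\<phi>: "d\<phi> i * \<phi> j = (if i = j then 1 else 0) - \<phi> j * d\<phi> i" "d\<phi> i * \<psi> j = - (\<psi> j * d\<phi> i)"
begin

lemma pr_neq [simp]: "pr i \<noteq> i" "i \<noteq> pr i"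
proof -
  show "pr i \<noteq> i"
  proof
    assume "pr i = i"
    then have "sg i = 0" using sg_pr[of i] by simp
    then show False using sg_sg[of i] by simp
  qed
  then show "i \<noteq> pr i" by metis
qed

definition om :: "'i \<Rightarrow> 'i \<Rightarrow> 'r" where
  "om i j = of_int (if j = pr i then sg i else 0)"

text \<open>The linear form \<omega>(e_i, \<psi>), and below it \<omega>(e_i, \<phi>).\<close>

definition \<psi>h :: "'i \<Rightarrow> 'r" where "\<psi>h i = of_int (sg i) * \<psi> (pr i)"
definition \<phi>h :: "'i \<Rightarrow> 'r" where "\<phi>h i = of_int (sg i) * \<phi> (pr i)"

lemma sum_om:
  "(\<Sum>j\<in>UNIV. A j * (om i j * B j)) = of_int (sg i) * (A (pr i) * B (pr i))"
proof -
  have "A j * (om i j * B j) = (if j = pr i then of_int (sg i) * (A (pr i) * B (pr i)) else 0)" for j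
    by (simp add: om_def mult_of_int_left)
  then show ?thesis by simp
qed

lemma reindex_pr: "(\<Sum>j\<in>UNIV. g (pr j)) = (\<Sum>j\<in>UNIV. g j)"
  by (rule sum.reindex_bij_witness[of _ pr pr]) auto

text \<open>Together with \<beta> and \<gamma>, the quadratic forms that are invariant under the
  symplectic group. They form the adjoint triplet of sl_2, with \<gamma> in the middle: E takes
  \<gamma> to \<alpha> and F takes it to \<beta>.\<close>

definition \<alpha> where "\<alpha> = (\<Sum>j\<in>UNIV. \<psi> j * \<psi>h j)"
definition \<beta> where "\<beta> = (\<Sum>j\<in>UNIV. \<phi> j * \<phi>h j)"
definition \<gamma> where "\<gamma> = (\<Sum>j\<in>UNIV. \<phi> j * \<psi>h j)"

text \<open>Two signs cancel: one from the skew form, one from exchanging the two families.\<close>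

lemma \<gamma>_alt: "\<gamma> = (\<Sum>j\<in>UNIV. \<psi> j * \<phi>h j)"
proof -
  have "(\<Sum>j\<in>UNIV. \<psi> j * \<phi>h j) = (\<Sum>j\<in>UNIV. \<psi> (pr j) * \<phi>h (pr j))"
    by (rule reindex_pr[symmetric])
  also have "\<dots> = \<gamma>"
    unfolding \<gamma>_def by (intro sum.cong) (simp_all add: \<psi>h_def \<phi>h_def odd(3) mult_of_int_left)
  finally show ?thesis ..
qed

definition E where "E = (\<Sum>i\<in>UNIV. \<psi> i * d\<phi> i)"
definition F where "F = (\<Sum>i\<in>UNIV. \<phi> i * d\<psi> i)"

definition even_elem :: "'r \<Rightarrow> bool" where
  "even_elem x \<longleftrightarrow> (\<forall>i. x * \<psi> i = \<psi> i * x \<and> x * \<phi> i = \<phi> i * x)"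

lemma odd': "\<psi> j * \<phi> i = - (\<phi> i * \<psi> j)"
  by (simp add: odd(3))

lemma odd_left: "\<psi> j * (\<psi> i * x) = - (\<psi> i * (\<psi> j * x))" "\<phi> j * (\<phi> i * x) = - (\<phi> i * (\<phi> j * x))"
  "\<phi> j * (\<psi> i * x) = - (\<psi> i * (\<phi> j * x))"
  by (simp_all only: mult.assoc[symmetric] odd[of j i] mult_minus_left)

lemma even_elem_mult:
  assumes "\<And>i. x * \<psi> i = - (\<psi> i * x)" "\<And>i. x * \<phi> i = - (\<phi> i * x)"
    "\<And>i. y * \<psi> i = - (\<psi> i * y)" "\<And>i. y * \<phi> i = - (\<phi> i * y)"
  shows "even_elem (x * y)"
proof -
  have "x * y * z = z * (x * y)" if "x * z = - (z * x)" "y * z = - (z * y)" for z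
  proof -
    have "x * y * z = x * (y * z)" by (rule mult.assoc)
    also have "\<dots> = - (x * z * y)" by (simp add: that(2) mult.assoc)
    also have "\<dots> = z * (x * y)" by (simp add: that(1) mult.assoc)
    finally show ?thesis .
  qed
  then show ?thesis using assms by (simp add: even_elem_def)
qed

lemma even_elem_sum: "(\<And>i. i \<in> A \<Longrightarrow> even_elem (g i)) \<Longrightarrow> even_elem (\<Sum>i\<in>A. g i)"
  by (simp add: even_elem_def sum_distrib_left sum_distrib_right)

lemma even_elem_add: "even_elem x \<Longrightarrow> even_elem y \<Longrightarrow> even_elem (x + y)"
  and even_elem_diff: "even_elem x \<Longrightarrow> even_elem y \<Longrightarrow> even_elem (x - y)"
  and even_elem_minus: "even_elem x \<Longrightarrow> even_elem (- x)"
  by (simp_all add: even_elem_def algebra_simps)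

lemma odd_h:
  "\<psi>h i * \<psi> j = - (\<psi> j * \<psi>h i)" "\<psi>h i * \<phi> j = - (\<phi> j * \<psi>h i)"
  "\<phi>h i * \<psi> j = - (\<psi> j * \<phi>h i)" "\<phi>h i * \<phi> j = - (\<phi> j * \<phi>h i)"
  using odd[of "pr i" j] odd[of j "pr i"]
  by (simp_all add: \<psi>h_def \<phi>h_def mult_of_int_left mult.assoc)

lemma even_elem_basic: "even_elem (\<psi> i * \<psi> j)" "even_elem (\<psi> i * \<phi> j)" "even_elem (\<phi> i * \<phi> j)" "even_elem (\<phi> i * \<psi>h j)"
   "even_elem (\<psi> i * \<psi>h j)" "even_elem (\<phi> i * \<phi>h j)" "even_elem (\<psi>h i * \<psi> j)" "even_elem (\<psi>h i * \<phi> j)" "even_elem (\<phi>h i * \<psi> j)" "even_elem (\<phi>h i * \<phi> j)"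
   "even_elem (\<psi>h i * \<phi>h j)" "even_elem (\<phi> i * \<psi> j)"
  by (rule even_elem_mult; rule odd odd' odd_h)+

lemma even_elem_quadratic: "even_elem \<alpha>" "even_elem \<beta>" "even_elem \<gamma>"
  unfolding \<alpha>_def \<beta>_def \<gamma>_def by (auto intro!: even_elem_sum even_elem_basic)

lemma even_elem_of_int: "even_elem x \<Longrightarrow> even_elem (of_int z * x)"
  by (simp add: even_elem_def mult_of_int_left mult.assoc)

lemma even_elem_h: "even_elem x \<Longrightarrow> x * \<psi>h i = \<psi>h i * x" "even_elem x \<Longrightarrow> x * \<phi>h i = \<phi>h i * x"
  by (simp_all add: even_elem_def \<psi>h_def \<phi>h_def mult_of_int_left mult.assoc)

lemma even_elem_commute:
  assumes "even_elem x"
  shows "x * \<alpha> = \<alpha> * x" "x * \<beta> = \<beta> * x" "x * \<gamma> = \<gamma> * x"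
proof -
  have 1: "x * (y * z) = y * z * x" if "x * y = y * x" "x * z = z * x" for y z
    by (simp only: mult.assoc[symmetric] that(1)) (simp only: mult.assoc that(2))
  show "x * \<alpha> = \<alpha> * x" "x * \<beta> = \<beta> * x" "x * \<gamma> = \<gamma> * x"
    unfolding \<alpha>_def \<beta>_def \<gamma>_def sum_distrib_left sum_distrib_right
    using assms by (auto intro!: sum.cong 1 even_elem_h simp: even_elem_def)
qed

lemma commutator_E:
  "commutator_is E (\<psi> i) 0" "commutator_is E (\<phi> i) (\<psi> i)" "commutator_is E (\<psi>h i) 0"
  "commutator_is E (\<phi>h i) (\<psi>h i)" "commutator_is E \<gamma> \<alpha>"
proof -
  show \<psi>: "commutator_is E (\<psi> i) 0" for i
    by (simp add: commutator_is_def E_def sum_distrib_left sum_distrib_right mult.assoc d\<phi> odd_left[of i])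
  have "\<psi> j * d\<phi> j * \<phi> i = \<phi> i * (\<psi> j * d\<phi> j) + (if i = j then \<psi> i else 0)" for i j
    by (simp add: mult.assoc d\<phi> right_diff_distrib odd_left)
  then show \<phi>: "commutator_is E (\<phi> i) (\<psi> i)" for i
    by (simp add: commutator_is_def E_def sum_distrib_left sum_distrib_right sum.distrib)
  show \<psi>h: "commutator_is E (\<psi>h i) 0" for i
    using commutator_is_of_int[OF \<psi>, of "sg i"] by (simp add: \<psi>h_def)
  show "commutator_is E (\<phi>h i) (\<psi>h i)"
    using commutator_is_of_int[OF \<phi>, of "sg i"] by (simp add: \<psi>h_def \<phi>h_def)
  show "commutator_is E \<gamma> \<alpha>"
    unfolding \<gamma>_def \<alpha>_def by (rule commutator_is_sum) (use commutator_is_mult[OF \<phi> \<psi>h] in simp)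
qed

lemma commutator_F:
  "commutator_is F (\<phi> i) 0" "commutator_is F (\<psi> i) (\<phi> i)" "commutator_is F (\<phi>h i) 0"
  "commutator_is F (\<psi>h i) (\<phi>h i)" "commutator_is F \<gamma> \<beta>"
proof -
  show \<phi>: "commutator_is F (\<phi> i) 0" for i
    by (simp add: commutator_is_def F_def sum_distrib_left sum_distrib_right mult.assoc d\<psi> odd_left[of i])
  have "\<phi> j * d\<psi> j * \<psi> i = \<psi> i * (\<phi> j * d\<psi> j) + (if i = j then \<phi> i else 0)" for i j
    by (simp add: mult.assoc d\<psi> right_diff_distrib odd_left)
  then show \<psi>: "commutator_is F (\<psi> i) (\<phi> i)" for i
    by (simp add: commutator_is_def F_def sum_distrib_left sum_distrib_right sum.distrib)
  show \<phi>h: "commutator_is F (\<phi>h i) 0" for i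
    using commutator_is_of_int[OF \<phi>, of "sg i"] by (simp add: \<phi>h_def)
  show \<psi>h: "commutator_is F (\<psi>h i) (\<phi>h i)" for i
    using commutator_is_of_int[OF \<psi>, of "sg i"] by (simp add: \<psi>h_def \<phi>h_def)
  show "commutator_is F \<gamma> \<beta>"
    unfolding \<gamma>_def \<beta>_def by (rule commutator_is_sum) (use commutator_is_mult[OF \<phi> \<psi>h] in simp)
qed

text \<open>The derivation replacing \<open>\<psi>\<^sub>p\<close> by the linear form \<open>\<omega>(e\<^sub>q, \<psi>)\<close> and the same for \<open>\<phi>\<close>: for
  \<open>p \<noteq> q'\<close> their sum is one half of the action of the matrix \<open>e\<^sub>p\<^sub>q + e\<^sub>q\<^sub>p\<close>.\<close>

definition D\<psi> where "D\<psi> q p = \<psi>h q * d\<psi> p"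
definition D\<phi> where "D\<phi> q p = \<phi>h q * d\<phi> p"

lemma commutator_D\<psi>:
  "commutator_is (D\<psi> q p) (\<psi> i) (if i = p then \<psi>h q else 0)" "commutator_is (D\<psi> q p) (\<phi> i) 0"
proof -
  have "\<psi>h q * (y * d\<psi> p) = - (y * (\<psi>h q * d\<psi> p))" if "\<psi>h q * y = - (y * \<psi>h q)" for y
    by (simp only: mult.assoc[symmetric] that mult_minus_left)
  then show "commutator_is (D\<psi> q p) (\<psi> i) (if i = p then \<psi>h q else 0)" "commutator_is (D\<psi> q p) (\<phi> i) 0"
    by (auto simp: commutator_is_def D\<psi>_def mult.assoc d\<psi> right_diff_distrib odd_h)
qed

lemma commutator_D\<phi>:
  "commutator_is (D\<phi> q p) (\<phi> i) (if i = p then \<phi>h q else 0)" "commutator_is (D\<phi> q p) (\<psi> i) 0"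
proof -
  have "\<phi>h q * (y * d\<phi> p) = - (y * (\<phi>h q * d\<phi> p))" if "\<phi>h q * y = - (y * \<phi>h q)" for y
    by (simp only: mult.assoc[symmetric] that mult_minus_left)
  then show "commutator_is (D\<phi> q p) (\<phi> i) (if i = p then \<phi>h q else 0)" "commutator_is (D\<phi> q p) (\<psi> i) 0"
    by (auto simp: commutator_is_def D\<phi>_def mult.assoc d\<phi> right_diff_distrib odd_h)
qed

end

text \<open>Diagonal terms and opposite pairs cancel separately, so no division by 2 is
  made.\<close>

lemma sum_alternating:
  fixes g :: "'i \<Rightarrow> 'i \<Rightarrow> 'a::ab_group_add"
  assumes "\<And>i. g i i = 0" "\<And>i j. g i j + g j i = 0"
  shows "(\<Sum>i\<in>A. \<Sum>j\<in>A. g i j) = 0"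
proof (induction A rule: infinite_finite_induct)
  case (insert x A)
  have "(\<Sum>i\<in>A. g i x) + (\<Sum>j\<in>A. g x j) = 0"
    using assms(2) by (simp add: sum.distrib[symmetric])
  with insert show ?case by (simp add: assms(1) sum.distrib add.assoc[symmetric])
qed simp_all

section \<open>Currents coupled to symplectic fermions\<close>

text \<open>The element \<open>f c i j\<close> models F_ij[c] with its second index lowered, whence
  the symmetry. The bracket is stated only where no central term occurs.\<close>

locale coupled_currents = symplectic_fermions \<psi> \<phi> d\<psi> d\<phi> sg pr
  for \<psi> \<phi> d\<psi> d\<phi> :: "'i::finite \<Rightarrow> 'r::ring_1" and sg pr +
  fixes f :: "int \<Rightarrow> 'i \<Rightarrow> 'i \<Rightarrow> 'r" and \<tau> :: 'r
  assumes f_sym: "f c i j = f c j i"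
    and f_fermion: "f c i j * \<psi> k = \<psi> k * f c i j" "f c i j * \<phi> k = \<phi> k * f c i j"
      "f c i j * d\<psi> k = d\<psi> k * f c i j" "f c i j * d\<phi> k = d\<phi> k * f c i j"
    and \<tau>_fermion: "\<tau> * \<psi> k = \<psi> k * \<tau>" "\<tau> * \<phi> k = \<phi> k * \<tau>"
      "\<tau> * d\<psi> k = d\<psi> k * \<tau>" "\<tau> * d\<phi> k = d\<phi> k * \<tau>"
    and \<tau>_f: "\<tau> * f (- 1) i j = f (- 1) i j * \<tau> + f (- 2) i j" "\<tau> * f 0 i j = f 0 i j * \<tau>"
    and bracket: "c + c' \<noteq> 0 \<Longrightarrow> f c i j * f c' k l = f c' k l * f c i j
      + (om j k * f (c + c') i l + om j l * f (c + c') i k + om i k * f (c + c') j l + om i l * f (c + c') j k)"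
begin

definition Q :: "int \<Rightarrow> 'r" where
  "Q c = (\<Sum>i\<in>UNIV. \<Sum>j\<in>UNIV. \<psi> i * \<phi> j * f c i j)"

definition field :: "('i \<Rightarrow> 'r) \<Rightarrow> int \<Rightarrow> 'i \<Rightarrow> 'r" where
  "field w c i = (\<Sum>l\<in>UNIV. w l * f c i l)"

lemma field_add: "field (\<lambda>l. v l + w l) c i = field v c i + field w c i"
  by (simp add: field_def distrib_right sum.distrib)

lemma field_diff: "field (\<lambda>l. v l - w l) c i = field v c i - field w c i"
  by (simp add: field_def left_diff_distrib sum_subtractf)

lemma field_mult: "field (\<lambda>l. z * w l) c i = z * field w c i"
  by (simp add: field_def sum_distrib_left mult.assoc)

lemma f_\<psi>h: "f c i j * \<psi>h k = \<psi>h k * f c i j" "f c i j * \<phi>h k = \<phi>h k * f c i j"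
  by (simp_all add: \<psi>h_def \<phi>h_def mult_of_int_left f_fermion mult.assoc)

lemma f_commutes_mult: "f c i j * x = x * f c i j \<Longrightarrow> f c i j * y = y * f c i j \<Longrightarrow> f c i j * (x * y) = x * y * f c i j"
  by (metis mult.assoc)

lemma f_Q:
  assumes "c + c' \<noteq> 0"
  shows "commutator_is (f c i j) (Q c')
     (field (\<lambda>l. \<psi>h j * \<phi> l) (c + c') i + field (\<lambda>l. \<psi> l * \<phi>h j) (c + c') i
    + field (\<lambda>l. \<psi>h i * \<phi> l) (c + c') j + field (\<lambda>l. \<psi> l * \<phi>h i) (c + c') j)"
proof -
  let ?d = "c + c'"
  have "commutator_is (f c i j) (\<psi> k * \<phi> l * f c' k l)
     (\<psi> k * \<phi> l * (om j k * f ?d i l + om j l * f ?d i k + om i k * f ?d j l + om i l * f ?d j k))" for k l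
  proof -
    have "commutator_is (f c i j) (\<psi> k * \<phi> l) 0"
      by (simp add: commutator_is_def f_commutes_mult f_fermion)
    moreover have "commutator_is (f c i j) (f c' k l)
      (om j k * f ?d i l + om j l * f ?d i k + om i k * f ?d j l + om i l * f ?d j k)"
      using bracket[OF assms] by (simp add: commutator_is_def)
    ultimately show ?thesis using commutator_is_mult by fastforce
  qed
  then have 1: "commutator_is (f c i j) (Q c') (\<Sum>k\<in>UNIV. \<Sum>l\<in>UNIV.
     \<psi> k * \<phi> l * (om j k * f ?d i l + om j l * f ?d i k + om i k * f ?d j l + om i l * f ?d j k))"
    unfolding Q_def by (intro commutator_is_sum)
  have left: "(\<Sum>k\<in>UNIV. \<Sum>l\<in>UNIV. \<psi> k * \<phi> l * (om j k * f ?d i l)) = field (\<lambda>l. \<psi>h j * \<phi> l) ?d i" for i j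
  proof -
    have "\<psi> k * \<phi> l * (om j k * f ?d i l) = \<psi> k * (om j k * (\<phi> l * f ?d i l))" for k l
      by (simp add: om_def mult_of_int_left mult.assoc)
    then show ?thesis
      by (subst sum.swap) (simp add: sum_om field_def \<psi>h_def mult.assoc)
  qed
  have right: "(\<Sum>k\<in>UNIV. \<Sum>l\<in>UNIV. \<psi> k * \<phi> l * (om j l * f ?d i k)) = field (\<lambda>k. \<psi> k * \<phi>h j) ?d i" for i j
  proof -
    have "\<psi> k * \<phi> l * (om j l * f ?d i k) = \<psi> k * (\<phi> l * (om j l * f ?d i k))" for k l
      by (simp add: mult.assoc)
    then show ?thesis
      by (simp add: sum_distrib_left[symmetric] sum_om field_def \<phi>h_def mult_of_int_left mult.assoc)
  qed
  show ?thesis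
    using 1 by (simp only: distrib_left sum.distrib left right)
qed

lemma derivation_Q:
  assumes "\<And>i. commutator_is e (\<psi> i) (u i)" "\<And>i. commutator_is e (\<phi> i) (v i)"
    and "\<And>i j. commutator_is e (f c i j) 0"
  shows "commutator_is e (Q c) (\<Sum>i\<in>UNIV. \<Sum>j\<in>UNIV. (u i * \<phi> j + \<psi> i * v j) * f c i j)"
proof -
  have "commutator_is e (\<psi> i * \<phi> j * f c i j) ((u i * \<phi> j + \<psi> i * v j) * f c i j)" for i j
    using commutator_is_mult[OF commutator_is_mult[OF assms(1)[of i] assms(2)[of j]] assms(3)[of i j]] by simp
  then show ?thesis unfolding Q_def by (intro commutator_is_sum)
qed

lemma f_commutes_operators:
  "commutator_is E (f c i j) 0" "commutator_is F (f c i j) 0"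
  "commutator_is (D\<psi> q p) (f c i j) 0" "commutator_is (D\<phi> q p) (f c i j) 0"
  using f_commutes_mult f_fermion f_\<psi>h
  by (simp_all add: commutator_is_def E_def F_def D\<psi>_def D\<phi>_def sum_distrib_left sum_distrib_right)

lemma \<tau>_\<psi>h: "\<tau> * \<psi>h k = \<psi>h k * \<tau>" "\<tau> * \<phi>h k = \<phi>h k * \<tau>"
  by (simp_all add: \<psi>h_def \<phi>h_def mult_of_int_left \<tau>_fermion mult.assoc)

lemma \<tau>_commutes_mult: "\<tau> * x = x * \<tau> \<Longrightarrow> \<tau> * y = y * \<tau> \<Longrightarrow> \<tau> * (x * y) = x * y * \<tau>"
  by (metis mult.assoc)

lemma \<tau>_commutes_operators:
  "commutator_is E \<tau> 0" "commutator_is F \<tau> 0"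
  "commutator_is (D\<psi> q p) \<tau> 0" "commutator_is (D\<phi> q p) \<tau> 0"
  using \<tau>_commutes_mult \<tau>_fermion \<tau>_\<psi>h
  by (simp_all add: commutator_is_def E_def F_def D\<psi>_def D\<phi>_def sum_distrib_left sum_distrib_right)

text \<open>E turns Q into the contraction of the symmetric f with the alternating products \<psi>_i
  \<psi>_j, which is zero.\<close>

lemma E_Q: "commutator_is E (Q c) 0"
proof -
  have "(\<Sum>i\<in>UNIV. \<Sum>j\<in>UNIV. \<psi> i * \<psi> j * f c i j) = 0"
    by (rule sum_alternating) (simp_all add: square f_sym[of c] odd(1)[THEN eq_neg_iff_add_eq_0[THEN iffD1]] distrib_right[symmetric])
  then show ?thesis
    using derivation_Q[OF commutator_E(1,2) f_commutes_operators(1), of c] by simp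
qed

lemma F_Q: "commutator_is F (Q c) 0"
proof -
  have "(\<Sum>i\<in>UNIV. \<Sum>j\<in>UNIV. \<phi> i * \<phi> j * f c i j) = 0"
    by (rule sum_alternating) (simp_all add: square f_sym[of c] odd(2)[THEN eq_neg_iff_add_eq_0[THEN iffD1]] distrib_right[symmetric])
  then show ?thesis
    using derivation_Q[OF commutator_F(2,1) f_commutes_operators(2), of c] by simp
qed

lemma D\<psi>_Q: "commutator_is (D\<psi> q p) (Q c) (field (\<lambda>j. \<psi>h q * \<phi> j) c p)"
proof -
  have "(\<Sum>i\<in>UNIV. \<Sum>j\<in>UNIV. ((if i = p then \<psi>h q else 0) * \<phi> j + \<psi> i * 0) * f c i j)
      = field (\<lambda>j. \<psi>h q * \<phi> j) c p"
    by (subst sum.swap) (simp add: field_def if_distrib[of "\<lambda>x. x * _"] cong: if_cong)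
  then show ?thesis
    using derivation_Q[OF commutator_D\<psi> f_commutes_operators(3), of q p c] by simp
qed

lemma D\<phi>_Q: "commutator_is (D\<phi> q p) (Q c) (field (\<lambda>j. \<psi> j * \<phi>h q) c p)"
  using derivation_Q[OF commutator_D\<phi>(2,1) f_commutes_operators(4), of q p c]
  by (simp add: field_def f_sym[of c _ p] if_distrib[of "\<lambda>x. x * _"] if_distrib[of "(*) _"] cong: if_cong)

text \<open>A rotation of both Grassmann families that has the same commutator with Q as the current
  \<open>f 0 i j\<close>, so that their difference commutes with Q.\<close>

definition rotation :: "'i \<Rightarrow> 'i \<Rightarrow> 'r" where
  "rotation i j = D\<psi> j i + D\<psi> i j + D\<phi> j i + D\<phi> i j"

lemma rotation_Q:
  "commutator_is (rotation i j) (Q c)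
     (field (\<lambda>l. \<psi>h j * \<phi> l) c i + field (\<lambda>l. \<psi> l * \<phi>h j) c i
    + field (\<lambda>l. \<psi>h i * \<phi> l) c j + field (\<lambda>l. \<psi> l * \<phi>h i) c j)"
proof -
  have "commutator_is (rotation i j) (Q c)
     (field (\<lambda>l. \<psi>h j * \<phi> l) c i + field (\<lambda>l. \<psi>h i * \<phi> l) c j
    + field (\<lambda>l. \<psi> l * \<phi>h j) c i + field (\<lambda>l. \<psi> l * \<phi>h i) c j)"
    unfolding rotation_def by (intro commutator_is_left D\<psi>_Q D\<phi>_Q)
  then show ?thesis by (simp add: add_ac)
qed

lemma odd_hh: "\<phi>h i * \<psi>h j = - (\<psi>h j * \<phi>h i)"
proof -
  have "x * \<psi>h j = - (\<psi>h j * x)" if "x * \<psi> (pr j) = - (\<psi> (pr j) * x)" for x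
    using that by (simp add: \<psi>h_def mult_of_int_left mult.assoc)
  then show ?thesis by (simp add: odd_h)
qed

lemma square_h: "\<psi>h i * \<psi>h i = 0" "\<phi>h i * \<phi>h i = 0"
  by (simp_all add: \<psi>h_def \<phi>h_def mult_of_int_left mult.assoc square)

lemma D_\<gamma>:
  "commutator_is (D\<psi> q p) \<gamma> (\<psi>h q * \<phi>h p)" "commutator_is (D\<phi> q p) \<gamma> (- (\<psi>h p * \<phi>h q))"
proof -
  have h: "commutator_is (D\<psi> q p) (\<psi>h i) (of_int (sg i) * (if pr i = p then \<psi>h q else 0))"
    "commutator_is (D\<phi> q p) (\<psi>h i) 0" for i
    using commutator_is_of_int[OF commutator_D\<psi>(1), of q p "sg i" "pr i"]
      commutator_is_of_int[OF commutator_D\<phi>(2), of q p "sg i" "pr i"] by (simp_all add: \<psi>h_def)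
  have "commutator_is (D\<psi> q p) \<gamma> (\<Sum>i\<in>UNIV. \<phi> i * (of_int (sg i) * (if pr i = p then \<psi>h q else 0)))"
    unfolding \<gamma>_def by (rule commutator_is_sum) (use commutator_is_mult[OF commutator_D\<psi>(2) h(1)] in fastforce)
  also have "(\<Sum>i\<in>UNIV. \<phi> i * (of_int (sg i) * (if pr i = p then \<psi>h q else 0))) = \<psi>h q * \<phi>h p"
  proof -
    have "\<phi> i * (of_int (sg i) * (if pr i = p then \<psi>h q else 0)) = (if i = pr p then \<psi>h q * \<phi>h p else 0)" for i
      by (auto simp: \<phi>h_def odd_h mult_of_int_left)
    then show ?thesis by simp
  qed
  finally show "commutator_is (D\<psi> q p) \<gamma> (\<psi>h q * \<phi>h p)" .
  have "commutator_is (D\<phi> q p) \<gamma> (\<Sum>i\<in>UNIV. (if i = p then \<phi>h q else 0) * \<psi>h i)"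
    unfolding \<gamma>_def by (rule commutator_is_sum) (use commutator_is_mult[OF commutator_D\<phi>(1) h(2)] in fastforce)
  then show "commutator_is (D\<phi> q p) \<gamma> (- (\<psi>h p * \<phi>h q))"
    by (simp add: if_distrib[of "\<lambda>x. x * _"] odd_hh cong: if_cong)
qed

lemma rotation_\<gamma>: "commutator_is (rotation i j) \<gamma> 0"
proof -
  have "commutator_is (rotation i j) \<gamma> (\<psi>h j * \<phi>h i + \<psi>h i * \<phi>h j + - (\<psi>h i * \<phi>h j) + - (\<psi>h j * \<phi>h i))"
    unfolding rotation_def by (intro commutator_is_left D_\<gamma>)
  then show ?thesis by simp
qed

end

text \<open>The elements \<open>x\<^sub>0\<close> and \<open>x\<^sub>1\<close> model the modes of
  one half of the lowered F_pp, a matrix of rank one; for it the four terms of the bracket merge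
  into two.\<close>

locale first_current = coupled_currents \<psi> \<phi> d\<psi> d\<phi> sg pr f \<tau> + coefficient_kernel N
  for \<psi> \<phi> d\<psi> d\<phi> :: "'i::finite \<Rightarrow> 'r::ring_1" and sg pr f \<tau> and N :: "'r set" +
  fixes x\<^sub>0 x\<^sub>1 K :: 'r and p :: 'i and n :: nat
  assumes x_fermion: "x\<^sub>0 * \<psi> k = \<psi> k * x\<^sub>0" "x\<^sub>0 * \<phi> k = \<phi> k * x\<^sub>0"
      "x\<^sub>1 * \<psi> k = \<psi> k * x\<^sub>1" "x\<^sub>1 * \<phi> k = \<phi> k * x\<^sub>1"
    and x_\<tau>: "x\<^sub>1 * \<tau> = \<tau> * x\<^sub>1 + x\<^sub>0" "x\<^sub>0 * \<tau> = \<tau> * x\<^sub>0"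
    and x_f: "x\<^sub>0 * f (- 1) k l = f (- 1) k l * x\<^sub>0 + (om p k * f (- 1) p l + om p l * f (- 1) p k)"
      "x\<^sub>1 * f (- 1) k l = f (- 1) k l * x\<^sub>1 + (om p k * f 0 p l + om p l * f 0 p k - 2 * (om p k * om p l) * K)"
    and K_central: "K * \<tau> = \<tau> * K" "K * \<psi> k = \<psi> k * K" "K * \<phi> k = \<phi> k * K" "K * f c i j = f c i j * K"
    and null: "null E" "null F" "null (D\<psi> p p)" "null (D\<phi> p p)"
    and annihilates: "annihilates x\<^sub>0" "annihilates x\<^sub>1" "annihilates (f 0 p l)"
    and level: "A * (K + of_nat (Suc n)) \<in> N"
begin

section \<open>The sl_2-multiplets attached to x\<close>

definition a where "a = \<psi>h p"
definition b where "b = \<phi>h p"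

lemma ab_rules:
  "\<psi> i * a = - (a * \<psi> i)" "\<phi> i * a = - (a * \<phi> i)" "\<psi> i * b = - (b * \<psi> i)" "\<phi> i * b = - (b * \<phi> i)"
  "b * a = - (a * b)" "a * a = 0" "b * b = 0"
  by (simp_all add: a_def b_def odd_h odd_hh square_h)

lemma ab_left:
  "\<psi> i * (a * x) = - (a * (\<psi> i * x))" "\<phi> i * (a * x) = - (a * (\<phi> i * x))"
  "\<psi> i * (b * x) = - (b * (\<psi> i * x))" "\<phi> i * (b * x) = - (b * (\<phi> i * x))"
  "b * (a * x) = - (a * (b * x))" "a * (a * x) = 0" "b * (b * x) = 0"
  by (simp_all only: mult.assoc[symmetric] ab_rules mult_minus_left mult_zero_left)

text \<open>The same factor arises twice: the double commutator contains t Q, as two equal copies of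
  -a b Q, and the central part of [x[1], Q] is t K, where the -2 comes from the trace form.\<close>

definition t where "t = - (2 * (a * b))"

text \<open>Both (a, b) and (\<psi>_l, \<phi>_l) are doublets of sl_2. Their invariant pairing is
  \<rho>, while b \<phi>_l, \<sigma>, a \<psi>_l make up the triplet. Accordingly \<open>H\<close>
  is a singlet and \<open>Y\<close>, \<open>V\<close>, \<open>Z\<close> form a triplet.\<close>

definition \<rho> :: "'i \<Rightarrow> 'r" where "\<rho> l = a * \<phi> l - b * \<psi> l"
definition \<sigma> :: "'i \<Rightarrow> 'r" where "\<sigma> l = a * \<phi> l + b * \<psi> l"

abbreviation H where "H c \<equiv> field \<rho> c p"
abbreviation V where "V c \<equiv> field \<sigma> c p"
abbreviation Y where "Y c \<equiv> field (\<lambda>l. b * \<phi> l) c p"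
abbreviation Z where "Z c \<equiv> field (\<lambda>l. a * \<psi> l) c p"

lemma even_elem_t: "even_elem t" "even_elem (a * b)"
proof -
  show "even_elem (a * b)" unfolding a_def b_def by (rule even_elem_basic)
  then show "even_elem t" unfolding t_def using even_elem_minus[OF even_elem_of_int[of "a * b" 2]] by simp
qed

lemma even_elem_rho: "even_elem (\<rho> l)" "even_elem (\<sigma> l)"
  unfolding \<rho>_def \<sigma>_def a_def b_def by (intro even_elem_diff even_elem_add even_elem_basic)+

lemma commutes_mult: "z * x = x * z \<Longrightarrow> z * y = y * z \<Longrightarrow> z * (x * y) = x * y * (z :: 'r)"
  by (metis mult.assoc)

lemma commutes_sum: "(\<And>i. i \<in> A \<Longrightarrow> z * x i = x i * z) \<Longrightarrow> z * (\<Sum>i\<in>A. x i) = (\<Sum>i\<in>A. x i) * (z :: 'r)"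
  by (simp add: sum_distrib_left sum_distrib_right)

text \<open>The property shared by all Grassmann elements, even or odd, towards \<tau> and the
  currents; their behaviour among themselves is the matter of \<open>even_elem\<close>.\<close>

definition scalar_like :: "'r \<Rightarrow> bool" where
  "scalar_like z \<longleftrightarrow> z * \<tau> = \<tau> * z \<and> (\<forall>c i j. z * f c i j = f c i j * z) \<and> K * z = z * K
     \<and> x\<^sub>0 * z = z * x\<^sub>0 \<and> x\<^sub>1 * z = z * x\<^sub>1"

lemma scalar_like_mult: "scalar_like x \<Longrightarrow> scalar_like y \<Longrightarrow> scalar_like (x * y)"
  using commutes_mult unfolding scalar_like_def by metis

lemma scalar_like_add: "scalar_like x \<Longrightarrow> scalar_like y \<Longrightarrow> scalar_like (x + y)"
  and scalar_like_diff: "scalar_like x \<Longrightarrow> scalar_like y \<Longrightarrow> scalar_like (x - y)"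
  and scalar_like_minus: "scalar_like x \<Longrightarrow> scalar_like (- x)"
  unfolding scalar_like_def by (simp_all add: algebra_simps)

lemma scalar_like_sum: "(\<And>i. i \<in> A \<Longrightarrow> scalar_like (x i)) \<Longrightarrow> scalar_like (\<Sum>i\<in>A. x i)"
  by (simp add: scalar_like_def sum_distrib_left sum_distrib_right)

lemma scalar_like_of_int: "scalar_like x \<Longrightarrow> scalar_like (of_int z * x)"
  unfolding scalar_like_def by (simp add: mult_of_int_left mult.assoc)

lemma scalar_like_basic:
  "scalar_like (\<psi> i)" "scalar_like (\<phi> i)" "scalar_like (\<psi>h i)" "scalar_like (\<phi>h i)" "scalar_like a" "scalar_like b"
proof -
  show 1: "scalar_like (\<psi> i)" "scalar_like (\<phi> i)" for i
    by (simp_all add: scalar_like_def f_fermion \<tau>_fermion K_central x_fermion)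
  show 2: "scalar_like (\<psi>h i)" "scalar_like (\<phi>h i)" for i
    by (simp_all add: \<psi>h_def \<phi>h_def scalar_like_of_int 1)
  show "scalar_like a" "scalar_like b" unfolding a_def b_def by (rule 2)+
qed

lemma scalar_like_quadratic: "scalar_like \<alpha>" "scalar_like \<beta>" "scalar_like \<gamma>" "scalar_like t"
  "scalar_like (\<rho> l)" "scalar_like (\<sigma> l)"
proof -
  have "scalar_like (of_int 2 * (a * b))"
    by (intro scalar_like_of_int scalar_like_mult scalar_like_basic)
  then show "scalar_like t" by (simp add: t_def scalar_like_minus)
qed (auto simp: \<alpha>_def \<beta>_def \<gamma>_def \<rho>_def \<sigma>_def
    intro!: scalar_like_sum scalar_like_mult scalar_like_add scalar_like_diff scalar_like_basic)

lemma central_Q: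
  assumes "scalar_like z" "even_elem z"
  shows "z * Q c = Q c * z"
  unfolding Q_def using assms
  by (intro commutes_sum commutes_mult) (simp_all add: scalar_like_def even_elem_def)

text \<open>Of the four terms in the bracket of two currents, two keep the index p and contract w
  with \<psi> or \<phi> through the form. The other two absorb p into a or b and leave a double sum
  over f.\<close>

lemma field_Q:
  assumes "c + c' \<noteq> 0" and w: "\<And>l. even_elem (w l)" "\<And>l. scalar_like (w l)"
  shows "commutator_is (field w c p) (Q c')
    (field (\<lambda>m. (\<Sum>l\<in>UNIV. w l * \<psi>h l) * \<phi> m) (c + c') p + field (\<lambda>m. \<psi> m * (\<Sum>l\<in>UNIV. w l * \<phi>h l)) (c + c') p
     + (\<Sum>l\<in>UNIV. \<Sum>m\<in>UNIV. (w l * a * \<phi> m + w l * \<psi> m * b) * f (c + c') l m))"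
proof -
  let ?d = "c + c'"
  have "commutator_is (w l * f c p l) (Q c') (w l * (field (\<lambda>m. \<psi>h l * \<phi> m) ?d p + field (\<lambda>m. \<psi> m * \<phi>h l) ?d p
      + field (\<lambda>m. a * \<phi> m) ?d l + field (\<lambda>m. \<psi> m * b) ?d l))" for l
  proof -
    have wQ: "w l * Q c' = Q c' * w l" using w by (rule central_Q[rotated])
    have "w l * f c p l * Q c' = w l * (f c p l * Q c')" by (rule mult.assoc)
    also have "\<dots> = w l * (Q c' * f c p l + (field (\<lambda>m. \<psi>h l * \<phi> m) ?d p + field (\<lambda>m. \<psi> m * \<phi>h l) ?d p
      + field (\<lambda>m. a * \<phi> m) ?d l + field (\<lambda>m. \<psi> m * b) ?d l))"
      using f_Q[OF assms(1), of p l] by (simp add: commutator_is_def a_def b_def)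
    finally show ?thesis
      by (simp only: commutator_is_def distrib_left[of "w l" "Q c' * f c p l"] mult.assoc[symmetric] wQ)
  qed
  then have 1: "commutator_is (field w c p) (Q c') (\<Sum>l\<in>UNIV. w l * (field (\<lambda>m. \<psi>h l * \<phi> m) ?d p + field (\<lambda>m. \<psi> m * \<phi>h l) ?d p
      + field (\<lambda>m. a * \<phi> m) ?d l + field (\<lambda>m. \<psi> m * b) ?d l))"
    unfolding field_def[of w] by (intro commutator_is_sum_left)
  have 2: "(\<Sum>l\<in>UNIV. w l * field (\<lambda>m. \<psi>h l * \<phi> m) ?d p) = field (\<lambda>m. (\<Sum>l\<in>UNIV. w l * \<psi>h l) * \<phi> m) ?d p"
    unfolding field_def sum_distrib_left sum_distrib_right by (subst sum.swap) (simp add: mult.assoc)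
  have "w l * (\<psi> m * (\<phi>h l * x)) = \<psi> m * (w l * (\<phi>h l * x))" for l m x
    using w(1)[of l] unfolding even_elem_def by (simp only: mult.assoc[symmetric])
  then have 3: "(\<Sum>l\<in>UNIV. w l * field (\<lambda>m. \<psi> m * \<phi>h l) ?d p) = field (\<lambda>m. \<psi> m * (\<Sum>l\<in>UNIV. w l * \<phi>h l)) ?d p"
    unfolding field_def sum_distrib_left sum_distrib_right by (subst sum.swap) (simp add: mult.assoc)
  have 4: "(\<Sum>l\<in>UNIV. w l * (field (\<lambda>m. a * \<phi> m) ?d l + field (\<lambda>m. \<psi> m * b) ?d l))
     = (\<Sum>l\<in>UNIV. \<Sum>m\<in>UNIV. (w l * a * \<phi> m + w l * \<psi> m * b) * f (c + c') l m)"
    by (simp only: field_def sum_distrib_left sum.distrib[symmetric] distrib_right distrib_left mult.assoc)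
  show ?thesis
    using 1 by (simp only: add.assoc distrib_left[of "w _" "field (\<lambda>m. \<psi>h _ * \<phi> m) ?d p"] distrib_left[of "w _" "field (\<lambda>m. \<psi> m * \<phi>h _) ?d p"]
      sum.distrib 2 3 4)
qed

lemma quadratic_left: 
  "\<alpha> * \<psi> i = \<psi> i * \<alpha>" "\<alpha> * \<phi> i = \<phi> i * \<alpha>" "\<beta> * \<psi> i = \<psi> i * \<beta>" "\<beta> * \<phi> i = \<phi> i * \<beta>"
  "\<gamma> * \<psi> i = \<psi> i * \<gamma>" "\<gamma> * \<phi> i = \<phi> i * \<gamma>" "\<alpha> * a = a * \<alpha>" "\<alpha> * b = b * \<alpha>"
  "\<beta> * a = a * \<beta>" "\<beta> * b = b * \<beta>" "\<gamma> * a = a * \<gamma>" "\<gamma> * b = b * \<gamma>"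
  using even_elem_quadratic even_elem_h by (simp_all add: even_elem_def a_def b_def)

text \<open>The terms that keep p contract \<rho> to \<alpha>, \<beta>, \<gamma> and give the
  triplet part. The other two are equal to -a b Q each, by the symmetry of f, and add up to t
  Q.\<close>

lemma H_Q:
  assumes "c + c' \<noteq> 0"
  shows "commutator_is (H c) (Q c') (t * Q (c + c') + (\<gamma> * V (c + c') - \<alpha> * Y (c + c') - \<beta> * Z (c + c')))"
proof -
  have 1: "(\<Sum>l\<in>UNIV. \<rho> l * \<psi>h l) = a * \<gamma> - b * \<alpha>" "(\<Sum>l\<in>UNIV. \<rho> l * \<phi>h l) = a * \<beta> - b * \<gamma>"
    by (simp_all add: \<rho>_def left_diff_distrib sum_subtractf mult.assoc sum_distrib_left[symmetric]
        \<gamma>_def[symmetric] \<alpha>_def[symmetric] \<beta>_def[symmetric] \<gamma>_alt[symmetric])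
  have e: "(\<rho> l * a * \<phi> m + \<rho> l * \<psi> m * b) * f c l m = - (a * b * (\<psi> l * \<phi> m * f c l m)) - a * b * (\<psi> m * \<phi> l * f c m l)" for l m c
    using f_sym[of c l m]
    by (simp add: \<rho>_def left_diff_distrib mult.assoc ab_rules ab_left odd(3) odd_left algebra_simps)
  have 2: "(\<Sum>l\<in>UNIV. \<Sum>m\<in>UNIV. (\<rho> l * a * \<phi> m + \<rho> l * \<psi> m * b) * f d l m) = t * Q d" for d
  proof -
    have "(\<Sum>l\<in>UNIV. \<Sum>m\<in>UNIV. (\<rho> l * a * \<phi> m + \<rho> l * \<psi> m * b) * f d l m)
       = - (a * b * Q d) - a * b * (\<Sum>l\<in>UNIV. \<Sum>m\<in>UNIV. \<psi> m * \<phi> l * f d m l)"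
      by (simp only: e Q_def sum_subtractf sum_negf sum_distrib_left)
    also have "(\<Sum>l\<in>UNIV. \<Sum>m\<in>UNIV. \<psi> m * \<phi> l * f d m l) = Q d"
      unfolding Q_def by (rule sum.swap)
    finally show ?thesis by (simp add: t_def mult_2 distrib_right left_diff_distrib)
  qed
  have 3: "field (\<lambda>m. (a * \<gamma> - b * \<alpha>) * \<phi> m) d p + field (\<lambda>m. \<psi> m * (a * \<beta> - b * \<gamma>)) d p
     = \<gamma> * V d - \<alpha> * Y d - \<beta> * Z d" for d
  proof -
    have "(a * \<gamma> - b * \<alpha>) * \<phi> m + \<psi> m * (a * \<beta> - b * \<gamma>) = \<gamma> * \<sigma> m - \<alpha> * (b * \<phi> m) - \<beta> * (a * \<psi> m)" for m
    proof -
      have "(a * \<gamma> - b * \<alpha>) * \<phi> m + \<psi> m * (a * \<beta> - b * \<gamma>) 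
         = a * \<gamma> * \<phi> m - b * \<alpha> * \<phi> m - a * (\<psi> m * \<beta>) + b * (\<psi> m * \<gamma>)"
        by (simp add: left_diff_distrib right_diff_distrib ab_left)
      moreover have "\<gamma> * \<sigma> m = a * \<gamma> * \<phi> m + b * (\<psi> m * \<gamma>)" "\<alpha> * (b * \<phi> m) = b * \<alpha> * \<phi> m"
        "\<beta> * (a * \<psi> m) = a * (\<psi> m * \<beta>)"
        by (simp_all only: \<sigma>_def distrib_left mult.assoc[symmetric] quadratic_left) (simp_all only: mult.assoc quadratic_left)
      ultimately show ?thesis by simp
    qed
    then show ?thesis
      by (simp only: field_add[symmetric] field_mult[symmetric] field_diff[symmetric])
  qed
  show ?thesis
    using field_Q[where w = \<rho>, OF assms even_elem_rho(1) scalar_like_quadratic(5)]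
    by (simp only: 1 2 3) (simp only: add.commute)
qed

text \<open>With \<sigma> in place of \<rho>, the two copies of a b Q have opposite signs, so no
  multiple of Q remains.\<close>

lemma V_Q:
  assumes "c + c' \<noteq> 0"
  shows "commutator_is (V c) (Q c') (\<gamma> * H (c + c') + (\<alpha> * Y (c + c') - \<beta> * Z (c + c')))"
proof -
  have 1: "(\<Sum>l\<in>UNIV. \<sigma> l * \<psi>h l) = a * \<gamma> + b * \<alpha>" "(\<Sum>l\<in>UNIV. \<sigma> l * \<phi>h l) = a * \<beta> + b * \<gamma>"
    by (simp_all add: \<sigma>_def distrib_right sum.distrib mult.assoc sum_distrib_left[symmetric]
        \<gamma>_def[symmetric] \<alpha>_def[symmetric] \<beta>_def[symmetric] \<gamma>_alt[symmetric])
  have e: "(\<sigma> l * a * \<phi> m + \<sigma> l * \<psi> m * b) * f c l m = a * b * (\<psi> l * \<phi> m * f c l m) - a * b * (\<psi> m * \<phi> l * f c m l)" for l m c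
    using f_sym[of c l m]
    by (simp add: \<sigma>_def distrib_right mult.assoc ab_rules ab_left odd(3) odd_left algebra_simps)
  have 2: "(\<Sum>l\<in>UNIV. \<Sum>m\<in>UNIV. (\<sigma> l * a * \<phi> m + \<sigma> l * \<psi> m * b) * f d l m) = 0" for d
  proof -
    have "(\<Sum>l\<in>UNIV. \<Sum>m\<in>UNIV. (\<sigma> l * a * \<phi> m + \<sigma> l * \<psi> m * b) * f d l m)
       = a * b * Q d - a * b * (\<Sum>l\<in>UNIV. \<Sum>m\<in>UNIV. \<psi> m * \<phi> l * f d m l)"
      by (simp only: e Q_def sum_subtractf sum_distrib_left)
    also have "(\<Sum>l\<in>UNIV. \<Sum>m\<in>UNIV. \<psi> m * \<phi> l * f d m l) = Q d"
      unfolding Q_def by (rule sum.swap)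
    finally show ?thesis by simp
  qed
  have 3: "field (\<lambda>m. (a * \<gamma> + b * \<alpha>) * \<phi> m) d p + field (\<lambda>m. \<psi> m * (a * \<beta> + b * \<gamma>)) d p
     = \<gamma> * H d + (\<alpha> * Y d - \<beta> * Z d)" for d
  proof -
    have "(a * \<gamma> + b * \<alpha>) * \<phi> m + \<psi> m * (a * \<beta> + b * \<gamma>) = \<gamma> * \<rho> m + (\<alpha> * (b * \<phi> m) - \<beta> * (a * \<psi> m))" for m
    proof -
      have "(a * \<gamma> + b * \<alpha>) * \<phi> m + \<psi> m * (a * \<beta> + b * \<gamma>) 
         = a * \<gamma> * \<phi> m + b * \<alpha> * \<phi> m - a * (\<psi> m * \<beta>) - b * (\<psi> m * \<gamma>)"
        by (simp add: distrib_left distrib_right ab_left)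
      moreover have "\<gamma> * \<rho> m = a * \<gamma> * \<phi> m - b * (\<psi> m * \<gamma>)" "\<alpha> * (b * \<phi> m) = b * \<alpha> * \<phi> m"
        "\<beta> * (a * \<psi> m) = a * (\<psi> m * \<beta>)"
        by (simp_all only: \<rho>_def right_diff_distrib mult.assoc[symmetric] quadratic_left) (simp_all only: mult.assoc quadratic_left)
      ultimately show ?thesis by simp
    qed
    then show ?thesis
      by (simp only: field_add[symmetric] field_mult[symmetric] field_diff[symmetric])
  qed
  show ?thesis
    using field_Q[where w = \<sigma>, OF assms even_elem_rho(2) scalar_like_quadratic(6)]
    by (simp only: 1 2 3 add_0_right)
qed


lemma om_left: "x * (om i j * y) = om i j * (x * y)"
  by (simp only: om_def mult_of_int_left)

lemma contraction_left:
  "(\<Sum>k\<in>UNIV. \<Sum>l\<in>UNIV. \<psi> k * \<phi> l * (om p k * f c p l)) = field (\<lambda>l. a * \<phi> l) c p"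
proof -
  have "\<psi> k * \<phi> l * (om p k * f c p l) = \<psi> k * (om p k * (\<phi> l * f c p l))" for k l
    by (simp add: om_def mult_of_int_left mult.assoc)
  then show ?thesis
    by (subst sum.swap) (simp add: sum_om field_def \<psi>h_def a_def mult.assoc)
qed

lemma contraction_right:
  "(\<Sum>k\<in>UNIV. \<Sum>l\<in>UNIV. \<psi> k * \<phi> l * (om p l * f c p k)) = field (\<lambda>k. \<psi> k * b) c p"
  by (simp add: mult.assoc sum_distrib_left[symmetric] sum_om field_def \<phi>h_def b_def mult_of_int_left)

lemma contraction_both:
  "(\<Sum>k\<in>UNIV. \<Sum>l\<in>UNIV. \<psi> k * \<phi> l * (om p k * om p l * z)) = a * (b * z)"
proof -
  have "\<psi> k * \<phi> l * (om p k * om p l * z) = \<psi> k * (om p k * (\<phi> l * (om p l * z)))" for k l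
    by (simp only: om_left[of "\<phi> l"] mult.assoc)
  then show ?thesis
    by (simp add: sum_distrib_left[symmetric] sum_om \<psi>h_def \<phi>h_def a_def b_def mult.assoc)
qed

lemma H_split: "H c = field (\<lambda>l. a * \<phi> l) c p + field (\<lambda>k. \<psi> k * b) c p"
  and V_split: "V c = field (\<lambda>l. a * \<phi> l) c p - field (\<lambda>k. \<psi> k * b) c p"
  by (simp_all only: field_add[symmetric] field_diff[symmetric]) (simp_all add: \<rho>_def[abs_def] \<sigma>_def[abs_def] ab_rules)

lemma x\<^sub>0_Q: "commutator_is x\<^sub>0 (Q (- 1)) (H (- 1))"
proof -
  have "commutator_is x\<^sub>0 (\<psi> k * \<phi> l * f (- 1) k l)
      (\<psi> k * \<phi> l * (om p k * f (- 1) p l + om p l * f (- 1) p k))" for k l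
    using commutator_is_mult[of x\<^sub>0 "\<psi> k * \<phi> l" 0 "f (- 1) k l"] commutes_mult[of x\<^sub>0 "\<psi> k" "\<phi> l"]
    by (simp add: commutator_is_def x_f x_fermion)
  then have "commutator_is x\<^sub>0 (Q (- 1)) (\<Sum>k\<in>UNIV. \<Sum>l\<in>UNIV.
      \<psi> k * \<phi> l * (om p k * f (- 1) p l + om p l * f (- 1) p k))"
    unfolding Q_def by (intro commutator_is_sum)
  then show ?thesis
    by (simp only: distrib_left sum.distrib contraction_left contraction_right H_split)
qed

lemma x\<^sub>1_Q: "commutator_is x\<^sub>1 (Q (- 1)) (H 0 + t * K)"
proof -
  have "commutator_is x\<^sub>1 (\<psi> k * \<phi> l * f (- 1) k l)
      (\<psi> k * \<phi> l * (om p k * f 0 p l + om p l * f 0 p k - 2 * (om p k * om p l) * K))" for k l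
    using commutator_is_mult[of x\<^sub>1 "\<psi> k * \<phi> l" 0 "f (- 1) k l"] commutes_mult[of x\<^sub>1 "\<psi> k" "\<phi> l"]
    by (simp add: commutator_is_def x_f x_fermion)
  then have "commutator_is x\<^sub>1 (Q (- 1)) (\<Sum>k\<in>UNIV. \<Sum>l\<in>UNIV.
      \<psi> k * \<phi> l * (om p k * f 0 p l + om p l * f 0 p k - 2 * (om p k * om p l) * K))"
    unfolding Q_def by (intro commutator_is_sum)
  moreover have "\<psi> k * \<phi> l * (2 * (om p k * om p l) * K) = 2 * (\<psi> k * \<phi> l * (om p k * om p l * K))" for k l
    by (simp only: mult.assoc mult_2_left)
  moreover have "t * K = - (2 * (a * (b * K)))"
    by (simp add: t_def mult.assoc)
  ultimately show ?thesis
    by (simp only: distrib_left right_diff_distrib sum.distrib sum_subtractf sum_distrib_left[symmetric]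
        contraction_left contraction_right contraction_both H_split) simp
qed

lemma \<tau>_Q: "commutator_is \<tau> (Q (- 1)) (Q (- 2))"
proof -
  have "commutator_is \<tau> (\<psi> k * \<phi> l * f (- 1) k l) (\<psi> k * \<phi> l * f (- 2) k l)" for k l
    using commutator_is_mult[of \<tau> "\<psi> k * \<phi> l" 0 "f (- 1) k l"] \<tau>_commutes_mult[of "\<psi> k" "\<phi> l"]
    by (simp add: commutator_is_def \<tau>_f \<tau>_fermion)
  then show ?thesis
    unfolding Q_def by (intro commutator_is_sum)
qed

lemma \<tau>_field:
  assumes "\<And>l. scalar_like (w l)"
  shows "commutator_is \<tau> (field w (- 1) p) (field w (- 2) p)" "commutator_is \<tau> (field w 0 p) 0"
proof -
  have w: "\<tau> * w l = w l * \<tau>" for l using assms[of l] by (simp add: scalar_like_def)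
  have "commutator_is \<tau> (w l * f (- 1) p l) (w l * f (- 2) p l)" for l
    using commutator_is_mult[of \<tau> "w l" 0 "f (- 1) p l"] by (simp add: commutator_is_def \<tau>_f w)
  then show "commutator_is \<tau> (field w (- 1) p) (field w (- 2) p)"
    unfolding field_def by (intro commutator_is_sum)
  have "commutator_is \<tau> (w l * f 0 p l) 0" for l
    using commutator_is_mult[of \<tau> "w l" 0 "f 0 p l"] by (simp add: commutator_is_def \<tau>_f w)
  then show "commutator_is \<tau> (field w 0 p) 0"
    unfolding field_def using commutator_is_sum[of UNIV \<tau> "\<lambda>l. w l * f 0 p l" "\<lambda>_. 0"] by simp
qed

lemma E_Y: "commutator_is E (Y c) (V c)"
proof -
  have "commutator_is E (b * \<phi> l * f c p l) (\<sigma> l * f c p l)" for l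
    using commutator_is_mult[OF commutator_is_mult[OF commutator_E(4)[of p] commutator_E(2)[of l]] f_commutes_operators(1)[of c p l]]
    by (simp add: \<sigma>_def a_def b_def)
  then show ?thesis unfolding field_def by (intro commutator_is_sum)
qed

lemma F_Z: "commutator_is F (Z c) (V c)"
proof -
  have "commutator_is F (a * \<psi> l * f c p l) (\<sigma> l * f c p l)" for l
    using commutator_is_mult[OF commutator_is_mult[OF commutator_F(4)[of p] commutator_F(2)[of l]] f_commutes_operators(2)[of c p l]]
    by (simp add: \<sigma>_def a_def b_def add.commute)
  then show ?thesis unfolding field_def by (intro commutator_is_sum)
qed

lemma K_Q: "K * Q c = Q c * K"
  unfolding Q_def by (intro commutes_sum commutes_mult) (simp_all add: K_central)

lemma null_add: "null x \<Longrightarrow> null y \<Longrightarrow> null (x + y)" "null x \<Longrightarrow> null y \<Longrightarrow> null (x - y)"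
  unfolding null_def by (simp_all add: distrib_left distrib_right left_diff_distrib right_diff_distrib N_add N_diff)

text \<open>The sum of the two rotations by x fixes \<gamma> and yields H; their difference moves
  \<gamma> by -t and yields V.\<close>

sublocale first_mode N \<tau> "Q (- 1)" \<gamma> t \<alpha> \<beta> "Q (- 2)" "H 0" "H (- 1)" "H (- 2)" "V (- 1)" "V (- 2)"
  "Y (- 1)" "Y (- 2)" "Z (- 1)" "Z (- 2)" x\<^sub>0 x\<^sub>1 K E F "D\<psi> p p + D\<phi> p p" "D\<psi> p p - D\<phi> p p" n
proof
  show "A * (K + of_nat (Suc n)) \<in> N" for A by (rule level)
  show "\<gamma> * Q (- 1) = Q (- 1) * \<gamma>" "t * Q (- 1) = Q (- 1) * t" "\<alpha> * Q (- 1) = Q (- 1) * \<alpha>" "\<beta> * Q (- 1) = Q (- 1) * \<beta>"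
    by (intro central_Q scalar_like_quadratic even_elem_quadratic even_elem_t)+
  show "\<gamma> * \<tau> = \<tau> * \<gamma>" "t * \<tau> = \<tau> * t" "\<alpha> * \<tau> = \<tau> * \<alpha>" "\<beta> * \<tau> = \<tau> * \<beta>" "x\<^sub>1 * \<gamma> = \<gamma> * x\<^sub>1"
    using scalar_like_quadratic by (simp_all add: scalar_like_def)
  show "K * \<tau> = \<tau> * K" "K * Q (- 1) = Q (- 1) * K" by (rule K_central K_Q)+
  show "\<alpha> * \<gamma> = \<gamma> * \<alpha>" "\<beta> * \<gamma> = \<gamma> * \<beta>" "t * \<gamma> = \<gamma> * t"
    by (intro even_elem_commute even_elem_quadratic even_elem_t)+
  have "commutator_is (D\<psi> p p + D\<phi> p p) \<gamma> 0" "commutator_is (D\<psi> p p - D\<phi> p p) \<gamma> (- t)"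
    using commutator_is_left[OF D_\<gamma>, of p p p p] by (simp_all add: t_def a_def b_def mult_2)
  then show "(D\<psi> p p + D\<phi> p p) * \<gamma> = \<gamma> * (D\<psi> p p + D\<phi> p p)"
    "(D\<psi> p p - D\<phi> p p) * \<gamma> = \<gamma> * (D\<psi> p p - D\<phi> p p) - t"
    by (simp_all add: commutator_is_def)
  show "x\<^sub>1 * \<tau> = \<tau> * x\<^sub>1 + x\<^sub>0" "x\<^sub>0 * \<tau> = \<tau> * x\<^sub>0" by (rule x_\<tau>)+
  show "x\<^sub>1 * Q (- 1) = Q (- 1) * x\<^sub>1 + (H 0 + t * K)" "x\<^sub>0 * Q (- 1) = Q (- 1) * x\<^sub>0 + H (- 1)"
    using x\<^sub>0_Q x\<^sub>1_Q by (simp_all add: commutator_is_def)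
  show "H 0 * Q (- 1) = Q (- 1) * H 0 + (t * Q (- 1) + (\<gamma> * V (- 1) - \<alpha> * Y (- 1) - \<beta> * Z (- 1)))"
    "H (- 1) * Q (- 1) = Q (- 1) * H (- 1) + (t * Q (- 2) + (\<gamma> * V (- 2) - \<alpha> * Y (- 2) - \<beta> * Z (- 2)))"
    using H_Q[of 0 "- 1"] H_Q[of "- 1" "- 1"] by (simp_all add: commutator_is_def)
  show "V (- 1) * Q (- 1) = Q (- 1) * V (- 1) + (\<gamma> * H (- 2) + (\<alpha> * Y (- 2) - \<beta> * Z (- 2)))"
    using V_Q[of "- 1" "- 1"] by (simp_all add: commutator_is_def)
  show "H 0 * \<tau> = \<tau> * H 0" "\<tau> * Q (- 1) = Q (- 1) * \<tau> + Q (- 2)" "\<tau> * H (- 1) = H (- 1) * \<tau> + H (- 2)"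
    "\<tau> * V (- 1) = V (- 1) * \<tau> + V (- 2)"
    using \<tau>_Q \<tau>_field[of \<rho>] \<tau>_field[of \<sigma>] scalar_like_quadratic by (simp_all add: commutator_is_def)
  show "E * \<tau> = \<tau> * E" "E * Q (- 1) = Q (- 1) * E" "E * \<gamma> = \<gamma> * E + \<alpha>"
    "E * Y (- 1) = Y (- 1) * E + V (- 1)" "E * Y (- 2) = Y (- 2) * E + V (- 2)"
    "F * \<tau> = \<tau> * F" "F * Q (- 1) = Q (- 1) * F" "F * \<gamma> = \<gamma> * F + \<beta>"
    "F * Z (- 1) = Z (- 1) * F + V (- 1)" "F * Z (- 2) = Z (- 2) * F + V (- 2)"
    using \<tau>_commutes_operators E_Q F_Q commutator_E commutator_F E_Y F_Z by (simp_all add: commutator_is_def)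
  show "(D\<psi> p p + D\<phi> p p) * \<tau> = \<tau> * (D\<psi> p p + D\<phi> p p)" "(D\<psi> p p - D\<phi> p p) * \<tau> = \<tau> * (D\<psi> p p - D\<phi> p p)"
    using commutator_is_left[OF \<tau>_commutes_operators(3,4), of p p p p] by (simp_all add: commutator_is_def)
  show "(D\<psi> p p + D\<phi> p p) * Q (- 1) = Q (- 1) * (D\<psi> p p + D\<phi> p p) + H (- 1)"
    "(D\<psi> p p - D\<phi> p p) * Q (- 1) = Q (- 1) * (D\<psi> p p - D\<phi> p p) + V (- 1)"
    using commutator_is_left[OF D\<psi>_Q[of p p "- 1"] D\<phi>_Q[of p p "- 1"]]
    by (simp_all add: commutator_is_def H_split V_split a_def b_def)
  show "null E" "null F" "null (D\<psi> p p + D\<phi> p p)" "null (D\<psi> p p - D\<phi> p p)"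
    by (intro null null_add)+
  show "annihilates x\<^sub>0" "annihilates x\<^sub>1" by (rule annihilates)+
  show "annihilates (H 0)"
    using annihilates(3) by (auto simp: annihilates_def field_def sum_distrib_left mult.assoc[symmetric] intro!: N_sum)
qed

end

section \<open>The vacuum ideal\<close>

lemma left_ideal_mult: "x \<in> left_ideal R \<Longrightarrow> a * x \<in> left_ideal R"
proof (induction rule: left_ideal.induct)
  case (gen r b)
  then show ?case using left_ideal.gen[of r R "a * b"] by (simp add: mult.assoc)
qed (auto simp: distrib_left intro: left_ideal.intros)

lemma left_ideal_minus: "x \<in> left_ideal R \<Longrightarrow> - x \<in> left_ideal R"
  using left_ideal_mult[of x R "- 1"] by simp

lemma left_ideal_diff: "x \<in> left_ideal R \<Longrightarrow> y \<in> left_ideal R \<Longrightarrow> x - y \<in> left_ideal R"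
  using left_ideal.add[OF _ left_ideal_minus, of x R y] by simp

lemma left_ideal_scaleC: "x \<in> left_ideal R \<Longrightarrow> c *\<^sub>C x \<in> left_ideal (R :: 'a::complex_algebra_1 set)"
  using left_ideal_mult[of x R "c *\<^sub>C 1"] by simp

lemma vacuum_ideal_loop: "a \<ge> 0 \<Longrightarrow> uea_gen (loop_elem x a) \<in> vacuum_ideal \<kappa>"
  unfolding vacuum_ideal_def by (rule left_ideal.gen[of _ _ 1, simplified]) blast

lemma vacuum_ideal_central: "uea_gen central_elem - \<kappa> *\<^sub>C 1 \<in> vacuum_ideal \<kappa>"
  unfolding vacuum_ideal_def by (rule left_ideal.gen[of _ _ 1, simplified]) blast

lemma vacuum_ideal_closed:
  "0 \<in> vacuum_ideal \<kappa>"
  "x \<in> vacuum_ideal \<kappa> \<Longrightarrow> y \<in> vacuum_ideal \<kappa> \<Longrightarrow> x + y \<in> vacuum_ideal \<kappa>"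
  "x \<in> vacuum_ideal \<kappa> \<Longrightarrow> y \<in> vacuum_ideal \<kappa> \<Longrightarrow> x - y \<in> vacuum_ideal \<kappa>"
  "x \<in> vacuum_ideal \<kappa> \<Longrightarrow> - x \<in> vacuum_ideal \<kappa>"
  "x \<in> vacuum_ideal \<kappa> \<Longrightarrow> u * x \<in> vacuum_ideal \<kappa>"
  "x \<in> vacuum_ideal \<kappa> \<Longrightarrow> c *\<^sub>C x \<in> vacuum_ideal \<kappa>"
  unfolding vacuum_ideal_def
  by (auto intro: left_ideal.intros left_ideal_diff left_ideal_minus left_ideal_mult left_ideal_scaleC)

lemma tau_minus: "tau (- u) = - tau u"
  using tau_add[of u "- u"] by (simp add: eq_neg_iff_add_eq_0 add.commute)

lemma tau_diff: "tau (u - v) = tau u - tau v"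
  using tau_add[of u "- v"] by (simp add: tau_minus)

lemma tau_central: "tau (uea_gen central_elem) = 0"
  using uea_gen_scaleC[of 0 0]
  by (simp add: tau_def uea_derivation_gen lie_derivation_minus_dt minus_dt_central_elem)

text \<open>\<tau> takes x[a] to -a x[a - 1], and the factor vanishes at a = 0, so no nonnegative
  mode becomes negative; \<tau> also kills the central element.\<close>

lemma tau_vacuum_ideal:
  assumes "x \<in> vacuum_ideal \<kappa>"
  shows "tau x \<in> vacuum_ideal \<kappa>"
  using assms unfolding vacuum_ideal_def
proof (induction rule: left_ideal.induct)
  case (gen r u)
  have "tau r \<in> vacuum_ideal \<kappa>"
  proof -
    have "tau (uea_gen central_elem - \<kappa> *\<^sub>C (1 :: 'a affine uea)) = 0"
      by (simp add: tau_diff tau_central tau_scaleC tau_one)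
    moreover have "tau (uea_gen (loop_elem x a)) \<in> vacuum_ideal \<kappa>" if "a \<ge> 0" for x :: 'a and a
    proof (cases "a = 0")
      case False
      then show ?thesis
        using that by (simp only: tau_loop_elem) (intro vacuum_ideal_closed vacuum_ideal_loop, simp)
    qed (simp add: tau_loop_elem vacuum_ideal_closed)
    ultimately show ?thesis
      using gen by (auto simp: vacuum_ideal_closed)
  qed
  moreover have "r \<in> vacuum_ideal \<kappa>"
    unfolding vacuum_ideal_def using left_ideal.gen[OF gen, of 1] by simp
  ultimately show ?case
    unfolding vacuum_ideal_def[symmetric] by (simp add: tau_mult vacuum_ideal_closed)
qed (simp_all add: left_ideal.intros tau_add)

section \<open>Operators on a fermionic Fock space over the enveloping algebra\<close>

text \<open>A function on sets of natural numbers stands for a vector of the Fock space with modes \<open>0, 1, \<dots>\<close>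
  and coefficients in the enveloping algebra. Preservation of the vacuum ideals lets operators act on
  vectors with coefficients in a vacuum module.\<close>

typedef (overloaded) 'g fock_op = "{f :: (nat set \<Rightarrow> 'g::quadratic_lie_algebra affine uea) \<Rightarrow> nat set \<Rightarrow> 'g affine uea.
    (\<forall>g h. f (\<lambda>S. g S + h S) = (\<lambda>S. f g S + f h S)) \<and>
    (\<forall>\<kappa> g. (\<forall>S. g S \<in> vacuum_ideal \<kappa>) \<longrightarrow> (\<forall>S. f g S \<in> vacuum_ideal \<kappa>))}"
  morphisms op_apply Fock_op
  by (rule exI[of _ "\<lambda>g. g"]) simp

setup_lifting type_definition_fock_op

lemma fock_op_eqI: "(\<And>g S. op_apply A g S = op_apply B g S) \<Longrightarrow> A = B"
  by (simp add: op_apply_inject[symmetric] fun_eq_iff)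

lemma op_apply_add_right: "op_apply A (\<lambda>S. g S + h S) = (\<lambda>S. op_apply A g S + op_apply A h S)"
  using op_apply[of A] by blast

lemma op_apply_vacuum_ideal: "(\<And>S. g S \<in> vacuum_ideal \<kappa>) \<Longrightarrow> op_apply A g S \<in> vacuum_ideal \<kappa>"
  using op_apply[of A] by blast

lemma op_apply_zero_right [simp]: "op_apply A (\<lambda>S. 0) = (\<lambda>S. 0)"
  using op_apply_add_right[of A "\<lambda>S. 0" "\<lambda>S. 0"] by (simp add: fun_eq_iff)

instantiation fock_op :: (quadratic_lie_algebra) ring_1
begin

lift_definition zero_fock_op :: "'a fock_op" is "\<lambda>g S. 0"
  by (simp add: vacuum_ideal_closed)
lift_definition one_fock_op :: "'a fock_op" is "\<lambda>g. g" by simp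
lift_definition plus_fock_op :: "'a fock_op \<Rightarrow> 'a fock_op \<Rightarrow> 'a fock_op" is "\<lambda>A B g S. A g S + B g S"
  by (auto simp: add_ac vacuum_ideal_closed)
lift_definition minus_fock_op :: "'a fock_op \<Rightarrow> 'a fock_op \<Rightarrow> 'a fock_op" is "\<lambda>A B g S. A g S - B g S"
  by (auto simp: vacuum_ideal_closed)
lift_definition uminus_fock_op :: "'a fock_op \<Rightarrow> 'a fock_op" is "\<lambda>A g S. - A g S"
  by (auto simp: vacuum_ideal_closed)
lift_definition times_fock_op :: "'a fock_op \<Rightarrow> 'a fock_op \<Rightarrow> 'a fock_op" is "\<lambda>A B g. A (B g)"
  by auto

instance
proof
  fix A B C :: "'a fock_op"
  show "A + B + C = A + (B + C)" "A + B = B + A" "0 + A = A" "- A + A = 0" "A - B = A + - B"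
    by (transfer; simp add: fun_eq_iff add_ac)+
  show "A * B * C = A * (B * C)" "1 * A = A" "A * 1 = A" "(A + B) * C = A * C + B * C"
    by (transfer; simp)+
  show "A * (B + C) = A * B + A * C"
    by transfer (simp add: fun_eq_iff)
  show "(0 :: 'a fock_op) \<noteq> 1"
  proof
    assume "(0 :: 'a fock_op) = 1"
    then have "op_apply 0 (\<lambda>S. 1 :: 'a affine uea) {} = op_apply 1 (\<lambda>S. 1 :: 'a affine uea) {}" by simp
    then show False by (simp add: zero_fock_op.rep_eq one_fock_op.rep_eq)
  qed
qed

end

lemmas op_apply_simps [simp] = zero_fock_op.rep_eq one_fock_op.rep_eq plus_fock_op.rep_eq
  minus_fock_op.rep_eq uminus_fock_op.rep_eq times_fock_op.rep_eq

lemma op_apply_of_nat [simp]: "op_apply (of_nat k) g S = of_nat k * g S"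
  by (induction k) (simp_all add: distrib_right)

lemma op_apply_of_int [simp]: "op_apply (of_int z) g S = of_int z * g S"
  by (cases z rule: int_diff_cases) (simp add: left_diff_distrib)

lemma op_apply_sum [simp]: "op_apply (\<Sum>i\<in>A. f i) g S = (\<Sum>i\<in>A. op_apply (f i) g S)"
  by (induction A rule: infinite_finite_induct) simp_all

text \<open>Whether a sign arises when mode p is moved past the smaller modes in S, as in the
  Jordan-Wigner representation.\<close>

definition flips :: "nat \<Rightarrow> nat set \<Rightarrow> bool" where
  "flips p S \<longleftrightarrow> odd (card {q\<in>S. q < p})"

lemma flips_insert: "flips q (insert p S) \<longleftrightarrow> (flips q S \<noteq> (p \<notin> S \<and> p < q))"
proof -
  have fin: "finite {x\<in>S. x < q}" by (rule finite_subset[of _ "{..<q}"]) auto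
  have "{x \<in> insert p S. x < q} = (if p < q then insert p {x\<in>S. x < q} else {x\<in>S. x < q})" by auto
  then show ?thesis using fin by (auto simp: flips_def card_insert_if)
qed

lemma flips_remove: "flips q (S - {p}) \<longleftrightarrow> (flips q S \<noteq> (p \<in> S \<and> p < q))"
proof (cases "p \<in> S")
  case True
  then have "S = insert p (S - {p})" by auto
  then have "flips q S \<longleftrightarrow> (flips q (S - {p}) \<noteq> (p \<notin> S - {p} \<and> p < q))"
    by (metis flips_insert)
  with True show ?thesis by auto
qed simp

lift_definition create :: "nat \<Rightarrow> 'g::quadratic_lie_algebra fock_op" is
  "\<lambda>p g S. if p \<in> S then (if flips p S then - g (S - {p}) else g (S - {p})) else 0"
  by (auto simp: vacuum_ideal_closed)

lift_definition annihilate :: "nat \<Rightarrow> 'g::quadratic_lie_algebra fock_op" is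
  "\<lambda>p g S. if p \<notin> S then (if flips p S then - g (insert p S) else g (insert p S)) else 0"
  by (auto simp: vacuum_ideal_closed)

definition left_mult :: "'g::quadratic_lie_algebra affine uea \<Rightarrow> 'g fock_op" where
  "left_mult u = Fock_op (\<lambda>g S. u * g S)"

lemma op_apply_left_mult: "op_apply (left_mult u) g S = u * g S"
  unfolding left_mult_def by (subst Fock_op_inverse) (auto simp: distrib_left vacuum_ideal_closed)

lift_definition tau_op :: "'g::quadratic_lie_algebra fock_op" is "\<lambda>g S. tau (g S)"
  by (auto simp: tau_add tau_vacuum_ideal)

lemmas op_apply_basic [simp] = create.rep_eq annihilate.rep_eq op_apply_left_mult tau_op.rep_eq

lemma create_create: "create q * create p = - (create p * create q)" "create p * create p = 0"
proof -
  show square: "create p * create p = 0" for p by (rule fock_op_eqI) simp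
  have "S - {q} - {p} = S - {p} - {q}" for S :: "nat set" by auto
  then have "create q * create p = - (create p * create q)" if "p \<noteq> q"
    using that by (intro fock_op_eqI) (auto simp: flips_remove)
  then show "create q * create p = - (create p * create q)"
    by (cases "p = q") (simp_all add: square)
qed

lemma annihilate_create:
  "annihilate p * create q = (if p = q then 1 else 0) - create q * annihilate p"
proof (rule fock_op_eqI)
  fix g :: "nat set \<Rightarrow> 'a affine uea" and S
  show "op_apply (annihilate p * create q) g S
      = op_apply ((if p = q then 1 else 0) - create q * annihilate p) g S"
  proof (cases "p = q")
    case True
    then show ?thesis by (auto simp: flips_insert flips_remove insert_absorb)
  next
    case False
    then have "insert p S - {q} = insert p (S - {q})" by auto
    then show ?thesis using False by (auto simp: flips_insert flips_remove)
  qed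
qed

lemma left_mult_commutes:
  "left_mult u * create p = create p * left_mult u" "left_mult u * annihilate p = annihilate p * left_mult u"
  "tau_op * create p = create p * tau_op" "tau_op * annihilate p = annihilate p * tau_op"
  by (rule fock_op_eqI; simp add: tau_minus)+

lemma left_mult_algebra:
  "left_mult (u + v) = left_mult u + left_mult v" "left_mult (u - v) = left_mult u - left_mult v"
  "left_mult (u * v) = left_mult u * left_mult v" "left_mult (of_int z) = of_int z" "left_mult 0 = 0"
  "left_mult (- u) = - left_mult u"
  by (rule fock_op_eqI; simp add: algebra_simps)+

lemma tau_left_mult: "tau_op * left_mult u = left_mult u * tau_op + left_mult (tau u)"
  by (rule fock_op_eqI) (simp add: tau_mult add.commute)

definition vacuum :: "'u::ring_1 \<Rightarrow> nat set \<Rightarrow> 'u" where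
  "vacuum u = (\<lambda>S. if S = {} then u else 0)"

lemma vacuum_annihilate: "op_apply (annihilate p) (vacuum u) = (\<lambda>S. 0)"
  by (auto simp: vacuum_def)

lemma vacuum_tau: "op_apply tau_op (vacuum u) = vacuum (tau u)"
  by (auto simp: vacuum_def)

lemma vacuum_left_mult: "op_apply (left_mult u) (vacuum v) = vacuum (u * v)"
  by (auto simp: vacuum_def)

definition coefficient_ideal :: "complex \<Rightarrow> nat set \<Rightarrow> 'g::quadratic_lie_algebra fock_op set" where
  "coefficient_ideal \<kappa> T = {A. op_apply A (vacuum 1) T \<in> vacuum_ideal \<kappa>}"

lemma of_nat_eq_scaleC: "of_nat k = of_nat k *\<^sub>C (1 :: 'a::complex_algebra_1)"
  by (induction k) (simp_all add: scaleC_add_left)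

interpretation coefficient_ideal: coefficient_kernel "coefficient_ideal \<kappa> T"
proof
  fix A :: "'a fock_op" and k
  assume "of_nat (Suc k) * A \<in> coefficient_ideal \<kappa> T"
  then have "of_nat (Suc k) *\<^sub>C op_apply A (vacuum 1) T \<in> vacuum_ideal \<kappa>"
    by (simp add: coefficient_ideal_def of_nat_eq_scaleC[of "Suc k"] del: of_nat_Suc)
  then have "(1 / of_nat (Suc k)) *\<^sub>C (of_nat (Suc k) *\<^sub>C op_apply A (vacuum 1) T) \<in> vacuum_ideal \<kappa>"
    by (rule vacuum_ideal_closed(6))
  moreover have "(1 / of_nat (Suc k)) *\<^sub>C (of_nat (Suc k) *\<^sub>C x) = x" for x :: "'a affine uea"
    by (simp del: of_nat_Suc)
  ultimately show "A \<in> coefficient_ideal \<kappa> T"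
    by (simp only: coefficient_ideal_def mem_Collect_eq)
qed (auto simp: coefficient_ideal_def vacuum_ideal_closed)

text \<open>As a right factor it kills the vacuum. As a left factor, \<open>create p\<close> reads
  the coefficient at T from the set without p, which still contains q, and there the range of
  \<open>annihilate q\<close> vanishes.\<close>

lemma null_create_annihilate:
  assumes "p \<noteq> q" "q \<in> T"
  shows "coefficient_ideal.null \<kappa> T (create p * annihilate q)"
proof -
  have "op_apply (A * (create p * annihilate q)) (vacuum 1) T = 0" for A :: "'a fock_op"
    by (simp only: times_fock_op.rep_eq vacuum_annihilate op_apply_zero_right)
  moreover have "op_apply (create p * annihilate q * A) (vacuum 1) T = 0" for A :: "'a fock_op"
    using assms by simp
  ultimately show ?thesis
    unfolding coefficient_ideal.null_def by (simp add: coefficient_ideal_def vacuum_ideal_closed)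
qed

text \<open>Applied to the vacuum, u gives a vector with all coefficients in the vacuum ideal, and
  every operator preserves such vectors.\<close>

lemma annihilates_left_mult:
  assumes "u \<in> vacuum_ideal \<kappa>"
  shows "A * left_mult u \<in> coefficient_ideal \<kappa> T"
proof -
  have "vacuum u S \<in> vacuum_ideal \<kappa>" for S
    using assms by (simp add: vacuum_def vacuum_ideal_closed)
  then have "op_apply A (vacuum u) T \<in> vacuum_ideal \<kappa>"
    by (rule op_apply_vacuum_ideal)
  then show ?thesis
    by (simp only: coefficient_ideal_def mem_Collect_eq times_fock_op.rep_eq vacuum_left_mult mult_1_right)
qed

section \<open>The symplectic currents\<close>

definition int_sign :: "'n::finite idx \<Rightarrow> int" where
  "int_sign i = (if Rep_idx i \<le> CARD('n) then 1 else - 1)"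

lemma idx_sign_eq: "idx_sign i = of_int (int_sign i)"
  by (simp add: idx_sign_def int_sign_def)

lemma int_sign_prime [simp]: "int_sign (idx_prime i) = - int_sign i"
  using idx_sign_prime[of i] by (simp add: idx_sign_eq flip: of_int_minus)

lemma int_sign_square: "int_sign i * int_sign i = 1"
  by (simp add: int_sign_def)

lemma of_int_sign_square: "of_int (int_sign i) * of_int (int_sign i) = (1 :: 'a::ring_1)"
  by (simp add: int_sign_square flip: of_int_mult)

definition omega :: "'n::finite idx \<Rightarrow> 'n idx \<Rightarrow> int" where
  "omega i j = (if j = idx_prime i then int_sign i else 0)"

text \<open>Lowering the second index with the symplectic form turns \<open>(F\<^sub>i\<^sub>j)\<close> into a symmetric matrix.\<close>

definition sp_elem :: "'n::finite idx \<Rightarrow> 'n idx \<Rightarrow> 'n sp" where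
  "sp_elem i j = idx_sign j *\<^sub>C F_sp i (idx_prime j)"

text \<open>With the index lowered, products and traces of matrix units involve only the values of
  \<omega>.\<close>

definition lowered_unit :: "'n::finite idx \<Rightarrow> 'n idx \<Rightarrow> complex^'n idx^'n idx" where
  "lowered_unit i j = idx_sign j *\<^sub>C matrix_unit i (idx_prime j)"

lemma Rep_sp_elem: "Rep_sp (sp_elem i j) = lowered_unit i j + lowered_unit j i"
  by (simp add: sp_elem_def scaleC_sp.rep_eq F_sp.rep_eq F_matrix_def lowered_unit_def scaleC_diff_right
      scaleC_minus_left scaleC_add_right mult.left_commute)

lemma sp_elem_sym: "sp_elem i j = sp_elem j i"
  by (simp add: Rep_sp_inject[symmetric] Rep_sp_elem add.commute)

lemma matrix_unit_mult: "matrix_unit i a ** matrix_unit b j = (if a = b then matrix_unit i j else 0)"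
proof -
  have "(\<Sum>k\<in>UNIV. (if c = i \<and> k = a then 1 else 0) * (if k = b \<and> d = j then 1 else 0))
     = (if a = b \<and> c = i \<and> d = j then 1 else (0 :: complex))" for c d
  proof -
    have "(if c = i \<and> k = a then 1 else 0) * (if k = b \<and> d = j then 1 else 0)
      = (if k = a then (if a = b \<and> c = i \<and> d = j then 1 else (0 :: complex)) else 0)" for k by auto
    then show ?thesis by simp
  qed
  then show ?thesis by (simp add: vec_eq_iff matrix_matrix_mult_def matrix_unit_def)
qed

lemma lowered_unit_mult: "lowered_unit i j ** lowered_unit k l = of_int (omega j k) *\<^sub>C lowered_unit i l"
  by (auto simp: lowered_unit_def scaleC_matrix_mult matrix_unit_mult omega_def idx_sign_eq mult.commute)

lemma trace_lowered_unit: "trace (lowered_unit i j) = of_int (omega j i)"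
proof -
  have "(\<Sum>k\<in>UNIV. if k = i \<and> k = idx_prime j then 1 else (0::complex)) = (if i = idx_prime j then 1 else 0)"
  proof -
    have "(if k = i \<and> k = idx_prime j then 1 else (0::complex)) = (if k = i then (if i = idx_prime j then 1 else 0) else 0)" for k
      by auto
    then show ?thesis by simp
  qed
  then show ?thesis
    by (simp add: lowered_unit_def trace_scaleC) (simp add: trace_def matrix_unit_def omega_def idx_sign_eq)
qed

lemma omega_skew: "omega j i = - omega i j"
  by (auto simp: omega_def)

lemma bracket_sp_elem:
  "lie_bracket (sp_elem i j) (sp_elem k l) = of_int (omega j k) *\<^sub>C sp_elem i l + of_int (omega j l) *\<^sub>C sp_elem i k
     + of_int (omega i k) *\<^sub>C sp_elem j l + of_int (omega i l) *\<^sub>C sp_elem j k"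
proof -
  have "Rep_sp (lie_bracket (sp_elem i j) (sp_elem k l)) = Rep_sp (of_int (omega j k) *\<^sub>C sp_elem i l + of_int (omega j l) *\<^sub>C sp_elem i k
     + of_int (omega i k) *\<^sub>C sp_elem j l + of_int (omega i l) *\<^sub>C sp_elem j k)"
    by (simp add: lie_bracket_sp.rep_eq plus_sp.rep_eq scaleC_sp.rep_eq Rep_sp_elem matrix_add_ldistrib
        matrix_add_rdistrib' lowered_unit_mult scaleC_add_right scaleC_minus_left
        omega_skew[of l i] omega_skew[of l j] omega_skew[of k i] omega_skew[of k j])
  then show ?thesis by (simp add: Rep_sp_inject)
qed

lemma inv_form_sp_elem:
  "inv_form (sp_elem i j) (sp_elem k l) = of_int (- 2 * (omega j k * omega i l + omega j l * omega i k))"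
  by (simp add: inv_form_sp.rep_eq Rep_sp_elem matrix_add_ldistrib matrix_add_rdistrib' lowered_unit_mult trace_add
      trace_scaleC trace_lowered_unit omega_skew[of l i] omega_skew[of l j] omega_skew[of k i] omega_skew[of k j])

section \<open>Affine currents and Grassmann variables as operators\<close>

definition current :: "'g::quadratic_lie_algebra \<Rightarrow> int \<Rightarrow> 'g fock_op" where
  "current y c = left_mult (uea_gen (loop_elem y c))"

definition level_op :: "'g::quadratic_lie_algebra fock_op" where
  "level_op = left_mult (uea_gen central_elem)"

lemma of_int_scaleC: "of_int z *\<^sub>C (u :: 'a::complex_algebra_1) = of_int z * u"
proof (cases z rule: int_diff_cases)
  case (diff m n)
  have "(of_nat m + - of_nat n) *\<^sub>C u = of_nat m *\<^sub>C u - of_nat n *\<^sub>C u"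
    by (simp only: scaleC_add_left scaleC_minus_left) simp
  moreover have "of_nat k *\<^sub>C u = of_nat k * u" for k
    by (subst of_nat_eq_scaleC) simp
  ultimately show ?thesis by (simp add: diff left_diff_distrib)
qed

lemma current_add: "current (y + z) c = current y c + current z c"
  by (simp add: current_def loop_elem_add uea_gen_add left_mult_algebra)

lemma current_of_int: "current (of_int z *\<^sub>C y) c = of_int z * current y c"
  by (simp add: current_def loop_elem_scaleC uea_gen_scaleC of_int_scaleC left_mult_algebra)

lemma current_commutator:
  "current y c * current z d = current z d * current y c + current (lie_bracket y z) (c + d)
     + left_mult (uea_gen ((if c + d = 0 then of_int c * inv_form y z else 0) *\<^sub>C central_elem))"
proof -
  have "uea_gen (loop_elem y c) * uea_gen (loop_elem z d) = uea_gen (loop_elem z d) * uea_gen (loop_elem y c)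
     + uea_gen (loop_elem (lie_bracket y z) (c + d))
     + uea_gen ((if c + d = 0 then of_int c * inv_form y z else 0) *\<^sub>C central_elem)"
    using uea_gen_commutator[of "loop_elem y c" "loop_elem z d"]
    by (simp only: lie_bracket_loop_elem uea_gen_add) (simp add: algebra_simps)
  then show ?thesis
    by (simp only: current_def left_mult_algebra[symmetric])
qed

lemma level_op_central: "level_op * current y c = current y c * level_op"
proof -
  have "uea_gen central_elem * uea_gen X = uea_gen X * uea_gen central_elem" for X :: "'a affine"
  proof -
    have "uea_gen central_elem * uea_gen X - uea_gen X * uea_gen central_elem = 0"
      using uea_gen_scaleC[of 0 0] by (simp add: uea_gen_commutator lie_bracket_central_elem)
    then show ?thesis by simp
  qed
  then show ?thesis by (simp add: level_op_def current_def left_mult_algebra[symmetric])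
qed

lemma tau_current: "tau_op * current y c = current y c * tau_op + of_int (- c) * current y (c - 1)"
  unfolding current_def
  by (simp only: tau_left_mult tau_loop_elem of_int_scaleC left_mult_algebra)

lemma tau_level_op: "tau_op * level_op = level_op * tau_op"
  by (simp add: level_op_def tau_left_mult tau_central left_mult_algebra)

text \<open>Even modes carry the first family and odd modes the second. Interleaving them makes the
  modes of \<psi>_i and \<eta>_i adjacent, which keeps signs out of the powers of \<gamma>.\<close>

definition psi :: "'n::finite idx \<Rightarrow> 'n sp fock_op" where "psi i = create (2 * Rep_idx i)"
definition eta :: "'n::finite idx \<Rightarrow> 'n sp fock_op" where "eta i = create (2 * Rep_idx i + 1)"
text \<open>\<eta> with its index lowered; this is the \<phi> of
  \<open>symplectic_fermions\<close>.\<close>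

definition chi :: "'n::finite idx \<Rightarrow> 'n sp fock_op" where "chi i = of_int (int_sign i) * eta (idx_prime i)"
definition d_psi :: "'n::finite idx \<Rightarrow> 'n sp fock_op" where "d_psi i = annihilate (2 * Rep_idx i)"
definition d_chi :: "'n::finite idx \<Rightarrow> 'n sp fock_op" where
  "d_chi i = of_int (int_sign i) * annihilate (2 * Rep_idx (idx_prime i) + 1)"

lemma even_neq_odd: "2 * a \<noteq> Suc (2 * b)" "Suc (2 * b) \<noteq> 2 * a" for a b :: nat
  by presburger+

lemma mult_commutes: "z * x = x * z \<Longrightarrow> z * y = y * z \<Longrightarrow> z * (x * y) = x * y * (z :: 'r::ring_1)"
  by (metis mult.assoc)

lemma of_int_anticommute:
  assumes "x * y = - (y * (x :: 'r::ring_1))"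
  shows "of_int a * x * (of_int b * y) = - (of_int b * y * (of_int a * x))" "x * (of_int b * y) = - (of_int b * y * x)"
    "of_int a * x * y = - (y * (of_int a * x))"
proof -
  have 2: "z * (of_int b * y) = - (of_int b * y * z)" if "z * y = - (y * z)" for z
    by (simp only: mult_of_int_left[of z b y] that) (simp add: mult.assoc)
  show 3: "of_int a * x * y = - (y * (of_int a * x))"
    by (simp add: mult.assoc assms mult_of_int_left[of y a x])
  show "x * (of_int b * y) = - (of_int b * y * x)" by (rule 2) (rule assms)
  show "of_int a * x * (of_int b * y) = - (of_int b * y * (of_int a * x))" by (rule 2) (rule 3)
qed

lemma of_int_mult_mult: "of_int a * x * (of_int b * y) = of_int (a * b) * (x * (y :: 'r::ring_1))"
  by (simp only: mult.assoc mult_of_int_left[of x b y] of_int_mult)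

interpretation sp: symplectic_fermions "psi :: 'n::finite idx \<Rightarrow> _" chi d_psi d_chi int_sign idx_prime
proof
  fix i j :: "'n idx"
  show "idx_prime (idx_prime i) = i" "int_sign (idx_prime i) = - int_sign i" "int_sign i * int_sign i = 1"
    by (simp_all add: int_sign_square)
  show "psi j * psi i = - (psi i * psi j)" "psi i * psi i = 0"
    unfolding psi_def by (rule create_create)+
  show "chi j * chi i = - (chi i * chi j)" "chi j * psi i = - (psi i * chi j)"
    unfolding chi_def eta_def psi_def by (rule of_int_anticommute create_create)+
  show "chi i * chi i = 0"
    by (simp only: chi_def eta_def of_int_mult_mult create_create(2) mult_zero_right)
  show "d_psi i * psi j = (if i = j then 1 else 0) - psi j * d_psi i"
    by (simp add: d_psi_def psi_def annihilate_create Rep_idx_inject)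
  show "d_psi i * chi j = - (chi j * d_psi i)"
    unfolding d_psi_def chi_def eta_def
    by (rule of_int_anticommute) (simp add: annihilate_create even_neq_odd)
  show "d_chi i * psi j = - (psi j * d_chi i)"
    unfolding d_chi_def psi_def
    by (rule of_int_anticommute) (simp add: annihilate_create even_neq_odd)
  have "idx_prime i = idx_prime j \<longleftrightarrow> i = j" by (metis idx_prime_prime)
  then show "d_chi i * chi j = (if i = j then 1 else 0) - chi j * d_chi i"
    unfolding d_chi_def chi_def eta_def of_int_mult_mult annihilate_create
    by (auto simp: Rep_idx_inject right_diff_distrib of_int_sign_square mult.commute)
qed


abbreviation sp_current :: "int \<Rightarrow> 'n::finite idx \<Rightarrow> 'n idx \<Rightarrow> 'n sp fock_op" where
  "sp_current c i j \<equiv> current (sp_elem i j) c"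

lemma om_eq: "sp.om i j = of_int (omega i j)"
  by (simp add: sp.om_def omega_def)

lemma current_commutes:
  "current y c * psi k = psi k * current y c" "current y c * chi k = chi k * current y c"
  "current y c * d_psi k = d_psi k * current y c" "current y c * d_chi k = d_chi k * current y c"
  "tau_op * psi k = psi k * tau_op" "tau_op * chi k = chi k * tau_op"
  "tau_op * d_psi k = d_psi k * tau_op" "tau_op * d_chi k = d_chi k * tau_op"
  "level_op * psi k = psi k * level_op" "level_op * chi k = chi k * level_op"
  by (simp_all add: current_def level_op_def psi_def chi_def eta_def d_psi_def d_chi_def mult_of_int_left
      left_mult_commutes mult.assoc)

lemma uea_gen_zero: "uea_gen 0 = 0"
  using uea_gen_scaleC[of 0 0] by simp

lemma left_mult_scaleC_zero: "left_mult (uea_gen (0 *\<^sub>C X)) = 0"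
  by (simp add: uea_gen_zero left_mult_algebra)

interpretation sp: coupled_currents "psi :: 'n::finite idx \<Rightarrow> _" chi d_psi d_chi int_sign idx_prime sp_current tau_op
proof
  fix c c' :: int and i j k l :: "'n idx"
  show "sp_current c i j = sp_current c j i" by (simp add: sp_elem_sym)
  show "tau_op * sp_current (- 1) i j = sp_current (- 1) i j * tau_op + sp_current (- 2) i j"
    using tau_current[of "sp_elem i j" "- 1"] by simp
  show "tau_op * sp_current 0 i j = sp_current 0 i j * tau_op"
    using tau_current[of "sp_elem i j" 0] by simp
  assume "c + c' \<noteq> 0"
  then have "sp_current c i j * sp_current c' k l = sp_current c' k l * sp_current c i j
      + current (lie_bracket (sp_elem i j) (sp_elem k l)) (c + c')"
    by (subst current_commutator) (simp only: if_False left_mult_scaleC_zero add_0_right)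
  then show "sp_current c i j * sp_current c' k l = sp_current c' k l * sp_current c i j
      + (sp.om j k * sp_current (c + c') i l + sp.om j l * sp_current (c + c') i k
       + sp.om i k * sp_current (c + c') j l + sp.om i l * sp_current (c + c') j k)"
    by (simp only: bracket_sp_elem current_add current_of_int om_eq)
qed (rule current_commutes)+

section \<open>Invariance of the fermionic sum at the critical level\<close>

definition top_modes :: "'n::finite itself \<Rightarrow> nat set" where
  "top_modes _ = (\<Union>i::'n idx. {2 * Rep_idx i, 2 * Rep_idx i + 1})"

abbreviation critical_kernel :: "'n::finite sp fock_op set" where
  "critical_kernel \<equiv> coefficient_ideal (- of_nat (CARD('n) + 1)) (top_modes TYPE('n))"

abbreviation critical_null :: "'n::finite sp fock_op \<Rightarrow> bool" where
  "critical_null \<equiv> coefficient_kernel.null critical_kernel"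

lemma top_modes: "2 * Rep_idx i \<in> top_modes TYPE('n)" "2 * Rep_idx i + 1 \<in> top_modes TYPE('n)"
  for i :: "'n::finite idx"
  by (auto simp: top_modes_def)

lemma null_of_int: "critical_null x \<Longrightarrow> critical_null (of_int z * x)"
  unfolding coefficient_ideal.null_def by (simp add: mult_of_int_left mult.assoc coefficient_ideal.N_of_int)

lemma null_add: "critical_null x \<Longrightarrow> critical_null y \<Longrightarrow> critical_null (x + y)"
  unfolding coefficient_ideal.null_def by (simp add: distrib_left distrib_right coefficient_ideal.N_add)

lemma null_sum: "(\<And>i. i \<in> A \<Longrightarrow> critical_null (x i)) \<Longrightarrow> critical_null (\<Sum>i\<in>A. x i)"
  unfolding coefficient_ideal.null_def by (simp add: sum_distrib_left sum_distrib_right coefficient_ideal.N_sum)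

text \<open>Each bilinear annihilates one mode and creates a different one. For j = i' the last two
  would be number operators up to sign, and these reproduce the top form.\<close>

lemma null_fermion_bilinear:
  fixes i j :: "'n::finite idx"
  shows "critical_null (psi i * d_chi j)" "critical_null (chi i * d_psi j)"
  "j \<noteq> idx_prime i \<Longrightarrow> critical_null (sp.\<psi>h i * d_psi j)"
  "j \<noteq> idx_prime i \<Longrightarrow> critical_null (sp.\<phi>h i * d_chi j)"
proof -
  have chih: "sp.\<phi>h i = - eta i"
    by (simp add: sp.\<phi>h_def chi_def of_int_sign_square mult.assoc[symmetric])
  have "critical_null (of_int z * (create a * annihilate b) :: 'n sp fock_op)" if "a \<noteq> b" "b \<in> top_modes TYPE('n)" for z a b
    by (rule null_of_int) (rule null_create_annihilate[OF that])
  note n = this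
  show "critical_null (psi i * d_chi j)"
    by (simp only: psi_def d_chi_def mult_of_int_left) (rule n, simp_all only: top_modes, presburger)
  show "critical_null (chi i * d_psi j)"
    by (simp only: chi_def eta_def d_psi_def mult.assoc) (rule n, simp_all only: top_modes, presburger)
  assume "j \<noteq> idx_prime i"
  then have "2 * Rep_idx (idx_prime i) \<noteq> 2 * Rep_idx j" "2 * Rep_idx i + 1 \<noteq> 2 * Rep_idx (idx_prime j) + 1"
    by (auto simp: Rep_idx_inject)
  note neq = this
  show "critical_null (sp.\<psi>h i * d_psi j)"
    by (simp only: sp.\<psi>h_def psi_def d_psi_def mult.assoc) (rule n, simp_all only: top_modes neq, simp)
  have "sp.\<phi>h i * d_chi j = of_int (- int_sign j) * (create (2 * Rep_idx i + 1) * annihilate (2 * Rep_idx (idx_prime j) + 1))"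
    by (simp only: chih d_chi_def eta_def mult_minus_left mult_of_int_left) simp
  then show "critical_null (sp.\<phi>h i * d_chi j)"
    by (simp only:) (rule n, simp_all only: top_modes neq, simp)
qed

lemma annihilates_current: "c \<ge> 0 \<Longrightarrow> A * current y c \<in> critical_kernel"
  unfolding current_def by (rule annihilates_left_mult) (rule vacuum_ideal_loop)

text \<open>Its top coefficient is a multiple of S_k when m = 2k and d = 2n - 2k. The indicator of
  even r is the weight of period 2 to which \<open>first_mode_invariance\<close> is applied.\<close>

definition fermionic_sum :: "nat \<Rightarrow> nat \<Rightarrow> 'n::finite sp fock_op" where
  "fermionic_sum m d = (\<Sum>r\<le>m. of_int (if even r then 1 else 0) * (of_nat (d + r + 1)
     * (sp.\<gamma> ^ (d + r) * fps_nth (tau_line.L tau_op (sp.Q (- 1)) ^ m) r)))"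

text \<open>The condition on d gives every summand exactly 2n pairs of Grassmann variables, the
  degree of the top form.\<close>

lemma current_mode_1:
  fixes p :: "'n::finite idx"
  assumes "d + (m + 2) = 2 * CARD('n)"
  shows "current ((1 / 2) *\<^sub>C sp_elem p p) 1 * fermionic_sum (m + 2) d \<in> critical_kernel"
proof -
  have half: "lie_bracket ((1 / 2) *\<^sub>C sp_elem p p) (sp_elem k l)
      = of_int (omega p k) *\<^sub>C sp_elem p l + of_int (omega p l) *\<^sub>C sp_elem p k" for k l
  proof -
    have "(1 / 2) *\<^sub>C (a *\<^sub>C x + b *\<^sub>C y + a *\<^sub>C x + b *\<^sub>C y) = a *\<^sub>C x + b *\<^sub>C (y :: 'n sp)" for a b x y
    proof -
      have "(1 / 2) *\<^sub>C (a *\<^sub>C x + b *\<^sub>C y + a *\<^sub>C x + b *\<^sub>C y)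
        = (1 / 2 * a + 1 / 2 * a) *\<^sub>C x + (1 / 2 * b + 1 / 2 * b) *\<^sub>C y"
        by (simp only: scaleC_add_right scaleC_scaleC scaleC_add_left add_ac)
      then show ?thesis by simp
    qed
    then show ?thesis by (simp only: lie_bracket_scaleC_left bracket_sp_elem)
  qed
  have form: "inv_form ((1 / 2) *\<^sub>C sp_elem p p) (sp_elem k l) = of_int (- 2 * (omega p k * omega p l))" for k l
    by (simp add: inv_form_scaleC_left inv_form_sp_elem)
  interpret first_current "psi :: 'n idx \<Rightarrow> _" chi d_psi d_chi int_sign idx_prime sp_current tau_op critical_kernel
    "current ((1 / 2) *\<^sub>C sp_elem p p) 0" "current ((1 / 2) *\<^sub>C sp_elem p p) 1" level_op p "CARD('n)"
  proof
    let ?x = "(1 / 2) *\<^sub>C sp_elem p p"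
    show "current ?x 1 * tau_op = tau_op * current ?x 1 + current ?x 0"
      "current ?x 0 * tau_op = tau_op * current ?x 0"
      using tau_current[of ?x 1] tau_current[of ?x 0] by simp_all
    fix k l :: "'n idx"
    show "current ?x 0 * sp_current (- 1) k l = sp_current (- 1) k l * current ?x 0
        + (sp.om p k * sp_current (- 1) p l + sp.om p l * sp_current (- 1) p k)"
      by (subst current_commutator) (simp add: half current_add current_of_int om_eq uea_gen_zero left_mult_algebra)
    have "left_mult (uea_gen (of_int z *\<^sub>C central_elem)) = (of_int z * level_op :: 'n sp fock_op)" for z
      by (simp add: uea_gen_scaleC of_int_scaleC left_mult_algebra level_op_def)
    then have "current ?x 1 * sp_current (- 1) k l = sp_current (- 1) k l * current ?x 1
        + current (lie_bracket ?x (sp_elem k l)) 0 + of_int (- 2 * (omega p k * omega p l)) * level_op"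
      using current_commutator[of ?x 1 "sp_elem k l" "- 1"]
      by (simp only: add.right_inverse simp_thms if_True of_int_1 mult_1_left form)
    then show "current ?x 1 * sp_current (- 1) k l = sp_current (- 1) k l * current ?x 1
        + (sp.om p k * sp_current 0 p l + sp.om p l * sp_current 0 p k - 2 * (sp.om p k * sp.om p l) * level_op)"
      by (simp add: half current_add current_of_int om_eq)
    show "level_op * tau_op = tau_op * level_op" by (rule tau_level_op[symmetric])
    show "critical_null sp.E" "critical_null sp.F"
      unfolding sp.E_def sp.F_def by (intro null_sum null_fermion_bilinear)+
    show "critical_null (sp.D\<psi> p p)" "critical_null (sp.D\<phi> p p)"
      unfolding sp.D\<psi>_def sp.D\<phi>_def by (intro null_fermion_bilinear; simp)+
    show "coefficient_kernel.annihilates critical_kernel (current ?x 0)" "coefficient_kernel.annihilates critical_kernel (current ?x 1)" "coefficient_kernel.annihilates critical_kernel (sp_current 0 p l)"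
      unfolding coefficient_ideal.annihilates_def by (intro allI annihilates_current; simp)+
    fix A :: "'n sp fock_op"
    \<comment> \<open>At the critical level this is left multiplication by a generator of the vacuum
      ideal.\<close>
    have "(level_op :: 'n sp fock_op) + of_nat (Suc CARD('n)) = left_mult (uea_gen central_elem - (- of_nat (CARD('n) + 1)) *\<^sub>C 1)"
    proof -
      have "left_mult (of_nat k) = (of_nat k :: 'n sp fock_op)" for k
        using left_mult_algebra(4)[of "int k"] by simp
      moreover have "- ((- of_nat (CARD('n) + 1)) *\<^sub>C 1) = (of_nat (Suc CARD('n)) :: 'n sp affine uea)"
        by (subst of_nat_eq_scaleC) (simp only: scaleC_minus_left minus_minus Suc_eq_plus1)
      ultimately show ?thesis
        by (simp only: level_op_def diff_conv_add_uminus left_mult_algebra(1))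
    qed
    then show "A * (level_op + of_nat (Suc CARD('n))) \<in> critical_kernel"
      by (simp only: annihilates_left_mult[OF vacuum_ideal_central])
  qed (rule current_commutes level_op_central)+
  show ?thesis
    unfolding fermionic_sum_def by (rule first_mode_invariance[OF assms]) simp
qed

text \<open>The current minus the rotation commutes with \<gamma>, Q and \<tau>, hence with the sum.
  On the right the current kills the vacuum, and the rotation is null. The excluded case j = i' has
  number operators in its rotation; it is recovered from brackets in
  \<open>sp_generation\<close>.\<close>

lemma current_mode_0:
  fixes i j :: "'n::finite idx"
  assumes "j \<noteq> idx_prime i"
  shows "sp_current 0 i j * fermionic_sum m d \<in> critical_kernel"
proof -
  let ?e = "sp_current 0 i j - sp.rotation i j" and ?S = "fermionic_sum m d :: 'n sp fock_op"
  have "critical_null (sp.rotation i j)"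
    unfolding sp.rotation_def sp.D\<psi>_def sp.D\<phi>_def
    using assms idx_prime_eq_iff[of i j] by (intro null_add null_fermion_bilinear(3,4)) auto
  then have null: "sp.rotation i j * ?S \<in> critical_kernel" "?S * sp.rotation i j \<in> critical_kernel"
    by (simp_all add: coefficient_ideal.null_def)
  have "commutator_is ?e (sp.Q (- 1)) 0"
    using commutator_is_left(2)[OF sp.f_Q[of 0 "- 1" i j] sp.rotation_Q[of i j "- 1"]] by simp
  then have Q: "?e * sp.Q (- 1) = sp.Q (- 1) * ?e" by (simp add: commutator_is_def)
  have "commutator_is (sp.rotation i j) tau_op (0 + 0 + 0 + 0)"
    unfolding sp.rotation_def by (intro commutator_is_left sp.\<tau>_commutes_operators)
  then have \<tau>: "?e * tau_op = tau_op * ?e"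
    using sp.\<tau>_f(2)[of i j] by (simp add: commutator_is_def algebra_simps)
  have "commutator_is (sp_current 0 i j) sp.\<gamma> 0"
    unfolding sp.\<gamma>_def commutator_is_def
    by (simp add: sum_distrib_left sum_distrib_right sp.f_commutes_mult current_commutes sp.f_\<psi>h)
  then have \<gamma>: "?e * sp.\<gamma> = sp.\<gamma> * ?e"
    using sp.rotation_\<gamma>[of i j] by (simp add: commutator_is_def algebra_simps)
  interpret tau_line critical_kernel tau_op "sp.Q (- 1)" ..
  have "?e * (sp.\<gamma> ^ k * fps_nth (L ^ m) r) = sp.\<gamma> ^ k * fps_nth (L ^ m) r * ?e" for k r
  proof -
    have "?e * sp.\<gamma> ^ k = sp.\<gamma> ^ k * ?e"
      by (rule power_commuting_commutes[symmetric]) (rule \<gamma>[symmetric])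
    moreover have "?e * fps_nth (L ^ m) r = fps_nth (L ^ m) r * ?e"
      by (rule coeff_power_commutes[OF \<tau> Q])
    ultimately show ?thesis by (rule mult_commutes)
  qed
  then have "?e * ?S = ?S * ?e"
    unfolding fermionic_sum_def sum_distrib_left sum_distrib_right
    by (intro sum.cong refl) (simp only: mult_of_int_left[of ?e] mult_of_nat_left[of ?e] mult.assoc)
  then have "sp_current 0 i j * ?S = ?S * sp_current 0 i j - ?S * sp.rotation i j + sp.rotation i j * ?S"
    by (simp add: algebra_simps)
  then show ?thesis
    using null annihilates_current[of 0 ?S "sp_elem i j"] by (simp add: coefficient_ideal.N_add coefficient_ideal.N_diff)
qed

section \<open>Sums over orderings\<close>

definition delete_nth :: "nat \<Rightarrow> 'a list \<Rightarrow> 'a list" where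
  "delete_nth k xs = take k xs @ drop (Suc k) xs"

text \<open>Without the factorial, splitting off the first letter is an exact recursion.\<close>

definition ordering_sum :: "('a list \<Rightarrow> 'b::comm_monoid_add) \<Rightarrow> 'a list \<Rightarrow> 'b" where
  "ordering_sum g xs = (\<Sum>\<sigma> | \<sigma> permutes {..<length xs}. g (permute_list \<sigma> xs))"

lemma delete_nth_map: "delete_nth k (map f xs) = map f (delete_nth k xs)"
  by (simp add: delete_nth_def take_map drop_map)

lemma mset_delete_nth: "k < length xs \<Longrightarrow> mset xs = add_mset (xs ! k) (mset (delete_nth k xs))"
  by (subst id_take_nth_drop[of k xs]) (simp_all add: delete_nth_def)

lemma permute_list_bij:
  assumes "distinct xs"
  shows "bij_betw (\<lambda>\<sigma>. permute_list \<sigma> xs) {\<sigma>. \<sigma> permutes {..<length xs}} (permutations_of_set (set xs))"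
  unfolding bij_betw_def
proof
  show "inj_on (\<lambda>\<sigma>. permute_list \<sigma> xs) {\<sigma>. \<sigma> permutes {..<length xs}}"
  proof (rule inj_onI, safe)
    fix \<sigma> \<pi>
    assume \<sigma>: "\<sigma> permutes {..<length xs}" and \<pi>: "\<pi> permutes {..<length xs}"
      and eq: "permute_list \<sigma> xs = permute_list \<pi> xs"
    show "\<sigma> = \<pi>"
    proof
      fix i
      show "\<sigma> i = \<pi> i"
      proof (cases "i < length xs")
        case True
        then have "xs ! \<sigma> i = xs ! \<pi> i"
          using permute_list_nth[OF \<sigma>] permute_list_nth[OF \<pi>] eq by metis
        moreover have "\<sigma> i < length xs" "\<pi> i < length xs"
          using True permutes_in_image[OF \<sigma>, of i] permutes_in_image[OF \<pi>, of i] by auto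
        ultimately show ?thesis using assms by (simp add: nth_eq_iff_index_eq)
      next
        case False
        then show ?thesis using permutes_not_in[OF \<sigma>, of i] permutes_not_in[OF \<pi>, of i] by simp
      qed
    qed
  qed
  show "(\<lambda>\<sigma>. permute_list \<sigma> xs) ` {\<sigma>. \<sigma> permutes {..<length xs}} = permutations_of_set (set xs)"
  proof (intro equalityI subsetI)
    fix l assume "l \<in> (\<lambda>\<sigma>. permute_list \<sigma> xs) ` {\<sigma>. \<sigma> permutes {..<length xs}}"
    then show "l \<in> permutations_of_set (set xs)"
      using assms by (auto simp: permutations_of_set_def)
  next
    fix l assume "l \<in> permutations_of_set (set xs)"
    then have "mset l = mset xs"
      using assms by (metis permutations_of_setD set_eq_iff_mset_eq_distinct)
    then obtain \<sigma> where "\<sigma> permutes {..<length xs}" "permute_list \<sigma> xs = l"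
      by (rule mset_eq_permutation)
    then show "l \<in> (\<lambda>\<sigma>. permute_list \<sigma> xs) ` {\<sigma>. \<sigma> permutes {..<length xs}}" by blast
  qed
qed

lemma ordering_sum_map:
  assumes "distinct xs"
  shows "ordering_sum g (map f xs) = (\<Sum>l\<in>permutations_of_set (set xs). g (map f l))"
proof -
  have "ordering_sum g (map f xs) = (\<Sum>\<sigma> | \<sigma> permutes {..<length xs}. g (map f (permute_list \<sigma> xs)))"
    unfolding ordering_sum_def by (intro sum.cong) (auto simp: permute_list_map)
  also have "\<dots> = (\<Sum>l\<in>permutations_of_set (set xs). g (map f l))"
    by (rule sum.reindex_bij_betw[OF permute_list_bij[OF assms]])
  finally show ?thesis .
qed

text \<open>Letters may repeat, so the list is read as a function on its positions, which are
  distinct, and orderings of positions are sorted by their first entry.\<close>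

lemma ordering_sum_rec:
  assumes "xs \<noteq> []"
  shows "ordering_sum g xs = (\<Sum>k<length xs. ordering_sum (\<lambda>l. g (xs ! k # l)) (delete_nth k xs))"
proof -
  let ?N = "length xs"
  have set: "set [0..<?N] = {..<?N}" by auto
  have "ordering_sum g xs = ordering_sum g (map ((!) xs) [0..<?N])" by (simp add: map_nth)
  also have "\<dots> = (\<Sum>l\<in>permutations_of_set {..<?N}. g (map ((!) xs) l))"
    by (subst ordering_sum_map) (simp_all only: distinct_upt set)
  also have "permutations_of_set {..<?N} = (\<Union>k\<in>{..<?N}. (\<lambda>l. k # l) ` permutations_of_set ({..<?N} - {k}))"
    using assms by (intro permutations_of_set_nonempty) auto
  also have "(\<Sum>l\<in>\<dots>. g (map ((!) xs) l))
      = (\<Sum>k<?N. \<Sum>l\<in>(\<lambda>l. k # l) ` permutations_of_set ({..<?N} - {k}). g (map ((!) xs) l))"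
    by (rule sum.UNION_disjoint) auto
  also have "\<dots> = (\<Sum>k<?N. ordering_sum (\<lambda>l. g (xs ! k # l)) (delete_nth k xs))"
  proof (intro sum.cong refl)
    fix k assume "k \<in> {..<?N}"
    then have k: "k < ?N" by simp
    have "distinct (delete_nth k [0..<?N])"
      using mset_delete_nth[of k "[0..<?N]"] k by (metis distinct_upt length_upt mset_eq_imp_distinct_iff distinct.simps(2) minus_nat.diff_0 mset.simps(2))
    moreover have "set (delete_nth k [0..<?N]) = {..<?N} - {k}"
    proof -
      have "set [0..<?N] = insert k (set (delete_nth k [0..<?N]))"
        using arg_cong[OF mset_delete_nth[of k "[0..<?N]"], of set_mset] k by simp
      moreover have "k \<notin> set (delete_nth k [0..<?N])"
        using mset_delete_nth[of k "[0..<?N]"] k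
        by (metis add_0 distinct.simps(2) distinct_upt length_upt minus_nat.diff_0 mset.simps(2) mset_eq_imp_distinct_iff nth_upt)
      ultimately show ?thesis using set by auto
    qed
    ultimately have "ordering_sum (\<lambda>l. g (xs ! k # l)) (delete_nth k (map ((!) xs) [0..<?N]))
       = (\<Sum>l\<in>permutations_of_set ({..<?N} - {k}). g (xs ! k # map ((!) xs) l))"
      by (simp add: delete_nth_map ordering_sum_map)
    then show "(\<Sum>l\<in>(\<lambda>l. k # l) ` permutations_of_set ({..<?N} - {k}). g (map ((!) xs) l))
      = ordering_sum (\<lambda>l. g (xs ! k # l)) (delete_nth k xs)"
      by (simp add: map_nth sum.reindex)
  qed
  finally show ?thesis .
qed

lemma ordering_sum_average:
  "ordering_average g xs = (1 / fact (length xs)) *\<^sub>C ordering_sum g xs"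
  by (simp add: ordering_average_def ordering_sum_def)

lemma scaleC_fact: "fact k *\<^sub>C ((1 / fact k) *\<^sub>C x) = (x :: 'a::complex_vector)"
  by simp

lemma ordering_sum_mset_cong:
  fixes g :: "'a list \<Rightarrow> 'b::complex_vector"
  assumes "mset xs = mset ys"
  shows "ordering_sum g xs = ordering_sum g ys"
proof -
  have "ordering_sum g xs = fact (length xs) *\<^sub>C ordering_average g xs"
    unfolding ordering_sum_average by (rule scaleC_fact[symmetric])
  also have "\<dots> = fact (length ys) *\<^sub>C ordering_average g ys"
    using ordering_average_mset_cong[OF assms, of g] mset_eq_length[OF assms] by simp
  also have "\<dots> = ordering_sum g ys"
    unfolding ordering_sum_average by (rule scaleC_fact)
  finally show ?thesis .
qed

definition tau_words :: "nat \<Rightarrow> 'g::quadratic_lie_algebra affine list \<Rightarrow> 'g affine uea" where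
  "tau_words r ys = ordering_sum tau_product (replicate r None @ map Some ys)"

lemma ordering_sum_comp:
  assumes "h 0 = 0" "\<And>u v. h (u + v) = h u + h v"
  shows "ordering_sum (\<lambda>l. h (g l)) xs = h (ordering_sum g xs)"
proof -
  have "h (sum f A) = (\<Sum>a\<in>A. h (f a))" for f :: "(nat \<Rightarrow> nat) \<Rightarrow> _" and A
    by (induction A rule: infinite_finite_induct) (simp_all add: assms)
  then show ?thesis by (simp add: ordering_sum_def)
qed

text \<open>The leftmost operator is one of r equal letters \<tau>, which acts as a derivation, or
  one of the y.\<close>

lemma tau_words_rec:
  assumes "r + length ys \<noteq> 0"
  shows "tau_words r ys = of_nat r * tau (tau_words (r - 1) ys)
     + (\<Sum>k<length ys. uea_gen (ys ! k) * tau_words r (delete_nth k ys))"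
proof -
  let ?xs = "replicate r None @ map Some ys"
  let ?t = "\<lambda>k. ordering_sum (\<lambda>l. tau_product (?xs ! k # l)) (delete_nth k ?xs)"
  have "?xs \<noteq> []" using assms by (cases r; cases ys) auto
  then have "tau_words r ys = (\<Sum>k<r + length ys. ?t k)"
    unfolding tau_words_def by (subst ordering_sum_rec) simp_all
  also have "\<dots> = (\<Sum>k<r. ?t k) + (\<Sum>k<length ys. ?t (r + k))"
    using sum.nat_group sum.atLeastLessThan_concat[of 0 r "r + length ys" ?t] sum.shift_bounds_nat_ivl[of ?t 0 r "length ys"]
    by (simp add: atLeast0LessThan add.commute)
  also have "(\<Sum>k<r. ?t k) = of_nat r * tau (tau_words (r - 1) ys)"
  proof -
    have "?t k = tau (tau_words (r - 1) ys)" if "k < r" for k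
    proof -
      have "?xs ! k = None" using that by (simp add: nth_append)
      then have "?t k = tau (ordering_sum tau_product (delete_nth k ?xs))"
        by (simp add: ordering_sum_comp[of tau] tau_add)
      also have "ordering_sum tau_product (delete_nth k ?xs) = tau_words (r - 1) ys"
        unfolding tau_words_def
      proof (rule ordering_sum_mset_cong)
        have "add_mset None (mset (delete_nth k ?xs)) = mset ?xs"
          using mset_delete_nth[of k ?xs] that \<open>?xs ! k = None\<close> by simp
        also have "\<dots> = add_mset None (mset (replicate (r - 1) None @ map Some ys))"
          using that by (cases r) simp_all
        finally show "mset (delete_nth k ?xs) = mset (replicate (r - 1) None @ map Some ys)" by simp
      qed
      finally show ?thesis .
    qed
    then show ?thesis by simp
  qed
  also have "(\<Sum>k<length ys. ?t (r + k)) = (\<Sum>k<length ys. uea_gen (ys ! k) * tau_words r (delete_nth k ys))"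
  proof (intro sum.cong refl)
    fix k assume "k \<in> {..<length ys}"
    then have "?xs ! (r + k) = Some (ys ! k)" "delete_nth (r + k) ?xs = replicate r None @ map Some (delete_nth k ys)"
      by (simp_all add: nth_append delete_nth_def take_map drop_map)
    then show "?t (r + k) = uea_gen (ys ! k) * tau_words r (delete_nth k ys)"
      by (simp add: tau_words_def ordering_sum_comp[of "\<lambda>u. uea_gen (ys ! k) * u"] distrib_left)
  qed
  finally show ?thesis .
qed

lemma tau_words_Nil: "tau_words 0 [] = 1"
  by (simp add: tau_words_def ordering_sum_def)

lemma symmetrisation_tau_words:
  "symmetrisation_tau r (c *\<^sub>C prod_list (map sym_gen ys)) = (c / fact (r + length ys)) *\<^sub>C tau_words r ys"
  by (simp add: symmetrisation_tau_monomial tau_words_def ordering_sum_def)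

lemma tau_product_Some: "tau_product (map Some ys) = prod_list (map uea_gen ys)"
  by (induction ys) simp_all

lemma symmetrisation_eq_tau: "symmetrisation F = symmetrisation_tau 0 F"
proof (induction F rule: symalg_induct)
  case zero
  show ?case
    using symmetrisation_add[of "0 :: 'a affine symalg" 0] symmetrisation_tau_add[of 0 "0 :: 'a affine symalg" 0] by simp
next
  case (monomial c ys)
  have "(\<Sum>\<sigma> | \<sigma> permutes {..<length ys}. prod_list (map uea_gen (permute_list \<sigma> ys)))
     = (\<Sum>\<sigma> | \<sigma> permutes {..<length ys}. tau_product (permute_list \<sigma> (map Some ys)))"
    by (intro sum.cong) (simp_all add: permute_list_map tau_product_Some)
  then show ?case
    by (simp add: symmetrisation_monomial symmetrisation_tau_monomial)
qed (simp add: symmetrisation_add symmetrisation_tau_add)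

section \<open>Words as coefficients of a fermionic operator\<close>

definition pair_op :: "'n::finite idx \<times> 'n idx \<Rightarrow> 'n sp fock_op" where
  "pair_op t = psi (fst t) * eta (snd t)"

definition pairs_op :: "('n::finite idx \<times> 'n idx) list \<Rightarrow> 'n sp fock_op" where
  "pairs_op ts = prod_list (map pair_op ts)"

definition letter :: "'n::finite idx \<times> 'n idx \<Rightarrow> 'n sp affine" where
  "letter t = loop_elem (F_sp (fst t) (snd t)) (- 1)"

lemma pair_commutes_odd:
  assumes "x * z = - (z * x)" "y * z = - (z * (y :: 'r::ring_1))"
  shows "x * y * z = z * (x * y)"
proof -
  have "x * y * z = x * (y * z)" by (rule mult.assoc)
  also have "\<dots> = - (x * z * y)" by (simp add: assms(2) mult.assoc)
  also have "\<dots> = z * (x * y)" by (simp add: assms(1) mult.assoc)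
  finally show ?thesis .
qed

lemma pair_op_commute: "pair_op s * pair_op t = pair_op t * pair_op s"
  unfolding pair_op_def psi_def eta_def
  by (rule mult_commutes) (rule pair_commutes_odd; rule create_create)+

lemma pair_op_pairs_op: "pair_op s * pairs_op ts = pairs_op ts * pair_op s"
proof (induction ts)
  case (Cons t ts)
  then show ?case
    unfolding pairs_op_def by (simp only: list.map prod_list.Cons) (rule mult_commutes, rule pair_op_commute)
qed (simp add: pairs_op_def)

lemma pairs_op_append: "pairs_op (us @ vs) = pairs_op us * pairs_op vs"
  by (simp add: pairs_op_def)

lemma pairs_op_Cons: "pairs_op (t # ts) = pair_op t * pairs_op ts"
  by (simp add: pairs_op_def)

lemma pairs_op_middle: "pairs_op (us @ t # vs) = pair_op t * pairs_op (us @ vs)"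
  by (simp only: pairs_op_append pairs_op_Cons mult.assoc[symmetric] pair_op_pairs_op[of t us])

lemma pairs_op_delete_nth:
  assumes "k < length ts"
  shows "pairs_op ts = pair_op (ts ! k) * pairs_op (delete_nth k ts)"
  using assms by (subst id_take_nth_drop[of k ts]) (simp_all add: pairs_op_middle delete_nth_def)

lemma pairs_op_mset_cong:
  "mset us = mset vs \<Longrightarrow> pairs_op us = pairs_op vs"
proof (induction us arbitrary: vs)
  case (Cons u us)
  then have "u \<in> set vs" by (metis list.set_intros(1) mset_eq_setD)
  then obtain xs ys where vs: "vs = xs @ u # ys" by (meson split_list)
  have "pairs_op us = pairs_op (xs @ ys)"
    using Cons.prems vs by (intro Cons.IH) simp
  with vs show ?case by (simp add: pairs_op_Cons pairs_op_middle)
qed (simp add: pairs_op_def)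

lemma left_mult_pairs_op:
  "left_mult u * pairs_op ts = pairs_op ts * left_mult u" "tau_op * pairs_op ts = pairs_op ts * tau_op"
proof -
  have 1: "left_mult u * pair_op t = pair_op t * left_mult u" "tau_op * pair_op t = pair_op t * tau_op" for t :: "'a idx \<times> 'a idx"
    unfolding pair_op_def psi_def eta_def by (rule mult_commutes; rule left_mult_commutes)+
  show "left_mult u * pairs_op ts = pairs_op ts * left_mult u"
  proof (induction ts)
    case (Cons t ts)
    with 1 show ?case unfolding pairs_op_Cons by (intro mult_commutes)
  qed (simp add: pairs_op_def)
  show "tau_op * pairs_op ts = pairs_op ts * tau_op"
  proof (induction ts)
    case (Cons t ts)
    with 1 show ?case unfolding pairs_op_Cons by (intro mult_commutes)
  qed (simp add: pairs_op_def)
qed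

text \<open>The sign and the prime from lowering the index occur once in \<open>chi\<close> and once
  in the current, and cancel.\<close>

lemma Q_pairs: "(sp.Q c :: 'n::finite sp fock_op) = (\<Sum>t\<in>UNIV. pair_op t * current (F_sp (fst t) (snd t)) c)"
proof -
  have "psi i * chi j * sp_current c i j = psi i * eta (idx_prime j) * current (F_sp i (idx_prime j)) c"
    for i j :: "'n idx"
  proof -
    have "sp_current c i j = of_int (int_sign j) * current (F_sp i (idx_prime j)) c"
      by (simp add: sp_elem_def idx_sign_eq current_of_int)
    then have "chi j * sp_current c i j = eta (idx_prime j) * current (F_sp i (idx_prime j)) c"
      by (simp only: chi_def of_int_mult_mult int_sign_square of_int_1 mult_1_left)
    then show ?thesis by (simp only: mult.assoc)
  qed
  then have "(sp.Q c :: 'n sp fock_op) = (\<Sum>i\<in>UNIV. \<Sum>j\<in>UNIV. psi i * eta (idx_prime j) * current (F_sp i (idx_prime j)) (c :: int))"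
    by (simp add: sp.Q_def)
  also have "\<dots> = (\<Sum>i\<in>UNIV. \<Sum>j\<in>UNIV. psi i * eta j * current (F_sp i j) c)"
    by (intro sum.cong refl sp.reindex_pr)
  also have "\<dots> = (\<Sum>t\<in>UNIV. pair_op t * current (F_sp (fst t) (snd t)) c)"
    unfolding sum.cartesian_product by (intro sum.cong) (auto simp: pair_op_def)
  finally show ?thesis .
qed

lemma Q_letters: "sp.Q (- 1) = (\<Sum>t\<in>UNIV. pair_op t * left_mult (uea_gen (letter t)))"
  by (simp only: Q_pairs) (simp only: current_def letter_def)

lemma finite_lists_length: "finite {ts :: 'a::finite list. length ts = m}"
  using finite_lists_length_eq[of "UNIV :: 'a set" m] by simp

lemma sum_delete_nth:
  assumes "k < m"
  shows "(\<Sum>ts | length ts = m. \<xi> (ts ! k) (delete_nth k ts))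
    = (\<Sum>t\<in>UNIV. \<Sum>ts | length ts = m - 1. \<xi> (t :: 'a::finite) ts)"
  unfolding sum.cartesian_product
  by (rule sum.reindex_bij_witness[of _ "\<lambda>(t, ts). take k ts @ t # drop k ts" "\<lambda>ts. (ts ! k, delete_nth k ts)"])
    (use assms in \<open>auto simp: delete_nth_def nth_append id_take_nth_drop[symmetric] min_def Suc_diff_le\<close>)

lemma op_apply_mult: "op_apply A (op_apply B g) = op_apply (A * B) g"
  by simp

lemma op_apply_sum_right: "op_apply A (\<lambda>S. \<Sum>t\<in>T. g t S) = (\<lambda>S. \<Sum>t\<in>T. op_apply A (g t) S)"
proof (induction T rule: infinite_finite_induct)
  case (insert t T)
  then show ?case by (simp add: op_apply_add_right)
qed simp_all

definition coefficient_vector :: "('n::finite idx \<times> 'n idx) list \<Rightarrow> 'n sp affine uea \<Rightarrow> nat set \<Rightarrow> 'n sp affine uea" where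
  "coefficient_vector ts u = op_apply (pairs_op ts) (vacuum u)"

lemma coefficient_vector_add: "coefficient_vector ts (u + v) S = coefficient_vector ts u S + coefficient_vector ts v S"
proof -
  have "vacuum (u + v) = (\<lambda>S. vacuum u S + vacuum v S)" by (auto simp: vacuum_def)
  then show ?thesis by (simp add: coefficient_vector_def op_apply_add_right)
qed

lemma coefficient_vector_zero: "coefficient_vector ts 0 S = 0"
  using coefficient_vector_add[of ts 0 0 S] by simp

lemma coefficient_vector_sum: "coefficient_vector ts (\<Sum>i\<in>A. u i) S = (\<Sum>i\<in>A. coefficient_vector ts (u i) S)"
  by (induction A rule: infinite_finite_induct) (simp_all add: coefficient_vector_add coefficient_vector_zero)

lemma coefficient_vector_of_nat: "coefficient_vector ts (of_nat k * u) S = of_nat k * coefficient_vector ts u S"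
  by (induction k) (simp_all add: coefficient_vector_add coefficient_vector_zero distrib_right)

lemma coefficient_vector_tau: "coefficient_vector ts (tau u) = op_apply tau_op (coefficient_vector ts u)"
  by (simp only: coefficient_vector_def vacuum_tau[symmetric] op_apply_mult left_mult_pairs_op)

lemma coefficient_vector_letter:
  assumes "k < length ts"
  shows "coefficient_vector ts (uea_gen (letter (ts ! k)) * u)
    = op_apply (pair_op (ts ! k) * left_mult (uea_gen (letter (ts ! k)))) (coefficient_vector (delete_nth k ts) u)"
  by (simp only: coefficient_vector_def vacuum_left_mult[symmetric] op_apply_mult
      pairs_op_delete_nth[OF assms] mult.assoc left_mult_pairs_op)

text \<open>A generating function: the Grassmann monomial in front of each symmetrised word records
  the rows and columns of the F_ij[-1] in it.\<close>

definition fock_words :: "nat \<Rightarrow> nat \<Rightarrow> nat set \<Rightarrow> 'n::finite sp affine uea" where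
  "fock_words r m S = (\<Sum>ts | length ts = m. coefficient_vector ts (tau_words r (map letter ts)) S)"

lemma fock_words_rec:
  assumes "r + m \<noteq> 0"
  shows "(fock_words r m S :: 'n::finite sp affine uea) = of_nat r * op_apply tau_op (fock_words (r - 1) m) S
     + of_nat m * op_apply (sp.Q (- 1)) (fock_words r (m - 1)) S"
proof -
  have fw: "(fock_words r m :: _ \<Rightarrow> 'n sp affine uea) = (\<lambda>S. \<Sum>ts | length ts = m. coefficient_vector ts (tau_words r (map letter ts)) S)" for r m
    by (simp add: fock_words_def fun_eq_iff)
  have Q: "(\<Sum>ts | length ts = m. coefficient_vector ts (uea_gen (letter (ts ! k)) * tau_words r (delete_nth k (map letter ts))) S)
      = op_apply (sp.Q (- 1) :: 'n sp fock_op) (fock_words r (m - 1)) S" if "k < m" for k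
  proof -
    let ?\<xi> = "\<lambda>(t :: 'n idx \<times> 'n idx) ts. op_apply (pair_op t * left_mult (uea_gen (letter t))) (coefficient_vector ts (tau_words r (map letter ts))) S"
    have "(\<Sum>ts | length ts = m. coefficient_vector ts (uea_gen (letter (ts ! k)) * tau_words r (delete_nth k (map letter ts))) S)
       = (\<Sum>ts | length ts = m. ?\<xi> (ts ! k) (delete_nth k ts))"
      using that by (intro sum.cong refl) (simp only: mem_Collect_eq delete_nth_map coefficient_vector_letter)
    also have "\<dots> = (\<Sum>t\<in>UNIV. \<Sum>ts | length ts = m - 1. ?\<xi> t ts)"
      by (rule sum_delete_nth[OF that])
    also have "\<dots> = op_apply (sp.Q (- 1)) (fock_words r (m - 1)) S"
      by (simp only: Q_letters op_apply_sum fw op_apply_sum_right) (rule sum.swap)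
    finally show ?thesis .
  qed
  have "(fock_words r m S :: 'n sp affine uea) = (\<Sum>ts | length ts = m. of_nat r * op_apply tau_op (coefficient_vector ts (tau_words (r - 1) (map letter ts))) S
      + (\<Sum>k<m. coefficient_vector ts (uea_gen (letter (ts ! k)) * tau_words r (delete_nth k (map letter ts))) S))"
    unfolding fock_words_def
  proof (intro sum.cong refl)
    fix ts :: "('n idx \<times> 'n idx) list" assume "ts \<in> {ts. length ts = m}"
    then have len: "length ts = m" by simp
    then have "tau_words r (map letter ts) = of_nat r * tau (tau_words (r - 1) (map letter ts))
       + (\<Sum>k<m. uea_gen (letter (ts ! k)) * tau_words r (delete_nth k (map letter ts)))"
      using tau_words_rec[of r "map letter ts"] assms by simp
    then show "coefficient_vector ts (tau_words r (map letter ts)) S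
       = of_nat r * op_apply tau_op (coefficient_vector ts (tau_words (r - 1) (map letter ts))) S
      + (\<Sum>k<m. coefficient_vector ts (uea_gen (letter (ts ! k)) * tau_words r (delete_nth k (map letter ts))) S)"
      by (simp only: coefficient_vector_add coefficient_vector_of_nat coefficient_vector_tau coefficient_vector_sum)
  qed
  also have "\<dots> = of_nat r * op_apply tau_op (fock_words (r - 1) m) S
      + (\<Sum>k<m. \<Sum>ts | length ts = m. coefficient_vector ts (uea_gen (letter (ts ! k)) * tau_words r (delete_nth k (map letter ts))) S)"
    by (simp only: sum.distrib fw op_apply_sum_right sum_distrib_left sum.swap[of _ "{..<m}"])
  also have "(\<Sum>k<m. \<Sum>ts | length ts = m. coefficient_vector (ts :: ('n idx \<times> 'n idx) list) (uea_gen (letter (ts ! k)) * tau_words r (delete_nth k (map letter ts))) S)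
      = of_nat m * op_apply (sp.Q (- 1)) (fock_words r (m - 1)) S"
    using Q by simp
  finally show ?thesis .
qed

lemma op_apply_of_nat_right: "op_apply A (\<lambda>S. of_nat k * g S) = (\<lambda>S. of_nat k * op_apply A g S)"
  by (induction k) (simp_all add: distrib_right op_apply_add_right)

text \<open>Both sides obey the recursion on the leftmost letter. The factor counts how r letters
  \<tau> and m letters from Q, all labelled, can be distributed over the places of a given
  word.\<close>

lemma fock_words_eq:
  "fock_words r m S = of_nat (fact r * fact m) * op_apply (fps_nth (tau_line.L tau_op (sp.Q (- 1)) ^ (r + m)) r) (vacuum 1) S"
proof (induction "r + m" arbitrary: r m S)
  case 0
  then show ?case
    by (simp add: fock_words_def coefficient_vector_def pairs_op_def tau_words_Nil)
next
  case (Suc N)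
  interpret tau_line critical_kernel tau_op "sp.Q (- 1) :: 'a sp fock_op" ..
  let ?c = "\<lambda>N r. op_apply (fps_nth (L ^ N) r) (vacuum 1)"
  have "of_nat r * op_apply tau_op (fock_words (r - 1) m) S
      = of_nat (fact r * fact m) * (if r = 0 then 0 else op_apply tau_op (?c N (r - 1)) S)"
  proof (cases r)
    case (Suc r')
    then have "fock_words r' m = (\<lambda>S. of_nat (fact r' * fact m) * ?c N r' S)"
      using Suc.hyps(1)[of r' m] Suc.hyps(2) by (auto simp: fun_eq_iff)
    then show ?thesis
      using Suc by (simp add: op_apply_of_nat_right mult.assoc algebra_simps del: op_apply_basic)
  qed simp
  moreover have "of_nat m * op_apply (sp.Q (- 1)) (fock_words r (m - 1)) S
      = of_nat (fact r * fact m) * op_apply (sp.Q (- 1)) (?c N r) S"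
  proof (cases m)
    case 0
    \<comment> \<open>Without letters Q the remaining N = r - 1 places cannot hold r letters
      \<tau>.\<close>
    then have "N < r" using Suc.hyps(2) by simp
    then show ?thesis using 0 by (simp add: coeff_power_eq_0)
  next
    case (Suc m')
    then have "fock_words r m' = (\<lambda>S. of_nat (fact r * fact m') * ?c N r S)"
      using Suc.hyps(1)[of r m'] Suc.hyps(2) by (auto simp: fun_eq_iff)
    then show ?thesis
      using Suc by (simp add: op_apply_of_nat_right mult.assoc algebra_simps del: op_apply_basic)
  qed
  moreover have "r + m \<noteq> 0" using Suc.hyps(2) by linarith
  ultimately show ?case
    using Suc.hyps(2)[symmetric] by (simp add: fock_words_rec coeff_L_mult distrib_left add.commute del: op_apply_basic of_nat_mult)
qed


section \<open>The top coefficient\<close>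

definition modes :: "'n::finite idx set \<Rightarrow> nat set" where
  "modes I = (\<Union>i\<in>I. {2 * Rep_idx i, 2 * Rep_idx i + 1})"

lemma mem_modes: "2 * Rep_idx i \<in> modes I \<longleftrightarrow> i \<in> I" "2 * Rep_idx i + 1 \<in> modes I \<longleftrightarrow> i \<in> I"
  by (auto simp: modes_def Rep_idx_inject even_neq_odd)

lemma modes_remove: "modes I - {2 * Rep_idx i} - {2 * Rep_idx i + 1} = modes (I - {i})"
  by (auto simp: modes_def Rep_idx_inject even_neq_odd)

text \<open>The two modes of index i are adjacent, so the same number of smaller modes is passed
  twice and the signs cancel.\<close>

lemma op_apply_pair_diagonal:
  "op_apply (pair_op (i, i)) g (modes I) = (if i \<in> I then g (modes (I - {i})) else 0)"
proof (cases "i \<in> I")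
  case True
  let ?p = "2 * Rep_idx i"
  have "{q \<in> modes I. q < ?p + 1} = insert ?p {q \<in> modes I. q < ?p}"
    using True mem_modes(1)[of i I] by auto
  moreover have "finite {q \<in> modes I. q < ?p}" by (rule finite_subset[of _ "{..<?p}"]) auto
  ultimately have "flips (?p + 1) (modes I) \<longleftrightarrow> \<not> flips ?p (modes I)"
    by (simp add: flips_def card_insert_if)
  then have "flips (?p + 1) (modes I - {?p}) \<longleftrightarrow> flips ?p (modes I)"
    using True by (simp only: flips_remove mem_modes) simp
  then show ?thesis
    using True by (simp add: pair_op_def psi_def eta_def mem_modes mem_modes(2)[simplified] modes_remove[simplified])
next
  case False
  then show ?thesis by (simp add: pair_op_def psi_def mem_modes)
qed

lemma gamma_pairs: "sp.\<gamma> = - (\<Sum>i\<in>UNIV. pair_op (i, i :: 'n::finite idx))"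
proof -
  have "chi j * sp.\<psi>h j = - (pair_op (idx_prime j, idx_prime j))" for j :: "'n idx"
    by (simp only: chi_def sp.\<psi>h_def of_int_mult_mult int_sign_square pair_op_def psi_def eta_def fst_conv snd_conv
        create_create(1)[of "2 * Rep_idx _ + 1" "2 * Rep_idx _"]) simp
  then have "sp.\<gamma> = - (\<Sum>j\<in>UNIV. pair_op (idx_prime j, idx_prime j :: 'n idx))"
    by (simp add: sp.\<gamma>_def sum_negf)
  also have "(\<Sum>j\<in>UNIV. pair_op (idx_prime j, idx_prime j :: 'n idx)) = (\<Sum>j\<in>UNIV. pair_op (j, j))"
    by (rule sp.reindex_pr)
  finally show ?thesis .
qed

text \<open>Each factor removes one index from J, and a given I is reached through all q! orders of
  removing the q indices outside it.\<close>

lemma gamma_power: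
  fixes J :: "'n::finite idx set"
  shows "op_apply ((\<Sum>i\<in>UNIV. pair_op (i, i :: 'n idx)) ^ q) g (modes J)
    = of_nat (fact q) * (\<Sum>I | I \<subseteq> J \<and> card I + q = card J. g (modes I))"
proof (induction q arbitrary: J)
  case 0
  have "{I. I \<subseteq> J \<and> card I = card J} = {J}"
    using card_subset_eq[OF finite[of J]] by auto
  then show ?case by simp
next
  case (Suc q)
  let ?n = "\<Sum>i\<in>UNIV. pair_op (i, i :: 'n idx)"
  have "op_apply (?n ^ Suc q) g (modes J) = (\<Sum>i\<in>J. op_apply (?n ^ q) g (modes (J - {i})))"
  proof -
    have "op_apply (?n * A) g (modes J) = (\<Sum>i\<in>J. op_apply A g (modes (J - {i})))" for A
      by (simp only: times_fock_op.rep_eq op_apply_sum op_apply_pair_diagonal) (simp add: sum.If_cases)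
    then show ?thesis by (simp only: power_Suc)
  qed
  also have "\<dots> = of_nat (fact q) * (\<Sum>i\<in>J. \<Sum>I | I \<subseteq> J - {i} \<and> card I + q = card (J - {i}). g (modes I))"
    by (simp only: Suc.IH sum_distrib_left)
  also have "(\<Sum>i\<in>J. \<Sum>I | I \<subseteq> J - {i} \<and> card I + q = card (J - {i}). g (modes I))
     = (\<Sum>i\<in>J. \<Sum>I\<in>{I \<in> {I. I \<subseteq> J \<and> card I + Suc q = card J}. i \<notin> I}. g (modes I))"
  proof (intro sum.cong refl)
    fix i assume "i \<in> J"
    then have c: "card J = Suc (card (J - {i}))" by (rule card.remove[OF finite])
    show "{I. I \<subseteq> J - {i} \<and> card I + q = card (J - {i})} = {I \<in> {I. I \<subseteq> J \<and> card I + Suc q = card J}. i \<notin> I}"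
      unfolding c by auto
  qed
  also have "\<dots> = (\<Sum>I | I \<subseteq> J \<and> card I + Suc q = card J. \<Sum>i\<in>{i \<in> J. i \<notin> I}. g (modes I))"
    by (rule sum.swap_restrict) simp_all
  also have "\<dots> = (\<Sum>I | I \<subseteq> J \<and> card I + Suc q = card J. of_nat (Suc q) * g (modes I))"
  proof (intro sum.cong refl)
    fix I assume "I \<in> {I. I \<subseteq> J \<and> card I + Suc q = card J}"
    then have "card (J - I) = Suc q" by (auto simp: card_Diff_subset)
    moreover have "{i \<in> J. i \<notin> I} = J - I" by auto
    ultimately show "(\<Sum>i\<in>{i \<in> J. i \<notin> I}. g (modes I)) = of_nat (Suc q) * g (modes I)" by simp
  qed
  finally show ?case
    by (simp only: sum_distrib_left[symmetric] mult.assoc[symmetric] of_nat_mult[symmetric])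
      (simp only: fact_Suc of_nat_id mult.commute)
qed

text \<open>A Grassmann monomial vanishes as soon as a row or a column repeats, and otherwise lives
  on a single set of modes.\<close>

lemma coefficient_vector_support:
  assumes "coefficient_vector ts u S \<noteq> 0"
  shows "distinct (map fst ts) \<and> distinct (map snd ts)
    \<and> S = (\<lambda>i. 2 * Rep_idx i) ` fst ` set ts \<union> (\<lambda>i. 2 * Rep_idx i + 1) ` snd ` set ts"
  using assms
proof (induction ts arbitrary: S)
  case Nil
  then show ?case by (auto simp: coefficient_vector_def pairs_op_def vacuum_def split: if_splits)
next
  case (Cons t ts)
  let ?a = "2 * Rep_idx (fst t)" and ?b = "2 * Rep_idx (snd t) + 1"
  have "coefficient_vector (t # ts) u S = op_apply (psi (fst t)) (op_apply (eta (snd t)) (coefficient_vector ts u)) S"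
    by (simp add: coefficient_vector_def pairs_op_Cons pair_op_def)
  with Cons.prems have S: "?a \<in> S" "?b \<in> S - {?a}" "coefficient_vector ts u (S - {?a} - {?b}) \<noteq> 0"
    by (auto simp: psi_def eta_def split: if_splits)
  note IH = Cons.IH[OF S(3)]
  have "fst t \<notin> fst ` set ts" "snd t \<notin> snd ` set ts"
    using IH by blast+
  moreover have "S = insert ?a (insert ?b (S - {?a} - {?b}))" using S(1,2) by blast
  then have "S = insert ?a (insert ?b ((\<lambda>i. 2 * Rep_idx i) ` fst ` set ts \<union> (\<lambda>i. 2 * Rep_idx i + 1) ` snd ` set ts))"
    using IH by (simp only:)
  ultimately show ?case
    using IH by (simp add: insert_commute)
qed

lemma pair_op_swap: "pair_op (a, x) * pair_op (b, y) = - (pair_op (a, y) * pair_op (b, x))"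
proof -
  have "eta x * (psi b * eta y) = - (eta y * (psi b * eta x))"
  proof -
    have "eta x * (psi b * eta y) = - (psi b * (eta x * eta y))" for x y :: "'a idx"
      unfolding eta_def psi_def by (simp only: mult.assoc[symmetric] create_create(1)[of "2 * Rep_idx x + 1" "2 * Rep_idx b"] mult_minus_left)
    moreover have "eta x * eta y = - (eta y * eta x)"
      unfolding eta_def by (rule create_create)
    ultimately show ?thesis by simp
  qed
  then show ?thesis by (simp add: pair_op_def mult.assoc)
qed

lemma coefficient_vector_identity:
  "distinct xs \<Longrightarrow> coefficient_vector (map (\<lambda>i. (i, i)) xs) u (modes (set xs)) = u"
proof (induction "xs")
  case Nil
  then show ?case by (simp add: coefficient_vector_def pairs_op_def vacuum_def modes_def)
next
  case (Cons i "xs")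
  then have "set (i # xs) - {i} = set xs" by auto
  with Cons show ?case
    by (simp add: coefficient_vector_def pairs_op_Cons op_apply_pair_diagonal del: op_apply_basic)
qed

text \<open>Composing with a transposition exchanges the columns of two pairs, which reverses the
  sign of the monomial; the identity gives 1.\<close>

lemma coefficient_vector_permutation:
  assumes "\<sigma> permutes I" and xs: "distinct xs" "set xs = I"
  shows "coefficient_vector (map (\<lambda>i. (i, \<sigma> i)) xs) u (modes I) = of_int (sign \<sigma>) * u"
proof -
  have "finite I" using xs(2) by auto
  from this assms(1) show ?thesis
  proof (induction rule: permutes_rev_induct)
    case id
    then show ?case using coefficient_vector_identity[OF xs(1), of u] xs(2) by (simp add: sign_id)
  next
    case (swap a b p)
    let ?q = "p \<circ> Transposition.transpose a b"
    define rest where "rest = filter (\<lambda>i. i \<noteq> a \<and> i \<noteq> b) xs"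
    have "distinct (a # b # rest)" "set xs = set (a # b # rest)"
      using swap xs by (auto simp: rest_def)
    then have ms: "mset xs = mset (a # b # rest)" 
      using xs(1) set_eq_iff_mset_eq_distinct by blast
    from \<open>distinct (a # b # rest)\<close>
    have rest: "map (\<lambda>i. (i, ?q i)) rest = map (\<lambda>i. (i, p i)) rest"
      by (auto simp: Transposition.transpose_def)
    have "pairs_op (map (\<lambda>i. (i, ?q i)) xs) = pairs_op (map (\<lambda>i. (i, ?q i)) (a # b # rest))"
      using ms by (intro pairs_op_mset_cong) (simp only: mset_map)
    also have "\<dots> = - pairs_op (map (\<lambda>i. (i, p i)) (a # b # rest))"
      by (simp only: list.map rest) (simp add: pairs_op_Cons mult.assoc[symmetric] pair_op_swap[of a "p b" b "p a"])
    also have "pairs_op (map (\<lambda>i. (i, p i)) (a # b # rest)) = pairs_op (map (\<lambda>i. (i, p i)) xs)"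
      using ms by (intro pairs_op_mset_cong) (simp only: mset_map)
    finally have "coefficient_vector (map (\<lambda>i. (i, ?q i)) xs) u (modes I) = - (of_int (sign p) * u)"
      using swap.IH by (simp add: coefficient_vector_def)
    moreover have "sign ?q = - sign p"
      using swap \<open>finite I\<close> by (subst sign_compose) (auto simp: sign_swap_id permutation_swap_id intro: permutes_imp_permutation)
    ultimately show ?case by (simp only: of_int_minus mult_minus_left)
  qed
qed

lemma modes_eq_iff:
  assumes "modes I = (\<lambda>i. 2 * Rep_idx i) ` A \<union> (\<lambda>i. 2 * Rep_idx i + 1) ` B"
  shows "A = I" "B = I"
proof -
  have "i \<in> A \<longleftrightarrow> i \<in> I" "i \<in> B \<longleftrightarrow> i \<in> I" for i
    using mem_modes[of i I] unfolding assms by (auto simp: Rep_idx_inject even_neq_odd)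
  then show "A = I" "B = I" by auto
qed

text \<open>A list contributes at \<open>modes I\<close> only if its rows and its columns each run
  through I once. Such a list is an ordering of I together with a permutation of I, and the sign
  turns the sum into determinants.\<close>

lemma sum_coefficient_vector:
  fixes I :: "'n::finite idx set" and u :: "_ \<Rightarrow> 'n sp affine uea"
  shows "(\<Sum>ts | length ts = card I. coefficient_vector ts (u ts) (modes I))
    = (\<Sum>xs\<in>permutations_of_set I. \<Sum>\<sigma> | \<sigma> permutes I. of_int (sign \<sigma>) * u (map (\<lambda>i. (i, \<sigma> i)) xs))"
proof -
  let ?P = "permutations_of_set I \<times> {\<sigma>. \<sigma> permutes I}"
  let ?h = "\<lambda>(xs, \<sigma>). map (\<lambda>i. (i, \<sigma> i)) (xs :: 'n idx list)"
  have inj: "inj_on ?h ?P"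
  proof (rule inj_onI, clarify)
    fix xs ys \<sigma> \<pi>
    assume "xs \<in> permutations_of_set I" "ys \<in> permutations_of_set I" "\<sigma> permutes I" "\<pi> permutes I"
      and eq: "map (\<lambda>i. (i, \<sigma> i)) xs = map (\<lambda>i. (i, \<pi> i)) ys"
    have "xs = ys" using arg_cong[OF eq, of "map fst"] by (simp add: o_def)
    moreover have "\<sigma> i = \<pi> i" for i
    proof (cases "i \<in> I")
      case True
      then have "i \<in> set xs" using \<open>xs \<in> _\<close> by (simp add: permutations_of_setD)
      then show ?thesis using eq \<open>xs = ys\<close> by simp
    next
      case False
      then show ?thesis using \<open>\<sigma> permutes I\<close> \<open>\<pi> permutes I\<close> by (simp add: permutes_not_in)
    qed
    ultimately show "xs = ys \<and> \<sigma> = \<pi>" by auto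
  qed
  have sub: "?h ` ?P \<subseteq> {ts. length ts = card I}"
    by (auto simp: length_finite_permutations_of_set)
  have zero: "coefficient_vector ts (u ts) (modes I) = 0" if ts: "ts \<notin> ?h ` ?P" for ts
  proof (rule ccontr)
    assume "coefficient_vector ts (u ts) (modes I) \<noteq> 0"
    note supp = coefficient_vector_support[OF this]
    then have d: "distinct (map fst ts)" "distinct (map snd ts)" and I: "fst ` set ts = I" "snd ` set ts = I"
      using modes_eq_iff[of I "fst ` set ts" "snd ` set ts"] by auto
    \<comment> \<open>The list of pairs serves as the graph of the permutation, which is extended by
      the identity outside I.\<close>
    define \<sigma> where "\<sigma> i = (if i \<in> I then the (map_of ts i) else i)" for i
    have \<sigma>: "\<sigma> (fst t) = snd t" if "t \<in> set ts" for t
    proof -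
      have "map_of ts (fst t) = Some (snd t)" using that d(1) by simp
      then show ?thesis using that I by (auto simp: \<sigma>_def)
    qed
    have "\<sigma> ` I = snd ` set ts"
      unfolding I(1)[symmetric] image_image using \<sigma> by (intro image_cong) auto
    then have img: "\<sigma> ` I = I" using I(2) by simp
    then have "bij_betw \<sigma> I I"
      by (simp add: bij_betw_def eq_card_imp_inj_on)
    then have "\<sigma> permutes I"
      by (rule bij_imp_permutes) (simp add: \<sigma>_def)
    moreover have "map fst ts \<in> permutations_of_set I"
      using d I by (auto simp: permutations_of_set_def)
    moreover have "ts = ?h (map fst ts, \<sigma>)"
    proof -
      have "map (\<lambda>t. (fst t, \<sigma> (fst t))) ts = map (\<lambda>t. t) ts"
        using \<sigma> by (intro map_cong) auto
      then show ?thesis by (simp add: o_def)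
    qed
    ultimately have "ts \<in> ?h ` ?P" by blast
    then show False using ts by contradiction
  qed
  have "(\<Sum>ts | length ts = card I. coefficient_vector ts (u ts) (modes I))
      = (\<Sum>ts\<in>?h ` ?P. coefficient_vector ts (u ts) (modes I))"
    by (rule sum.mono_neutral_right[OF finite_lists_length sub]) (use zero in blast)
  also have "\<dots> = (\<Sum>p\<in>?P. coefficient_vector (?h p) (u (?h p)) (modes I))"
    by (simp add: sum.reindex[OF inj])
  also have "\<dots> = (\<Sum>xs\<in>permutations_of_set I. \<Sum>\<sigma> | \<sigma> permutes I.
      coefficient_vector (map (\<lambda>i. (i, \<sigma> i)) xs) (u (map (\<lambda>i. (i, \<sigma> i)) xs)) (modes I))"
    by (simp add: sum.cartesian_product split_def)
  also have "\<dots> = (\<Sum>xs\<in>permutations_of_set I. \<Sum>\<sigma> | \<sigma> permutes I. of_int (sign \<sigma>) * u (map (\<lambda>i. (i, \<sigma> i)) xs))"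
    by (intro sum.cong refl coefficient_vector_permutation) (auto simp: permutations_of_setD)
  finally show ?thesis .
qed

lemma at_minus_one_sum: "at_minus_one (\<Sum>i\<in>A. F i) = (\<Sum>i\<in>A. at_minus_one (F i))"
  by (induction A rule: infinite_finite_induct) (simp_all add: at_minus_one_add)

lemma symmetrisation_tau_zero [simp]: "symmetrisation_tau r 0 = 0"
  using symmetrisation_tau_add[of r 0 0] by simp

lemma symmetrisation_tau_sum: "symmetrisation_tau r (\<Sum>i\<in>A. F i) = (\<Sum>i\<in>A. symmetrisation_tau r (F i))"
  by (induction A rule: infinite_finite_induct) (simp_all add: symmetrisation_tau_add)

text \<open>The left side does not depend on the ordering \<open>xs\<close>, so that all orderings
  of I contribute equally to the generating function.\<close>

lemma symmetrisation_tau_minor: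
  assumes "xs \<in> permutations_of_set I"
  shows "fact (r + card I) *\<^sub>C symmetrisation_tau r (at_minus_one (of_int z * (\<Prod>i\<in>I. sym_gen (F_sp i (\<sigma> i)))))
    = of_int z * tau_words r (map letter (map (\<lambda>i. (i, \<sigma> i)) xs))"
proof -
  have xs: "distinct xs" "set xs = I" "length xs = card I"
    using assms by (auto dest: permutations_of_setD length_finite_permutations_of_set)
  have "(\<Prod>i\<in>I. sym_gen (F_sp i (\<sigma> i))) = prod_list (map sym_gen (map (\<lambda>i. F_sp i (\<sigma> i)) xs))"
    using xs by (simp add: prod.distinct_set_conv_list[symmetric] o_def)
  then have "at_minus_one (of_int z * (\<Prod>i\<in>I. sym_gen (F_sp i (\<sigma> i))))
      = of_int z *\<^sub>C prod_list (map sym_gen (map letter (map (\<lambda>i. (i, \<sigma> i)) xs)))"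
    using at_minus_one_monomial[of "of_int z" "map (\<lambda>i. F_sp i (\<sigma> i)) xs"]
    by (simp add: of_int_scaleC letter_def o_def)
  then show ?thesis
    using xs by (simp only: symmetrisation_tau_words) (simp add: of_int_scaleC)
qed

lemma fock_words_modes:
  fixes I :: "'n::finite idx set"
  shows "fock_words r (card I) (modes I) = of_nat (fact (card I)) * (fact (r + card I) *\<^sub>C
    symmetrisation_tau r (at_minus_one (\<Sum>\<sigma> | \<sigma> permutes I. of_int (sign \<sigma>) * (\<Prod>i\<in>I. sym_gen (F_sp i (\<sigma> i))))))"
proof -
  have "fock_words r (card I) (modes I) = (\<Sum>xs\<in>permutations_of_set I. \<Sum>\<sigma> | \<sigma> permutes I.
      of_int (sign \<sigma>) * tau_words r (map letter (map (\<lambda>i. (i, \<sigma> i)) xs)))"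
    unfolding fock_words_def by (rule sum_coefficient_vector)
  also have "\<dots> = (\<Sum>xs\<in>permutations_of_set I. fact (r + card I) *\<^sub>C
    symmetrisation_tau r (at_minus_one (\<Sum>\<sigma> | \<sigma> permutes I. of_int (sign \<sigma>) * (\<Prod>i\<in>I. sym_gen (F_sp i (\<sigma> i))))))"
    by (simp only: at_minus_one_sum symmetrisation_tau_sum scaleC_sum_right)
      (intro sum.cong refl symmetrisation_tau_minor[symmetric])
  finally show ?thesis by simp
qed

lemma top_modes_eq: "top_modes TYPE('n::finite) = modes (UNIV :: 'n idx set)"
  by (simp add: top_modes_def modes_def)

lemma card_idx: "CARD('n::finite idx) = 2 * CARD('n)"
  using type_definition.card[OF type_definition_idx[where 'n = 'n]] by simp

lemma of_nat_scaleC: "of_nat k * u = of_nat k *\<^sub>C (u :: 'a::complex_algebra_1)"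
  by (subst of_nat_eq_scaleC) simp

text \<open>The power of \<gamma> removes the indices outside I, in q! orders, and its sign
  disappears because q is even. The m! orderings of I cancel against the m! in
  \<open>fock_words_eq\<close>.\<close>

lemma top_coefficient:
  assumes "even q" and "q + m = 2 * CARD('n::finite)"
  shows "op_apply (sp.\<gamma> ^ q * fps_nth (tau_line.L tau_op (sp.Q (- 1)) ^ (r + m)) r) (vacuum 1) (top_modes TYPE('n))
    = (fact q * fact (r + m) / fact r) *\<^sub>C symmetrisation_tau r (at_minus_one (Delta m :: 'n sp symalg))"
proof -
  let ?n = "\<Sum>i\<in>UNIV. pair_op (i, i :: 'n idx)"
  let ?A = "fps_nth (tau_line.L tau_op (sp.Q (- 1) :: 'n sp fock_op) ^ (r + m)) r"
  let ?X = "op_apply (sp.\<gamma> ^ q * ?A) (vacuum 1) (modes (UNIV :: 'n idx set))"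
  let ?\<Delta> = "\<lambda>I :: 'n idx set. \<Sum>\<sigma> | \<sigma> permutes I. of_int (sign \<sigma>) * (\<Prod>i\<in>I. sym_gen (F_sp i (\<sigma> i)))"
  let ?Y = "symmetrisation_tau r (at_minus_one (Delta m :: 'n sp symalg))"
  have \<gamma>: "sp.\<gamma> ^ q = ?n ^ q"
    using assms(1) by (simp add: gamma_pairs)
  have fw: "fock_words r m = (\<lambda>S. of_nat (fact r * fact m) * op_apply ?A (vacuum 1) S)"
    by (rule ext) (rule fock_words_eq)
  have "of_nat (fact r * fact m) * ?X = op_apply (?n ^ q) (fock_words r m) (modes (UNIV :: 'n idx set))"
    by (simp only: \<gamma> fw op_apply_of_nat_right times_fock_op.rep_eq)
  also have "\<dots> = of_nat (fact q) * (\<Sum>I\<in>{I :: 'n idx set. card I = m}. fock_words r m (modes I))"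
  proof -
    have "{I :: 'n idx set. I \<subseteq> UNIV \<and> card I + q = card (UNIV :: 'n idx set)} = {I. card I = m}"
      using assms(2) by (auto simp: card_idx)
    then show ?thesis by (simp only: gamma_power)
  qed
  also have "(\<Sum>I\<in>{I :: 'n idx set. card I = m}. fock_words r m (modes I))
      = (\<Sum>I | card I = m. of_nat (fact m) * (fact (r + m) *\<^sub>C symmetrisation_tau r (at_minus_one (?\<Delta> I))))"
    using fock_words_modes by (intro sum.cong) auto
  also have "\<dots> = of_nat (fact m) * (fact (r + m) *\<^sub>C ?Y)"
    by (simp only: Delta_def at_minus_one_sum symmetrisation_tau_sum scaleC_sum_right sum_distrib_left)
  finally have "(fact r * fact m) *\<^sub>C ?X = (fact q * (fact m * fact (r + m))) *\<^sub>C ?Y"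
    by (simp add: of_nat_scaleC mult.commute mult.left_commute)
  then have "(1 / (fact r * fact m)) *\<^sub>C ((fact r * fact m) *\<^sub>C ?X)
      = (1 / (fact r * fact m)) *\<^sub>C ((fact q * (fact m * fact (r + m))) *\<^sub>C ?Y)"
    by (rule arg_cong)
  moreover have "1 / (fact r * fact m) * (fact q * (fact m * fact (r + m))) = (fact q * fact (r + m) / fact r :: complex)"
    by simp
  ultimately show ?thesis
    by (simp only: scaleC_scaleC top_modes_eq) simp
qed

lemma tau_words_Suc_Nil: "tau_words (Suc r) [] = 0"
proof (induction r)
  case 0
  show ?case by (subst tau_words_rec) (simp_all add: tau_words_Nil tau_one)
next
  case (Suc r)
  then show ?case by (subst tau_words_rec) simp_all
qed

text \<open>Since \<Delta>_0 = 1 and \<tau> kills 1, the summand r = 2k of the fermionic sum drops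
  out.\<close>

lemma symmetrisation_tau_Delta_0:
  assumes "r \<noteq> 0"
  shows "symmetrisation_tau r (at_minus_one (Delta 0 :: 'n::finite sp symalg)) = 0"
proof -
  obtain r' where r: "r = Suc r'" using assms by (cases r) auto
  have "{I :: 'n idx set. card I = 0} = {{}}" by auto
  moreover have "{\<sigma>. \<sigma> permutes ({} :: 'n idx set)} = {id}" by auto
  ultimately have "(Delta 0 :: 'n sp symalg) = 1 *\<^sub>C prod_list (map sym_gen [])"
    by (simp add: Delta_def sign_id)
  then show ?thesis
    by (simp only: at_minus_one_monomial symmetrisation_tau_words) (simp add: r tau_words_Suc_Nil)
qed

section \<open>Membership in the negative subalgebra\<close>

lemma negative_subalgebra_closed:
  "0 \<in> negative_subalgebra"
  "1 \<in> negative_subalgebra"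
  "u \<in> negative_subalgebra \<Longrightarrow> v \<in> negative_subalgebra \<Longrightarrow> u + v \<in> negative_subalgebra"
  "u \<in> negative_subalgebra \<Longrightarrow> v \<in> negative_subalgebra \<Longrightarrow> u * v \<in> negative_subalgebra"
  "u \<in> negative_subalgebra \<Longrightarrow> c *\<^sub>C u \<in> negative_subalgebra"
proof -
  show "0 \<in> negative_subalgebra" "1 \<in> negative_subalgebra"
    using subalgebra.scalar[of 0] subalgebra.scalar[of 1] by (simp_all add: negative_subalgebra_def)
  show "u \<in> negative_subalgebra \<Longrightarrow> c *\<^sub>C u \<in> negative_subalgebra"
    unfolding negative_subalgebra_def using subalgebra.mult[OF subalgebra.scalar, of u _ c] by simp
qed (unfold negative_subalgebra_def, (rule subalgebra.intros; assumption)+)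

lemma tau_negative_subalgebra: "u \<in> negative_subalgebra \<Longrightarrow> tau u \<in> negative_subalgebra"
  unfolding negative_subalgebra_def
proof (induction rule: subalgebra.induct)
  case (scalar c)
  then show ?case
    using negative_subalgebra_closed(1) by (simp add: negative_subalgebra_def tau_scaleC tau_one)
next
  case (gen x)
  then obtain y a where x: "x = uea_gen (loop_elem y a)" "a < 0" by blast
  then have "uea_gen (loop_elem y (a - 1)) \<in> negative_subalgebra"
    unfolding negative_subalgebra_def by (intro subalgebra.gen) force
  then show ?case
    unfolding x(1) tau_loop_elem negative_subalgebra_def[symmetric] by (rule negative_subalgebra_closed)
next
  case (mult u v)
  then show ?case
    unfolding tau_mult by (intro subalgebra.add subalgebra.mult)
qed (simp add: tau_add subalgebra.add)

lemma symmetrisation_tau_negative: "symmetrisation_tau r (at_minus_one F) \<in> negative_subalgebra"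
proof (induction F rule: symalg_induct)
  case (monomial c ys)
  have word: "tau_product zs \<in> negative_subalgebra"
    if "set zs \<subseteq> insert None (Some ` range (\<lambda>y. loop_elem y (- 1)))" for zs :: "'a affine option list"
    using that
  proof (induction zs rule: tau_product.induct)
    case (3 y zs)
    then have "uea_gen y \<in> negative_subalgebra"
      unfolding negative_subalgebra_def by (intro subalgebra.gen) force
    with 3 show ?case by (simp add: negative_subalgebra_closed)
  qed (simp_all add: negative_subalgebra_closed tau_negative_subalgebra)
  let ?xs = "replicate r None @ map Some (map (\<lambda>y. loop_elem y (- 1)) ys)"
  have sum: "sum f A \<in> negative_subalgebra" if "\<And>a. a \<in> A \<Longrightarrow> f a \<in> negative_subalgebra"
    for f :: "(nat \<Rightarrow> nat) \<Rightarrow> 'a affine uea" and A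
    using that by (induction A rule: infinite_finite_induct) (auto simp: negative_subalgebra_closed)
  have "tau_words r (map (\<lambda>y. loop_elem y (- 1)) ys) \<in> negative_subalgebra"
    unfolding tau_words_def ordering_sum_def
  proof (rule sum, rule word)
    fix \<sigma> assume "\<sigma> \<in> {\<sigma>. \<sigma> permutes {..<length ?xs}}"
    then have "set (permute_list \<sigma> ?xs) = set ?xs" by (intro set_permute_list) simp
    then show "set (permute_list \<sigma> ?xs) \<subseteq> insert None (Some ` range (\<lambda>y. loop_elem y (- 1)))" by auto
  qed
  then show ?case
    by (simp only: at_minus_one_monomial symmetrisation_tau_words negative_subalgebra_closed)
qed (simp_all add: negative_subalgebra_closed at_minus_one_add symmetrisation_tau_add)

section \<open>Stabilisers of a vector of the vacuum module\<close>

definition kills_vector :: "complex \<Rightarrow> 'g::quadratic_lie_algebra affine uea \<Rightarrow> 'g affine \<Rightarrow> bool" where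
  "kills_vector \<kappa> s X \<longleftrightarrow> uea_gen X * s \<in> vacuum_ideal \<kappa>"

lemma kills_vector_add: "kills_vector \<kappa> s X \<Longrightarrow> kills_vector \<kappa> s Y \<Longrightarrow> kills_vector \<kappa> s (X + Y)"
  by (simp add: kills_vector_def uea_gen_add distrib_right vacuum_ideal_closed)

lemma kills_vector_scaleC: "kills_vector \<kappa> s X \<Longrightarrow> kills_vector \<kappa> s (c *\<^sub>C X)"
  by (simp add: kills_vector_def uea_gen_scaleC vacuum_ideal_closed)

lemma kills_vector_bracket:
  assumes "kills_vector \<kappa> s X" "kills_vector \<kappa> s Y"
  shows "kills_vector \<kappa> s (lie_bracket X Y)"
proof -
  have "uea_gen (lie_bracket X Y) * s = uea_gen X * (uea_gen Y * s) - uea_gen Y * (uea_gen X * s)"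
    by (simp add: uea_gen_commutator[symmetric] left_diff_distrib mult.assoc)
  then show ?thesis
    using assms by (simp add: kills_vector_def vacuum_ideal_closed)
qed

text \<open>The cocycle has the factor a and lives on a + b = 0, so the third hypothesis removes the
  central term.\<close>

lemma kills_vector_loop_bracket:
  assumes "kills_vector \<kappa> s (loop_elem x a)" "kills_vector \<kappa> s (loop_elem y b)" "a = 0 \<or> a + b \<noteq> 0"
  shows "kills_vector \<kappa> s (loop_elem (lie_bracket x y) (a + b))"
  using kills_vector_bracket[OF assms(1,2)] assms(3)
  by (cases "a = 0") (simp_all add: lie_bracket_loop_elem cong: if_cong)

lemma kills_vector_loop_scaleC:
  assumes "c \<noteq> 0" "kills_vector \<kappa> s (loop_elem (c *\<^sub>C x) a)"
  shows "kills_vector \<kappa> s (loop_elem x a)"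
  using kills_vector_scaleC[OF assms(2), of "1 / c"] assms(1) by (simp add: loop_elem_scaleC)

text \<open>The bracket of the lowered F_ii with F_i'l is a nonzero multiple of F_il. In degree 0
  this supplies the missing elements l = i'; with F_ii[1] in place of F_ii[0] it raises the degree
  by one.\<close>

lemma sp_generation:
  fixes s :: "'n::finite sp affine uea"
  assumes mode_0: "\<And>i j. j \<noteq> idx_prime i \<Longrightarrow> kills_vector \<kappa> s (loop_elem (sp_elem i j) 0)"
    and mode_1: "\<And>i. kills_vector \<kappa> s (loop_elem (sp_elem i i) 1)"
    and "a \<ge> 0"
  shows "kills_vector \<kappa> s (loop_elem x a)"
proof -
  have om: "omega i (idx_prime i) \<noteq> 0" for i :: "'n idx"
    using int_sign_square[of i] by (auto simp: omega_def)
  have step: "kills_vector \<kappa> s (loop_elem (sp_elem i l) (c + d))"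
    if "kills_vector \<kappa> s (loop_elem (sp_elem i i) c)" "kills_vector \<kappa> s (loop_elem (sp_elem (idx_prime i) l) d)"
      "c = 0 \<or> c + d \<noteq> 0" for i l and c d :: int
  proof -
    let ?w = "of_int (omega i (idx_prime i)) :: complex"
    \<comment> \<open>For l = i' all four terms of the bracket survive and coincide, otherwise only
      two of them.\<close>
    have "lie_bracket (sp_elem i i) (sp_elem (idx_prime i) l)
        = (if l = idx_prime i then 4 * ?w else 2 * ?w) *\<^sub>C sp_elem i l"
    proof -
      have two: "a *\<^sub>C z + a *\<^sub>C z = (2 * a) *\<^sub>C z" for a and z :: "'n sp"
        by (simp only: scaleC_add_left[symmetric] mult_2)
      moreover have "a *\<^sub>C z + a *\<^sub>C z + a *\<^sub>C z + a *\<^sub>C z = (4 * a) *\<^sub>C z" for a and z :: "'n sp"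
        using two[of "2 * a" z] by (simp add: add.assoc two[symmetric])
      ultimately show ?thesis
        by (cases "l = idx_prime i") (simp_all add: bracket_sp_elem omega_def)
    qed
    then have "kills_vector \<kappa> s (loop_elem ((if l = idx_prime i then 4 * ?w else 2 * ?w) *\<^sub>C sp_elem i l) (c + d))"
      using kills_vector_loop_bracket[OF that] by simp
    then show ?thesis
      by (rule kills_vector_loop_scaleC[rotated]) (use om in simp)
  qed
  have prime: "i \<noteq> idx_prime i" for i :: "'n idx" by simp
  have zero: "kills_vector \<kappa> s (loop_elem (sp_elem i l) 0)" for i l
  proof (cases "l = idx_prime i")
    case True
    then show ?thesis
      using step[of i 0 l 0] mode_0[of i i] mode_0[of "idx_prime i" "idx_prime i"] prime by simp
  qed (rule mode_0)
  have nat: "kills_vector \<kappa> s (loop_elem (sp_elem i l) (int k))" for i l k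
  proof (induction k arbitrary: i l)
    case (Suc k)
    have "kills_vector \<kappa> s (loop_elem (sp_elem i l) (1 + int k))"
      by (rule step[OF mode_1 Suc]) simp
    then show ?case by (simp add: add.commute)
  qed (simp add: zero)
  have sp: "kills_vector \<kappa> s (loop_elem (sp_elem i l) a)" for i l
    using nat[of i l "nat a"] \<open>a \<ge> 0\<close> by simp
  obtain c where c: "Rep_sp x = (\<Sum>i\<in>UNIV. \<Sum>j\<in>UNIV. c i j *\<^sub>C F_matrix i j)"
    using Rep_sp[of x] by blast
  have Rep_sum: "Rep_sp (\<Sum>i\<in>A. f i) = (\<Sum>i\<in>A. Rep_sp (f i))" for f :: "'n idx \<Rightarrow> 'n sp" and A
    by (induction A rule: infinite_finite_induct) (simp_all add: zero_sp.rep_eq plus_sp.rep_eq)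
  have F: "F_sp i j = idx_sign (idx_prime j) *\<^sub>C sp_elem i (idx_prime j)" for i j :: "'n idx"
    by (simp add: sp_elem_def)
  have "x = (\<Sum>i\<in>UNIV. \<Sum>j\<in>UNIV. c i j *\<^sub>C F_sp i j)"
    by (simp add: Rep_sp_inject[symmetric] Rep_sum c scaleC_sp.rep_eq F_sp.rep_eq)
  moreover have loop_sum: "kills_vector \<kappa> s (loop_elem (\<Sum>i\<in>A. f i) a)"
    if "\<And>i. kills_vector \<kappa> s (loop_elem (f i) a)" for f :: "'n idx \<Rightarrow> 'n sp" and A
  proof (induction A rule: infinite_finite_induct)
    case (insert i A)
    then show ?case using that by (simp add: loop_elem_add kills_vector_add)
  qed (simp_all add: kills_vector_def loop_elem_def zero_affine_def[symmetric] uea_gen_zero vacuum_ideal_closed)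
  ultimately show ?thesis
    by (simp only:) (intro loop_sum, simp only: F loop_elem_scaleC, intro kills_vector_scaleC sp)
qed

section \<open>The Segal-Sugawara vectors\<close>

lemma fermionic_sum_top:
  fixes k :: nat
  assumes "1 \<le> k" and "k \<le> CARD('n::finite)"
  defines "d \<equiv> 2 * CARD('n) - 2 * k"
  shows "op_apply (fermionic_sum (2 * k) d) (vacuum 1) (top_modes TYPE('n))
    = (fact (2 * k) * fact (d + 1)) *\<^sub>C (symmetrisation (at_minus_one (Delta (2 * k) :: 'n sp symalg))
    + (\<Sum>r\<in>{1..<k}. of_nat ((2 * CARD('n) - 2 * k + 2 * r + 1) choose (2 * r))
        * symmetrisation_tau (2 * r) (at_minus_one (Delta (2 * k - 2 * r)))))"
proof -
  let ?Y = "\<lambda>r. symmetrisation_tau r (at_minus_one (Delta (2 * k - r) :: 'n sp symalg))"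
  let ?T = "top_modes TYPE('n)"
  let ?X = "\<lambda>r. op_apply (sp.\<gamma> ^ (d + r) * fps_nth (tau_line.L tau_op (sp.Q (- 1)) ^ (2 * k)) r) (vacuum 1) ?T"
  have d: "even d" "d + 2 * k = 2 * CARD('n)" using assms(2) by (simp_all add: d_def)
  have X: "of_nat (d + r + 1) * ?X r = (fact (2 * k) * fact (d + 1)) *\<^sub>C (of_nat ((d + r + 1) choose r) * ?Y r)"
    if "r \<le> 2 * k" "even r" for r
  proof -
    have "?X r = (fact (d + r) * fact (2 * k) / fact r) *\<^sub>C ?Y r"
      using top_coefficient[of "d + r" "2 * k - r" r, where 'n = 'n] that d by simp
    moreover have "of_nat (d + r + 1) * (fact (d + r) * fact (2 * k) / fact r)
        = fact (2 * k) * fact (d + 1) * (of_nat ((d + r + 1) choose r) :: complex)"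
    proof -
      have "x * (y * z / w) = z * v * (x * y / (w * v))" if "v \<noteq> 0" for v w x y z :: complex
        using that by simp
      moreover have "(of_nat ((d + r + 1) choose r) :: complex) = of_nat (d + r + 1) * fact (d + r) / (fact r * fact (d + 1))"
        using binomial_fact[of r "d + r + 1", where 'a = complex] fact_Suc[of "d + r", where 'a = complex] by simp
      ultimately show ?thesis by (simp only: fact_nonzero not_False_eq_True)
    qed
    ultimately show ?thesis
      by (simp only: of_nat_scaleC scaleC_scaleC)
  qed
  have "op_apply (fermionic_sum (2 * k) d) (vacuum 1) ?T
      = (\<Sum>r\<le>2 * k. of_int (if even r then 1 else 0) * (of_nat (d + r + 1) * ?X r))"
    by (simp add: fermionic_sum_def del: op_apply_basic of_nat_add of_nat_Suc)
  also have "\<dots> = (\<Sum>r | r \<le> 2 * k \<and> even r. of_nat (d + r + 1) * ?X r)"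
    by (rule sum.mono_neutral_cong_right) auto
  also have "\<dots> = (\<Sum>r\<le>k. of_nat (d + 2 * r + 1) * ?X (2 * r))"
    by (rule sum.reindex_bij_witness[of _ "\<lambda>r. 2 * r" "\<lambda>r. r div 2"]) auto
  also have "\<dots> = (fact (2 * k) * fact (d + 1)) *\<^sub>C (\<Sum>r\<le>k. of_nat ((d + 2 * r + 1) choose (2 * r)) * ?Y (2 * r))"
    by (simp only: scaleC_sum_right) (intro sum.cong refl X, auto)
  \<comment> \<open>The term r = 0 has binomial coefficient 1, and the term r = k involves
    \<tau>^(2k) applied to \<Delta>_0 and vanishes.\<close>
  also have "(\<Sum>r\<le>k. of_nat ((d + 2 * r + 1) choose (2 * r)) * ?Y (2 * r))
     = ?Y 0 + (\<Sum>r\<in>{1..<k}. of_nat ((d + 2 * r + 1) choose (2 * r)) * ?Y (2 * r))"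
  proof -
    have "{..k} = insert 0 (insert k {1..<k})" using assms(1) by auto
    moreover have "?Y (2 * k) = 0" using symmetrisation_tau_Delta_0[of "2 * k"] assms(1) by simp
    ultimately show ?thesis using assms(1) by simp
  qed
  finally show ?thesis
    by (simp only: symmetrisation_eq_tau d_def) simp
qed

theorem theorem4p4:
  fixes k :: nat
  assumes "1 \<le> k" and "k \<le> CARD('n::finite)"
  shows "symmetrisation (at_minus_one (Delta (2 * k)))
    + (\<Sum>r\<in>{1..<k}. of_nat ((2 * CARD('n) - 2 * k + 2 * r + 1) choose (2 * r))
        * symmetrisation_tau (2 * r) (at_minus_one (Delta (2 * k - 2 * r))))
    \<in> (feigin_frenkel_centre :: 'n sp affine uea set)"
proof -
  let ?\<kappa> = "- of_nat (CARD('n) + 1) :: complex" and ?d = "2 * CARD('n) - 2 * k"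
  let ?c = "fact (2 * k) * fact (?d + 1) :: complex"
  define S :: "'n sp affine uea" where "S = symmetrisation (at_minus_one (Delta (2 * k)))
    + (\<Sum>r\<in>{1..<k}. of_nat ((2 * CARD('n) - 2 * k + 2 * r + 1) choose (2 * r))
        * symmetrisation_tau (2 * r) (at_minus_one (Delta (2 * k - 2 * r))))"
  have top: "op_apply (fermionic_sum (2 * k) ?d) (vacuum 1) (top_modes TYPE('n)) = ?c *\<^sub>C S"
    unfolding S_def by (rule fermionic_sum_top[OF assms])
  \<comment> \<open>The scalar \<open>?c\<close> is a product of factorials, so invariance of the
    top coefficient passes to \<open>S\<close> after division.\<close>
  have kills: "kills_vector ?\<kappa> S (loop_elem y a)"
    if "current y a * fermionic_sum (2 * k) ?d \<in> critical_kernel" for y a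
  proof -
    have "?c *\<^sub>C (uea_gen (loop_elem y a) * S) \<in> vacuum_ideal ?\<kappa>"
      using that by (simp add: coefficient_ideal_def current_def top del: minus_add_distrib)
    then have "(1 / ?c) *\<^sub>C (?c *\<^sub>C (uea_gen (loop_elem y a) * S)) \<in> vacuum_ideal ?\<kappa>"
      by (rule vacuum_ideal_closed(6))
    moreover have "?c \<noteq> 0" by (simp only: mult_eq_0_iff fact_nonzero simp_thms)
    then have "(1 / ?c) *\<^sub>C (?c *\<^sub>C u) = u" for u :: "'n sp affine uea"
      by (simp only: scaleC_scaleC nonzero_eq_divide_eq[symmetric] times_divide_eq_left mult_1_left divide_self scaleC_one not_False_eq_True)
    ultimately show ?thesis by (simp only: kills_vector_def)
  qed
  have "kills_vector ?\<kappa> S (loop_elem x a)" if "a \<ge> 0" for x a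
  proof (rule sp_generation[OF _ _ that])
    fix i j :: "'n idx" assume "j \<noteq> idx_prime i"
    then show "kills_vector ?\<kappa> S (loop_elem (sp_elem i j) 0)"
      by (intro kills current_mode_0)
  next
    fix i :: "'n idx"
    have e: "2 * k - 2 + 2 = 2 * k" using assms(1) by simp
    have "current ((1 / 2) *\<^sub>C sp_elem i i) 1 * fermionic_sum (2 * k - 2 + 2) ?d \<in> critical_kernel"
      by (rule current_mode_1) (use assms in simp)
    then have "kills_vector ?\<kappa> S (loop_elem ((1 / 2) *\<^sub>C sp_elem i i) 1)"
      unfolding e by (rule kills)
    then show "kills_vector ?\<kappa> S (loop_elem (sp_elem i i) 1)"
      by (rule kills_vector_loop_scaleC[rotated]) simp
  qed
  moreover have "S \<in> negative_subalgebra"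
  proof -
    have sum: "sum f A \<in> negative_subalgebra" if "\<And>r. f r \<in> negative_subalgebra"
      for f :: "nat \<Rightarrow> 'n sp affine uea" and A
      using that by (induction A rule: infinite_finite_induct) (auto simp: negative_subalgebra_closed)
    show ?thesis
      unfolding S_def symmetrisation_eq_tau of_nat_scaleC
      by (intro negative_subalgebra_closed sum symmetrisation_tau_negative)
  qed
  ultimately have "S \<in> feigin_frenkel_centre"
    unfolding feigin_frenkel_centre_def vacuum_invariants_def kills_vector_def by blast
  then show ?thesis by (simp only: S_def)
qed

end
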